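(* Let $(a,b)\in\partial\mathcal{H}$ with $0<b<1$ and $a+b>1$, where $\mathcal{H}$ is the set of all parameters $(a,b)$ with $a>0$, $0<b<1$ for which the Lozi map $L_{a,b}$ has homoclinic points for its fixed point $X$ in the first quadrant. Then the set of all homoclinic points for $X$ is one of the following: (1) the orbit of $Z$; (2) the orbit of $V$; (3) the union of the orbits of $Z$ and $V$; (4) the union of the orbits of the points on a segment joining $V$ with an iterate $Z^k$ ($k\in\mathbb{Z}$) of $Z$.
   Context: The Lozi map is the homeomorphism $L_{a,b}\colon\mathbb{R}^2\to\mathbb{R}^2$, $L_{a,b}(x,y)=(1+y-a|x|,\,bx)$. For $0<b<1$, $a+b>1$ it has the hyperbolic saddle fixed point $X=\bigl(\frac{1}{1+a-b},\frac{b}{1+a-b}\bigr)$. For a point $A$ and $k\in\mathbb{Z}$ put $A^k=L_{a,b}^k(A)$; the orbit of $A$ is $\{A^k:k\in\mathbb{Z}\}$, and its elements are the iterates of $A$. The unstable and stable manifolds of $X$ are $W_X^u=\{T: T^{-n}\to X \text{ as } n\to\infty\}$ and $W_X^s=\{T: T^{n}\to X \text{ as } n\to\infty\}$; they are polygonal lines. A homoclinic point for $X$ is a point $T\neq X$ with $T\in W_X^s\cap W_X^u$. $\mathcal{H}\subset\mathbb{R}^2$ is the set of all $(a,b)$ with $a>0$, $0<b<1$ such that $L_{a,b}$ has homoclinic points for $X$, and $\partial\mathcal{H}$ is its boundary in the parameter plane. The point $Z=\left(\frac{2}{2+a-\sqrt{a^2+4b}},\,0\right)$ is the first point at which the half of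 $W_X^u$ starting at $X$ and going to the right meets the positive $x$-axis. The point $V=\left(0,\,-\frac{2b}{-a+2b+\sqrt{a^2+4b}}\right)$ is the first point at which the half of $W_X^s$ starting at $X$ and going down meets the negative $y$-axis. A segment may be straight or polygonal. *)

theory Defs
  imports "HOL-Analysis.Analysis"
begin

definition lozi :: "real \<Rightarrow> real \<Rightarrow> real \<times> real \<Rightarrow> real \<times> real" where
  "lozi a b = (\<lambda>(x, y). (1 + y - a * \<bar>x\<bar>, b * x))"

lemma bij_lozi:
  assumes "b \<noteq> 0"
  shows "bij (lozi a b)"
proof (rule o_bij)
  show "(\<lambda>(u, v). (v / b, u - 1 + a * \<bar>v / b\<bar>)) \<circ> lozi a b = id"
    using assms by (auto simp: lozi_def fun_eq_iff abs_mult)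
  show "lozi a b \<circ> (\<lambda>(u, v). (v / b, u - 1 + a * \<bar>v / b\<bar>)) = id"
    using assms by (auto simp: lozi_def fun_eq_iff abs_mult)
qed

text \<open>Only used for \<open>b \<noteq> 0\<close>, where \<open>inv\<close> is the genuine inverse of the Lozi map.\<close>

definition lozi_iter :: "real \<Rightarrow> real \<Rightarrow> int \<Rightarrow> real \<times> real \<Rightarrow> real \<times> real" where
  "lozi_iter a b k =
     (if 0 \<le> k then lozi a b ^^ nat k else inv (lozi a b) ^^ nat (- k))"

definition lozi_orbit :: "real \<Rightarrow> real \<Rightarrow> real \<times> real \<Rightarrow> (real \<times> real) set" where
  "lozi_orbit a b A = range (\<lambda>k. lozi_iter a b k A)"

definition X_pt :: "real \<Rightarrow> real \<Rightarrow> real \<times> real" where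
  "X_pt a b = (1 / (1 + a - b), b / (1 + a - b))"

lemma lozi_X_pt:
  assumes "0 < a" "0 < b" "b < 1"
  shows "lozi a b (X_pt a b) = X_pt a b"
proof -
  define c where "c = 1 + a - b"
  have "0 < c" using assms by (simp add: c_def)
  then have "1 + b / c - a * (1 / c) = 1 / c"
    by (simp add: divide_simps) (simp add: c_def)
  with \<open>0 < c\<close> show ?thesis by (simp add: lozi_def X_pt_def c_def [symmetric])
qed

definition unstable_manifold :: "real \<Rightarrow> real \<Rightarrow> (real \<times> real) set" where
  "unstable_manifold a b = {T. (\<lambda>n. lozi_iter a b (- int n) T) \<longlonglongrightarrow> X_pt a b}"

definition stable_manifold :: "real \<Rightarrow> real \<Rightarrow> (real \<times> real) set" where
  "stable_manifold a b = {T. (\<lambda>n. lozi_iter a b (int n) T) \<longlonglongrightarrow> X_pt a b}"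

definition homoclinic_points :: "real \<Rightarrow> real \<Rightarrow> (real \<times> real) set" where
  "homoclinic_points a b = {T. T \<noteq> X_pt a b \<and> T \<in> stable_manifold a b \<inter> unstable_manifold a b}"

definition homoclinic_parameters :: "(real \<times> real) set" where
  "homoclinic_parameters = {(a, b). 0 < a \<and> 0 < b \<and> b < 1 \<and> homoclinic_points a b \<noteq> {}}"

text \<open>The eigenvalues of \<open>lozi a b\<close> at \<open>X_pt a b\<close> are \<open>(- a - sqrt (a\<^sup>2 + 4 * b)) / 2\<close>
  (unstable) and \<open>(- a + sqrt (a\<^sup>2 + 4 * b)) / 2\<close> (stable), an eigenvector for an eigenvalue
  \<open>l\<close> being \<open>(l, b)\<close>. The unstable line through \<open>X_pt a b\<close> meets the x-axis in \<open>Z_pt a b\<close>, and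
  the stable line meets the y-axis in \<open>V_pt a b\<close>.\<close>

definition Z_pt :: "real \<Rightarrow> real \<Rightarrow> real \<times> real" where
  "Z_pt a b = (2 / (2 + a - sqrt (a\<^sup>2 + 4 * b)), 0)"

definition V_pt :: "real \<Rightarrow> real \<Rightarrow> real \<times> real" where
  "V_pt a b = (0, - (2 * b / (- a + 2 * b + sqrt (a\<^sup>2 + 4 * b))))"

fun polygonal_path :: "'a::real_normed_vector list \<Rightarrow> real \<Rightarrow> 'a" where
  "polygonal_path [] = (\<lambda>t. 0)"
| "polygonal_path [p] = linepath p p"
| "polygonal_path [p, q] = linepath p q"
| "polygonal_path (p # q # r # vs) = linepath p q +++ polygonal_path (q # r # vs)"

text \<open>A straight or polygonal segment: a non-self-intersecting chain of finitely many line
  segments. Since an \<open>arc\<close> is injective, the endpoints \<open>p\<close> and \<open>q\<close> are distinct.\<close>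

definition polygonal_segment :: "'a::real_normed_vector \<Rightarrow> 'a \<Rightarrow> 'a set \<Rightarrow> bool" where
  "polygonal_segment p q S \<longleftrightarrow>
     (\<exists>vs. 2 \<le> length vs \<and> hd vs = p \<and> last vs = q \<and>
           arc (polygonal_path vs) \<and> path_image (polygonal_path vs) = S)"

end

theory Submission
  imports Defs
begin

text \<open>
Write \<open>a = u - l\<close> and \<open>b = u l\<close> with \<open>u > 1 > u l > 0\<close>.
Then \<open>-u\<close> and \<open>l\<close> are the eigenvalues of the right branch of the Lozi
map, whose fixed point is \<open>X\<close>, and \<open>u\<close> and \<open>-l\<close> are those
of the left branch, whose fixed point is called \<open>Y\<close> below. If the second coordinate
is divided by \<open>b\<close>, the map becomes \<open>stp\<close>: the second coordinate of a
point is the first coordinate of its predecessor. The four affine functionals \<open>pf\<close>,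
\<open>qf\<close>, \<open>tau\<close>, \<open>sg\<close> vanish on the stable and unstable lines
of \<open>X\<close> and on the stable and unstable lines of \<open>Y\<close>, and each of them
is multiplied by an eigenvalue.

The unstable manifold of \<open>X\<close> consists of \<open>X\<close> and the iterates \<open>F
n s\<close> of the points \<open>T s\<close> of a straight segment from \<open>X\<close>; every
orbit in it other than \<open>X\<close> passes through exactly one \<open>T s\<close> with
\<open>1/u\<^sup>2 < s \<le> 1\<close>, and \<open>s = 1\<close> is the orbit of
\<open>Z\<close>. The orbit of a point tends to \<open>X\<close> if and only if it lands, that
is, reaches the half-line \<open>pf = 0, x \<ge> 0\<close>. So the theorem describes the set
\<open>E\<close> of the landing parameters \<open>s\<close>.

If some curve \<open>F n\<close> crossed the landing half-line transversally, the crossing would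
persist for all nearby parameters, which would then all have homoclinic points. On the frontier
there is therefore no crossing (\<open>no_crossing\<close>). The first consequence,
\<open>F_not_tooth\<close>, is that the unstable manifold avoids a region called the tooth,
which is bounded by the unstable line of \<open>Y\<close> and by points whose successor is on
the landing half-line: following such a point back along the curve to \<open>X\<close> would
produce a crossing.

Everything else is derived from the avoidance of the tooth. The point \<open>Z = zz 0\<close>
and its even iterates \<open>zz 1\<close>, \<open>zz 2\<close>, ... are corners of the unstable
manifold as long as the iterates of \<open>Z\<close> alternate between the half planes. By
\<open>trichotomy\<close> either they spiral inwards or stop turning while still in the right
half plane, or some edge from \<open>zz k\<close> to \<open>zz (k + 1)\<close> crosses the axis
\<open>x = 0\<close>. In the first two cases the odd iterates stay in a convex hull in the right
half plane and can only land in a corner (\<open>hull_trap\<close>), so all homoclinic points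
are on the orbit of \<open>Z\<close>. In the third case the odd iterates that enter the left
half plane do so in a region bounded by two edges and the image of the axis; sliding a point of
this region that would reach the tooth until it hits the boundary shows that no such point
exists (\<open>no_tooth\<close>). Consequently the last phase of a landing orbit before it lands
starts on one of the two edges (\<open>ctooth_edge\<close>, \<open>landing\<close>).

If such an orbit meets the axis before it lands, then it passes through \<open>V\<close>: the
only difficult hit is the point where the edge itself is folded by the axis, and there the three
one-sided conditions of not entering the tooth contradict each other (\<open>fold\<close>,
\<open>axis_hit\<close>). Away from the axis the map \<open>F n\<close> is locally affine, so
near a landing parameter off the orbit of \<open>V\<close> the functional \<open>pf\<close> is
affine, vanishes at the parameter and does not change sign; hence it vanishes identically. Thus
\<open>E\<close> is open except at the at most one parameter \<open>v\<close> of the orbit of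
\<open>V\<close>. It is also closed, and it is not everything (\<open>not_all_land\<close>). So
between \<open>1/u\<^sup>2\<close> and \<open>1\<close> it is empty, \<open>{v}\<close>, or
everything on one side of \<open>v\<close>; in the last case the itinerary is constant on that
side, and a suitable \<open>F i\<close> maps it to a straight segment from \<open>V\<close> to
an iterate of \<open>Z\<close> (\<open>landing_set\<close>, \<open>classification\<close>).

It remains to see that frontier parameters have a homoclinic point at all. They are limits of
parameters that have one. On the part of the odd iterates in the left half plane,
\<open>tau\<close> is positive at the limit parameter (\<open>tau_pos_odd\<close>), hence
bounded away from zero nearby, and as \<open>tau\<close> grows by the factor \<open>u\<close>
with every left step, the landing times are bounded (\<open>land_bound\<close>). So a limit of
landing points is a landing point (\<open>limit_land\<close>).
\<close>

section \<open>Coordinates, invariant lines and the tooth\<close>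

locale lozi_uv =
  fixes u l :: real
  assumes u1: "1 < u" and l0: "0 < l" and ul1: "u * l < 1"
begin

lemma l1: "l < 1"
proof (rule ccontr)
  assume "\<not> l < 1"
  then have "1 * 1 \<le> u * l" using u1 by (intro mult_mono) auto
  with ul1 show False by simp
qed

lemma lu: "l < u" using l1 u1 by simp

definition a where "a = u - l"
definition b where "b = u * l"

lemma a0: "0 < a" using lu by (simp add: a_def)
lemma b0: "0 < b" using u1 l0 by (simp add: b_def)
lemma b1: "b < 1" using ul1 by (simp add: b_def)

text \<open>The Lozi map after division of the second coordinate by \<open>b\<close>. Its
branches \<open>brL\<close> and \<open>brR\<close> are used as affine maps of the whole plane.\<close>
definition stp :: "real \<times> real \<Rightarrow> real \<times> real" where
  "stp p = (1 + b * snd p - a * \<bar>fst p\<bar>, fst p)"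
definition brL :: "real \<times> real \<Rightarrow> real \<times> real" where
  "brL p = (1 + b * snd p + a * fst p, fst p)"
definition brR :: "real \<times> real \<Rightarrow> real \<times> real" where
  "brR p = (1 + b * snd p - a * fst p, fst p)"

lemma stp_L: "fst p \<le> 0 \<Longrightarrow> stp p = brL p" by (simp add: stp_def brL_def)
lemma stp_R: "0 \<le> fst p \<Longrightarrow> stp p = brR p" by (simp add: stp_def brR_def)
lemma snd_br [simp]: "snd (stp p) = fst p" "snd (brL p) = fst p" "snd (brR p) = fst p"
  by (simp_all add: stp_def brL_def brR_def)

text \<open>The zero sets are the stable line of \<open>X\<close>, the unstable line of
\<open>X\<close>, the stable line of \<open>Y\<close> and the unstable line of \<open>Y\<close>,
in this order.\<close>
definition pf where "pf p = fst p - l * snd p - 1 / (1 + u)"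
definition qf where "qf p = fst p + u * snd p - 1 / (1 - l)"
definition tau where "tau p = fst p + l * snd p + 1 / (u - 1)"
definition sg where "sg p = fst p - u * snd p - 1 / (1 + l)"

lemma pf_brR: "pf (brR p) = - u * pf p"
  using u1 unfolding pf_def brR_def a_def b_def by (simp add: field_simps)
lemma pf_brL: "pf (brL p) = - u * pf p + 2 * a * fst p"
  using u1 unfolding pf_def brL_def a_def b_def by (simp add: field_simps)
lemma qf_brR: "qf (brR p) = l * qf p"
  using l1 unfolding qf_def brR_def a_def b_def by (simp add: field_simps)
lemma qf_brL: "qf (brL p) = l * qf p + 2 * a * fst p"
  using l1 unfolding qf_def brL_def a_def b_def by (simp add: field_simps)
lemma tau_brL: "tau (brL p) = u * tau p"
  using u1 unfolding tau_def brL_def a_def b_def by (simp add: field_simps)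
lemma sg_brL: "sg (brL p) = - l * sg p"
  using l0 unfolding sg_def brL_def a_def b_def by (simp add: field_simps)

text \<open>The constant in \<open>fst_tau_sg\<close>, which expresses the first coordinate by
\<open>tau\<close> and \<open>sg\<close>: a left iterate is back in the right half plane as soon
as its \<open>tau\<close> is large.\<close>
definition dY where "dY = (u + l) / ((u - 1) * (1 + l))"
lemma dY0: "0 < dY" using u1 l0 unfolding dY_def by (intro divide_pos_pos mult_pos_pos) auto
lemma fst_tau_sg: "(u + l) * fst p = u * tau p + l * sg p - dY"
proof -
  have "u / (u - 1) - l / (1 + l) = dY"
    using u1 l0 unfolding dY_def by (simp add: field_simps)
  then show ?thesis unfolding tau_def sg_def using u1 l0 by (simp add: algebra_simps)
qed

lemma tau_iter: "tau ((brL ^^ n) p) = u ^ n * tau p" by (induction n) (simp_all add: tau_brL)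
lemma sg_iter: "sg ((brL ^^ n) p) = (- l) ^ n * sg p" by (induction n) (simp_all add: sg_brL)

text \<open>Points beyond the unstable line of \<open>Y\<close> that are on the side of the
stable line of \<open>X\<close> opposite to \<open>Zp\<close>, but whose left image is on the
same side as \<open>Zp\<close>.\<close>
definition tooth where "tooth p \<longleftrightarrow> 0 < sg p \<and> pf p < 0 \<and> 0 < pf (brL p)"
definition ctooth where "ctooth p \<longleftrightarrow> 0 \<le> sg p \<and> pf p \<le> 0 \<and> 0 \<le> pf (brL p)"

lemma kappa_gap: "(u - l) / ((1 + u) * (1 + l)) = 1 / (1 + l) - 1 / (1 + u)"
  using u1 l0 by (simp add: field_simps)

lemma kappa_pos: "0 < 1 / (1 + l) - 1 / (1 + u)"
  using u1 l0 lu by (subst kappa_gap[symmetric]) (intro divide_pos_pos mult_pos_pos; simp)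

lemma sg_pf_snd_neg: assumes "0 \<le> sg p" "pf p \<le> 0" shows "snd p < 0"
proof -
  have "sg p - pf p = - (u - l) * snd p - (1 / (1 + l) - 1 / (1 + u))"
    unfolding sg_def pf_def by (simp add: algebra_simps)
  moreover note kappa_pos
  ultimately have "(u - l) * snd p < 0" using assms by linarith
  then show ?thesis using lu by (simp add: mult_less_0_iff)
qed

lemma sg_kappa_snd_neg: assumes "0 \<le> sg p" "fst p \<le> 0" shows "snd p < 0"
proof -
  have "u * snd p \<le> - (1 / (1 + l))" using assms unfolding sg_def by simp
  moreover have "0 < 1 / (1 + l)" using l0 by simp
  ultimately have "u * snd p < 0" by linarith
  then show ?thesis using u1 by (simp add: mult_less_0_iff)
qed

lemma pf_stp_R: "0 \<le> fst p \<Longrightarrow> pf (stp p) = - u * pf p" by (simp add: stp_R pf_brR)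
lemma pf_stp_L: "fst p \<le> 0 \<Longrightarrow> pf (stp p) = pf (brL p)" by (simp add: stp_L)

text \<open>This form mentions only the actual successor, so the next point is on the same side
of the stable line as \<open>Zp\<close>. It also makes the tooth the positivity set of one
continuous function.\<close>
lemma tooth_iff: "tooth p \<longleftrightarrow> 0 < sg p \<and> 0 < pf (stp p)"
proof (cases "0 \<le> fst p")
  case True
  have "pf p < 0 \<longleftrightarrow> 0 < pf (stp p)" using u1 True by (simp add: pf_stp_R mult_less_0_iff)
  moreover have "pf p < 0 \<Longrightarrow> 0 < pf (brL p)" unfolding pf_brL
    using True a0 u1 by (intro add_pos_nonneg) (auto simp: mult_less_0_iff)
  ultimately show ?thesis unfolding tooth_def by auto
next
  case False
  have "0 < pf (brL p) \<Longrightarrow> pf p < 0"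
  proof -
    assume "0 < pf (brL p)"
    moreover have "2 * a * fst p \<le> 0" using False a0 by (simp add: mult_le_0_iff)
    ultimately have "u * pf p < 0" unfolding pf_brL by linarith
    then show ?thesis using u1 by (simp add: mult_less_0_iff)
  qed
  then show ?thesis using False unfolding tooth_def by (auto simp: pf_stp_L)
qed

text \<open>A path that leaves the closed tooth through \<open>pf \<circ> stp = 0\<close> really
crosses the half-line, not just the line.\<close>
lemma fst_stp_pos: assumes "0 \<le> sg p" "0 \<le> pf (stp p)" shows "0 < fst (stp p)"
proof (cases "0 \<le> fst p")
  case True
  have "0 \<le> fst (stp p) - l * fst p - 1 / (1 + u)" using assms(2) unfolding pf_def by simp
  moreover have "0 < 1 / (1 + u)" "0 \<le> l * fst p" using u1 l0 True by simp_all
  ultimately show ?thesis by linarith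
next
  case False
  let ?q = "stp p"
  have s: "sg ?q \<le> 0" using assms(1) False l0 by (simp add: stp_L sg_brL)
  have 1: "fst ?q \<ge> l * fst p + 1 / (1 + u)" using assms(2) unfolding pf_def by simp
  have 2: "fst ?q \<le> u * fst p + 1 / (1 + l)" using s unfolding sg_def by simp
  have "u * (fst ?q) - l * fst ?q \<ge> u * (l * fst p + 1 / (1 + u)) - l * (u * fst p + 1 / (1 + l))"
    using mult_left_mono[OF 1, of u] mult_left_mono[OF 2, of l] u1 l0 by linarith
  also have "u * (l * fst p + 1 / (1 + u)) - l * (u * fst p + 1 / (1 + l)) = u / (1 + u) - l / (1 + l)"
    by (simp add: algebra_simps)
  finally have "(u - l) * fst ?q \<ge> u / (1 + u) - l / (1 + l)" by (simp add: algebra_simps)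
  moreover have "u / (1 + u) - l / (1 + l) = 1 / (1 + l) - 1 / (1 + u)"
    using u1 l0 by (simp add: divide_simps) (simp add: algebra_simps)
  moreover note kappa_pos
  ultimately have "0 < (u - l) * fst ?q" by linarith
  then show ?thesis using lu by (simp add: zero_less_mult_iff)
qed

text \<open>The fixed point, the image of \<open>Z\<close>, and the points \<open>Z\<close> and
\<open>V\<close>, in the new coordinates.\<close>
definition Xp where "Xp = (1 / ((1 + u) * (1 - l)), 1 / ((1 + u) * (1 - l)))"
definition Z1 where "Z1 = ((1 - u) / (1 - l), 1 / (1 - l))"
definition Zp where "Zp = (1 / (1 - l), 0 :: real)"
definition Vp where "Vp = (0 :: real, - (1 / (l * (1 + u))))"

text \<open>The segment of the unstable manifold from \<open>X\<close> to the image of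
\<open>Z\<close>.\<close>
definition T where "T s = (1 - s) *\<^sub>R Xp + s *\<^sub>R Z1"
definition F where "F n s = (stp ^^ n) (T s)"

lemma F_0 [simp]: "F 0 s = T s" by (simp add: F_def)
lemma F_Suc: "F (Suc n) s = stp (F n s)" by (simp add: F_def)

lemma pf_Xp: "pf Xp = 0" using u1 l1 unfolding pf_def Xp_def by (simp add: divide_simps)
lemma qf_Xp: "qf Xp = 0" using u1 l1 unfolding qf_def Xp_def by (simp add: divide_simps)
lemma qf_Z1: "qf Z1 = 0" using u1 l1 unfolding qf_def Z1_def by (simp add: field_simps)
lemma xX0: "0 < fst Xp" "0 < snd Xp" "snd Xp = fst Xp" using u1 l1 by (simp_all add: Xp_def)
lemma stp_Xp: "stp Xp = Xp"
proof -
  have "(1 + u) * (1 - l) * (1 / ((1 + u) * (1 - l))) = 1" using u1 l1 by simp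
  then have "1 + (u * l) * (1 / ((1 + u) * (1 - l))) - (u - l) * (1 / ((1 + u) * (1 - l))) = 1 / ((1 + u) * (1 - l))"
    by algebra
  then show ?thesis using xX0 by (simp add: stp_def Xp_def a_def b_def)
qed

lemma pf_aff: "pf ((1 - t) *\<^sub>R p + t *\<^sub>R q) = (1 - t) * pf p + t * pf q"
proof -
  have "\<And>k::real. ((1 - t) * fst p + t * fst q) - l * ((1 - t) * snd p + t * snd q) - k
      = (1 - t) * (fst p - l * snd p - k) + t * (fst q - l * snd q - k)"
    by (simp add: algebra_simps)
  from this[of "1 / (1 + u)"] show ?thesis by (simp add: pf_def)
qed
lemma qf_aff: "qf ((1 - t) *\<^sub>R p + t *\<^sub>R q) = (1 - t) * qf p + t * qf q"
proof -
  have "\<And>k::real. ((1 - t) * fst p + t * fst q) + u * ((1 - t) * snd p + t * snd q) - k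
      = (1 - t) * (fst p + u * snd p - k) + t * (fst q + u * snd q - k)"
    by (simp add: algebra_simps)
  from this[of "1 / (1 - l)"] show ?thesis by (simp add: qf_def)
qed
lemma sg_aff: "sg ((1 - t) *\<^sub>R p + t *\<^sub>R q) = (1 - t) * sg p + t * sg q"
proof -
  have "\<And>k::real. ((1 - t) * fst p + t * fst q) - u * ((1 - t) * snd p + t * snd q) - k
      = (1 - t) * (fst p - u * snd p - k) + t * (fst q - u * snd q - k)"
    by (simp add: algebra_simps)
  from this[of "1 / (1 + l)"] show ?thesis by (simp add: sg_def)
qed
lemma fst_aff: "fst ((1 - t) *\<^sub>R p + t *\<^sub>R q) = (1 - t) * fst p + t * fst (q::real\<times>real)"
  by simp
lemma brL_aff: "brL ((1 - t) *\<^sub>R p + t *\<^sub>R q) = (1 - t) *\<^sub>R brL p + t *\<^sub>R brL q"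
  by (simp add: brL_def prod_eq_iff algebra_simps)
lemma brR_aff: "brR ((1 - t) *\<^sub>R p + t *\<^sub>R q) = (1 - t) *\<^sub>R brR p + t *\<^sub>R brR q"
  by (simp add: brR_def prod_eq_iff algebra_simps)
lemma brL_iter_aff: "(brL ^^ n) ((1 - t) *\<^sub>R p + t *\<^sub>R q) = (1 - t) *\<^sub>R (brL ^^ n) p + t *\<^sub>R (brL ^^ n) q"
  by (induction n) (simp_all add: brL_aff)

lemma qf_T: "qf (T s) = 0" by (simp add: T_def qf_aff qf_Xp qf_Z1)
lemma snd_T_pos: assumes "0 \<le> s" "s \<le> 1" shows "0 < snd (T s)"
proof -
  have "snd Xp > 0" "snd Z1 > 0" using u1 l1 by (simp_all add: Xp_def Z1_def)
  then have "0 < (1 - s) * snd Xp + s * snd Z1" using assms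
    by (cases "s = 0") (auto intro: add_nonneg_pos)
  then show ?thesis by (simp add: T_def)
qed
lemma pf_T: assumes "0 \<le> s" shows "pf (T s) \<le> 0" "s > 0 \<Longrightarrow> pf (T s) < 0"
proof -
  have "pf Z1 = (1 - u - l) / (1 - l) - 1 / (1 + u)"
    unfolding pf_def Z1_def by (simp add: diff_divide_distrib)
  moreover have "(1 - u - l) / (1 - l) < 0" using u1 l1 l0 by (intro divide_neg_pos) auto
  moreover have "0 < 1 / (1 + u)" using u1 by simp
  ultimately have z: "pf Z1 < 0" by linarith
  show "pf (T s) \<le> 0" "s > 0 \<Longrightarrow> pf (T s) < 0"
    using z assms by (auto simp: T_def pf_aff pf_Xp mult_le_0_iff mult_less_0_iff)
qed

lemma stp_cont: "isCont stp p" unfolding stp_def by (intro continuous_intros)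
lemma continuous_F: "continuous_on UNIV (F n)"
proof (induction n)
  case 0 then show ?case unfolding F_def T_def by (simp, intro continuous_intros)
next
  case (Suc n)
  have "F (Suc n) = (\<lambda>s. stp (F n s))" by (simp add: F_Suc fun_eq_iff)
  then show ?case unfolding stp_def by (simp) (intro continuous_intros Suc)
qed

lemma sg_snd_cases: "sg p = 0 \<Longrightarrow> 0 \<le> pf (stp p) \<Longrightarrow> snd p < 0"
proof (cases "0 \<le> fst p")
  case True
  assume "sg p = 0" "0 \<le> pf (stp p)"
  then show ?thesis using True u1 by (intro sg_pf_snd_neg) (auto simp: pf_stp_R mult_le_0_iff)
qed (auto intro: sg_kappa_snd_neg)

text \<open>The preimages of a point of the unstable line of \<open>Y\<close> with negative
second coordinate have the same property, whereas the segment \<open>T\<close> has positive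
second coordinates.\<close>
lemma F_not_kappa: assumes "0 \<le> s" "s \<le> 1" shows "\<not> (sg (F n s) = 0 \<and> snd (F n s) < 0)"
proof (induction n)
  case 0 then show ?case using snd_T_pos[OF assms] by simp
next
  case (Suc n)
  show ?case
  proof
    assume A: "sg (F (Suc n) s) = 0 \<and> snd (F (Suc n) s) < 0"
    then have x: "fst (F n s) < 0" by (simp add: F_Suc)
    then have "sg (F n s) = 0" using A l0 by (simp add: F_Suc stp_L sg_brL)
    moreover from this have "snd (F n s) < 0" using x by (intro sg_kappa_snd_neg) auto
    ultimately show False using Suc by blast
  qed
qed

text \<open>The curves \<open>F n\<close>, \<open>n \<le> B\<close>, do not change sides of the
stable line of \<open>X\<close> within the right half plane.\<close>
definition no_crossing where
  "no_crossing B \<longleftrightarrow> (\<forall>n\<le>B. \<forall>s1 s2. 0 \<le> s1 \<and> s1 \<le> s2 \<and> s2 \<le> 1 \<and> (\<forall>s\<in>{s1..s2}. 0 < fst (F n s))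
     \<longrightarrow> \<not> pf (F n s1) * pf (F n s2) < 0)"

lemma F_Xp: "F n 0 = Xp" by (induction n) (simp_all add: F_Suc stp_Xp T_def)

lemma cont_comp: "continuous_on UNIV (\<lambda>s. sg (F n s))" "continuous_on UNIV (\<lambda>s. pf (F n s))"
  "continuous_on UNIV (\<lambda>s. fst (F n s))" "continuous_on UNIV (\<lambda>s. tau (F n s))"
  unfolding sg_def pf_def tau_def by (intro continuous_intros continuous_F)+

lemma sg_Xp: "sg Xp < 0"
proof -
  have "sg Xp = fst Xp * (1 - u) - 1 / (1 + l)" using xX0(3) by (simp add: sg_def algebra_simps)
  moreover have "fst Xp * (1 - u) < 0" using xX0 u1 by (simp add: mult_pos_neg)
  moreover have "0 < 1 / (1 + l)" using l0 by simp
  ultimately show ?thesis by linarith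
qed

text \<open>Move the parameter from a point in the tooth down to \<open>X\<close>, which is
outside. The curve cannot leave through \<open>sg = 0\<close> by \<open>F_not_kappa\<close>, so
it leaves through \<open>pf \<circ> stp = 0\<close>, and there the next curve \<open>F (n +
1)\<close> crosses the landing half-line.\<close>
lemma F_not_tooth:
  assumes nc: "no_crossing B" and n: "Suc n \<le> B" and s: "0 \<le> s1" "s1 \<le> 1"
  shows "\<not> tooth (F n s1)"
proof
  assume "tooth (F n s1)"
  then have t1: "0 < sg (F n s1)" "0 < pf (F (Suc n) s1)" by (simp_all add: tooth_iff F_Suc)
  define P where "P s = min (sg (F n s)) (pf (F (Suc n) s))" for s
  have contP: "continuous_on UNIV P" unfolding P_def by (intro continuous_intros cont_comp)
  have P1: "P s1 > 0" using t1 by (simp add: P_def)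
  have P0: "P 0 < 0" using sg_Xp by (simp add: P_def F_Xp)
  have good: "0 < sg (F n s) \<and> 0 < fst (F (Suc n) s) \<and> 0 \<le> pf (F (Suc n) s)"
    if "0 \<le> P s" "0 \<le> s" "s \<le> 1" for s
  proof -
    have 1: "0 \<le> sg (F n s)" "0 \<le> pf (stp (F n s))" using that by (simp_all add: P_def F_Suc)
    have "sg (F n s) \<noteq> 0" using sg_snd_cases[OF _ 1(2)] F_not_kappa[of s n] that by blast
    then show ?thesis using 1 fst_stp_pos[OF 1] by (simp add: F_Suc)
  qed
  \<comment> \<open>Beyond the supremum the curve is in the closed tooth, but it is outside for parameters arbitrarily close to the supremum.\<close>
  define C where "C = {s. 0 \<le> s \<and> s \<le> s1 \<and> P s < 0}"
  have C0: "0 \<in> C" using P0 s by (simp add: C_def)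
  define s0 where "s0 = Sup C"
  have bdd: "bdd_above C" by (auto simp: C_def bdd_above_def)
  have s0b: "0 \<le> s0" "s0 \<le> s1" unfolding s0_def
    using C0 bdd by (auto intro: cSup_upper cSup_least simp: C_def)
  have after: "P s \<ge> 0" if "s0 < s" "s \<le> s1" for s
  proof (rule ccontr)
    assume "\<not> 0 \<le> P s"
    then have "s \<in> C" using that s0b by (simp add: C_def)
    then have "s \<le> s0" unfolding s0_def using bdd by (rule cSup_upper)
    then show False using that by simp
  qed
  have icP: "isCont P s0" using contP by (auto simp: continuous_on_eq_continuous_at)
  have Ps0: "0 \<le> P s0"
  proof (rule ccontr)
    assume neg: "\<not> 0 \<le> P s0"
    then have lt: "s0 < s1" using P1 s0b by (cases "s0 = s1") auto
    have "\<exists>x\<ge>s0. x \<le> s1 \<and> P x = P s0 / 2"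
      using neg P1 s0b contP by (intro IVT') (auto intro: continuous_on_subset)
    then obtain x where x: "s0 \<le> x" "x \<le> s1" "P x = P s0 / 2" by blast
    then have "s0 < x" using neg by (cases "s0 = x") auto
    then show False using after[of x] x neg by simp
  qed
  have s0pos: "0 < s0" using Ps0 P0 s0b by (cases "s0 = 0") auto
  have g0: "0 < sg (F n s0)" "0 < fst (F (Suc n) s0)" using good[OF Ps0] s0b s by auto
  have ev1: "eventually (\<lambda>s. 0 < sg (F n s)) (at s0)"
    using cont_comp(1)[of n] g0(1) by (auto simp: continuous_on_eq_continuous_at isCont_def intro!: order_tendstoD)
  have ev2: "eventually (\<lambda>s. 0 < fst (F (Suc n) s)) (at s0)"
    using cont_comp(3)[of "Suc n"] g0(2) by (auto simp: continuous_on_eq_continuous_at isCont_def intro!: order_tendstoD)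
  obtain d where d: "d > 0" "\<And>s. s \<noteq> s0 \<Longrightarrow> dist s s0 < d \<Longrightarrow> 0 < sg (F n s) \<and> 0 < fst (F (Suc n) s)"
    using eventually_conj[OF ev1 ev2] unfolding eventually_at by auto
  have "\<exists>s2\<in>C. s0 - d < s2" unfolding s0_def using C0 bdd d(1)
    by (metis diff_less_eq less_add_same_cancel1 less_cSup_iff empty_iff)
  then obtain s2 where s2: "s2 \<in> C" "s0 - d < s2" by blast
  have s2le: "s2 \<le> s0" unfolding s0_def using s2 bdd by (intro cSup_upper)
  have s2ne: "s2 \<noteq> s0" using s2 Ps0 by (auto simp: C_def)
  have "0 < sg (F n s2)" using d(2)[of s2] s2 s2le s2ne by (auto simp: dist_real_def)
  then have neg: "pf (F (Suc n) s2) < 0" using s2 by (auto simp: C_def P_def min_def split: if_splits)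
  have "\<forall>s\<in>{s2..s1}. 0 < fst (F (Suc n) s)"
  proof
    fix s' assume s': "s' \<in> {s2..s1}"
    show "0 < fst (F (Suc n) s')"
    proof (cases "s' < s0")
      case True
      then show ?thesis using d(2)[of s'] s' s2 by (auto simp: dist_real_def)
    next
      case False
      then have "0 \<le> P s'" using Ps0 after[of s'] s' by (cases "s' = s0") auto
      then show ?thesis using good[of s'] s' s False s0b by auto
    qed
  qed
  moreover have "pf (F (Suc n) s2) * pf (F (Suc n) s1) < 0" using neg t1 by (simp add: mult_neg_pos)
  moreover have "0 \<le> s2" "s2 \<le> s1" using s2 by (auto simp: C_def)
  ultimately show False using nc n s unfolding no_crossing_def by (meson Suc_leD)
qed
end

section \<open>The corners of the odd iterates\<close>

context lozi_uv begin

definition crs :: "real \<times> real \<Rightarrow> real \<times> real \<Rightarrow> real" where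
  "crs v w = fst v * snd w - snd v * fst w"

text \<open>One excursion: a step in the right half plane, then one in the left half plane.
\<open>GL\<close> is its linear part, which has determinant \<open>b\<^sup>2\<close>, and
\<open>zz k\<close> and \<open>uu k\<close> are the corners and the edge vectors between them.\<close>
definition G where "G p = brL (brR p)"
definition GL :: "real \<times> real \<Rightarrow> real \<times> real" where
  "GL v = (a * (b * snd v - a * fst v) + b * fst v, b * snd v - a * fst v)"
definition zz where "zz k = (G ^^ k) Zp"
definition uu where "uu k = zz (Suc k) - zz k"

lemma zz_0: "zz 0 = Zp" and zz_Suc: "zz (Suc k) = G (zz k)" by (simp_all add: zz_def)
lemma G_diff: "G p - G q = GL (p - q)"
  by (simp add: G_def GL_def brL_def brR_def prod_eq_iff algebra_simps)
lemma uu_Suc: "uu (Suc k) = GL (uu k)" by (simp add: uu_def zz_Suc G_diff)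
lemma GL_lin: "GL (v + w) = GL v + GL w" "GL (r *\<^sub>R v) = r *\<^sub>R GL v" "GL (v - w) = GL v - GL w"
  by (simp_all add: GL_def prod_eq_iff algebra_simps)
lemma crs_lin: "crs (v + v') w = crs v w + crs v' w" "crs (r *\<^sub>R v) w = r * crs v w"
  "crs v (w + w') = crs v w + crs v w'" "crs v (r *\<^sub>R w) = r * crs v w"
  "crs v (w - w') = crs v w - crs v w'" "crs (v - v') w = crs v w - crs v' w" "crs v v = 0"
  "crs v (- w) = - crs v w" "crs v 0 = 0"
  by (simp_all add: crs_def algebra_simps)
lemma crs_swap: "crs v w = - crs w v" by (simp add: crs_def)
lemma crs_GL: "crs (GL v) (GL w) = b\<^sup>2 * crs v w"
  by (simp add: crs_def GL_def power2_eq_square algebra_simps)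
lemma GL_CH: "GL (GL v) = (2 * b - a\<^sup>2) *\<^sub>R GL v - b\<^sup>2 *\<^sub>R v"
  by (simp add: GL_def prod_eq_iff power2_eq_square algebra_simps)

text \<open>Up to powers of \<open>b\<close>, the Chebyshev-like sequence belonging to the
linear recurrence of \<open>GL\<close>. Its terms give the cross products of edge vectors, and
\<open>Sb\<close> sums them to locate corners relative to the lines through edges.\<close>
fun Ub :: "nat \<Rightarrow> real" where
  "Ub 0 = 0" | "Ub (Suc 0) = 1" | "Ub (Suc (Suc n)) = (2 * b - a\<^sup>2) * Ub (Suc n) - b\<^sup>2 * Ub n"
definition Sb where "Sb N = (\<Sum>n=1..N. Ub n / b ^ (2 * n))"
lemma Sb_0 [simp]: "Sb 0 = 0" by (simp add: Sb_def)
lemma Sb_Suc: "Sb (Suc N) = Sb N + Ub (Suc N) / b ^ (2 * Suc N)" by (simp add: Sb_def)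

definition k1 where "k1 = crs (uu 0) (uu 1)"
definition mm where "mm = (u - 1) / (1 - l)"
lemma mm0: "0 < mm" using u1 l1 by (simp add: mm_def)

lemma uu_0: "uu 0 = (- mm * (u - 2 * l), - mm)"
proof -
  define z where "z = 1 / (1 - l)"
  have z: "z * (1 - l) = 1" using l1 by (simp add: z_def)
  have m: "mm = (u - 1) * z" by (simp add: mm_def z_def)
  have "uu 0 = (a * (1 - a * z) + (1 + b * z) - z, 1 - a * z)"
    by (simp add: uu_def zz_def G_def brL_def brR_def Zp_def z_def prod_eq_iff)
  also have "\<dots> = (- mm * (u - 2 * l), - mm)"
  proof -
    have zl: "z * l = z - 1" using z by (simp add: algebra_simps)
    have 1: "1 - (u - l) * z = - ((u - 1) * z)"
      using zl by (simp add: algebra_simps)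
    have "(u - l) * (- ((u - 1) * z)) + (1 + u * l * z) - z = - ((u - 1) * z) * (u - 2 * l) + (1 - (z - z * l))"
      by (simp add: algebra_simps)
    then have 2: "(u - l) * (- ((u - 1) * z)) + (1 + u * l * z) - z = - ((u - 1) * z) * (u - 2 * l)"
      using zl by simp
    show ?thesis unfolding m a_def b_def prod_eq_iff fst_conv snd_conv 1 using 2 by simp
  qed
  finally show ?thesis .
qed

lemma k1_neg: "k1 < 0"
proof -
  have "k1 = - (2 * a * l\<^sup>2 * mm\<^sup>2)"
    unfolding k1_def One_nat_def uu_Suc uu_0
    by (simp add: crs_def GL_def a_def b_def power2_eq_square algebra_simps)
  then show ?thesis using a0 l0 mm0 by simp
qed

lemma GL_iter_Ub: "(GL ^^ Suc n) v = Ub (Suc n) *\<^sub>R GL v - (b\<^sup>2 * Ub n) *\<^sub>R v"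
proof (induction n)
  case 0 then show ?case by simp
next
  case (Suc n)
  have "(GL ^^ Suc (Suc n)) v = GL ((GL ^^ Suc n) v)" by simp
  also have "\<dots> = Ub (Suc n) *\<^sub>R GL (GL v) - (b\<^sup>2 * Ub n) *\<^sub>R GL v"
    unfolding Suc by (simp add: GL_lin)
  also have "\<dots> = Ub (Suc (Suc n)) *\<^sub>R GL v - (b\<^sup>2 * Ub (Suc n)) *\<^sub>R v"
    unfolding GL_CH by (simp add: algebra_simps scaleR_diff_left scaleR_diff_right)
  finally show ?case .
qed
lemma uu_iter: "uu (k + n) = (GL ^^ n) (uu k)"
  by (induction n) (simp_all add: uu_Suc)
lemma crs_uu_Suc: "crs (uu k) (uu (Suc k)) = b ^ (2 * k) * k1"
proof (induction k)
  case (Suc k)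
  have "crs (uu (Suc k)) (uu (Suc (Suc k))) = b\<^sup>2 * crs (uu k) (uu (Suc k))"
    unfolding uu_Suc[of "Suc k"] by (subst uu_Suc[of k]) (simp only: crs_GL uu_Suc)
  then show ?case using Suc by (simp add: power_add power2_eq_square)
qed (simp add: k1_def)
lemma crs_uu: "crs (uu k) (uu (k + n)) = b ^ (2 * k) * k1 * Ub n"
proof (cases n)
  case 0 then show ?thesis by (simp add: crs_lin)
next
  case (Suc m)
  have "crs (uu k) (uu (k + n)) = Ub n * crs (uu k) (uu (Suc k))"
    unfolding uu_iter Suc GL_iter_Ub by (simp add: crs_lin uu_Suc)
  then show ?thesis by (simp add: crs_uu_Suc)
qed

lemma zz_diff: "zz (k + n) - zz k = (\<Sum>j<n. uu (k + j))"
  by (induction n) (simp_all add: uu_def algebra_simps)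
lemma crs_sum_right: "crs v (\<Sum>j\<in>A. f j) = (\<Sum>j\<in>A. crs v (f j))"
  by (induction A rule: infinite_finite_induct) (simp_all add: crs_lin)

text \<open>The signed area that is nonnegative on the inner side of the line through the edge
from \<open>zz k\<close> to \<open>zz (k + 1)\<close>.\<close>
definition dl where "dl k p = - crs (uu k) (p - zz k)"
lemma dl_aff: "dl k ((1 - t) *\<^sub>R p + t *\<^sub>R q) = (1 - t) * dl k p + t * dl k q"
  by (simp add: dl_def crs_def algebra_simps)
lemma dl_G: "dl (Suc k) (G p) = b\<^sup>2 * dl k p"
  by (simp add: dl_def uu_Suc zz_Suc G_diff crs_GL)

text \<open>The line through the first edge is the left image of the unstable line of
\<open>X\<close>.\<close>
lemma dl_0_brL: "dl 0 (brL p) = - (mm * l) * qf p"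
proof -
  define z where "z = 1 / (1 - l)"
  have z: "z * (1 - l) = 1" using l1 by (simp add: z_def)
  have "dl 0 (brL p) = - (mm * l) * (fst p + u * snd p - z)"
  proof -
    have zl: "z * l = z - 1" using z by (simp add: algebra_simps)
    have "l * (z * mm) + mm * (1 - z) = mm * (z * l - (z - 1))" by (simp add: algebra_simps)
    then have "l * (z * mm) + mm * (1 - z) = 0" using zl by simp
    then show ?thesis
      by (simp add: dl_def uu_0 zz_0 crs_def brL_def Zp_def z_def[symmetric] a_def b_def algebra_simps)
  qed
  then show ?thesis by (simp add: qf_def z_def)
qed

lemma dl_zz_ge: "dl k (zz (Suc k + n)) = - k1 * b ^ (2 * k) * (\<Sum>j=1..n. Ub j)"
proof -
  have "zz (Suc k + n) - zz k = (\<Sum>j<Suc n. uu (k + j))" using zz_diff[of k "Suc n"] by simp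
  then have "dl k (zz (Suc k + n)) = - (\<Sum>j<Suc n. b ^ (2 * k) * k1 * Ub j)"
    by (simp add: dl_def crs_sum_right crs_uu crs_lin del: sum.lessThan_Suc)
  also have "(\<Sum>j<Suc n. b ^ (2 * k) * k1 * Ub j) = b ^ (2 * k) * k1 * (\<Sum>j=1..n. Ub j)"
    by (simp add: sum_distrib_left[symmetric] lessThan_Suc_atMost atLeast0AtMost[symmetric] sum.atLeast_Suc_atMost)
  finally show ?thesis by simp
qed
lemma dl_zz_le: assumes "j \<le> k" shows "dl k (zz j) = - k1 * b ^ (2 * k) * Sb (k - j)"
proof -
  obtain n where n: "k = j + n" using assms le_Suc_ex by blast
  have "zz k - zz j = (\<Sum>i<n. uu (j + i))" using zz_diff[of j n] n by simp
  then have "dl k (zz j) = crs (uu k) (\<Sum>i<n. uu (j + i))"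
    by (metis dl_def crs_lin(8) minus_diff_eq)
  also have "\<dots> = (\<Sum>i<n. - (b ^ (2 * (j + i)) * k1 * Ub (n - i)))"
    unfolding crs_sum_right
  proof (intro sum.cong refl)
    fix i assume "i \<in> {..<n}"
    then have "k = (j + i) + (n - i)" using n by simp
    then show "crs (uu k) (uu (j + i)) = - (b ^ (2 * (j + i)) * k1 * Ub (n - i))"
      using crs_uu[of "j + i" "n - i"] crs_swap[of "uu k"] by simp
  qed
  also have "\<dots> = (\<Sum>i=1..n. - (b ^ (2 * (j + (n - i))) * k1 * Ub i))"
    by (rule sum.reindex_bij_witness[of _ "\<lambda>i. n - i" "\<lambda>i. n - i"]) auto
  also have "\<dots> = (\<Sum>i=1..n. - k1 * b ^ (2 * k) * (Ub i / b ^ (2 * i)))"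
  proof (intro sum.cong refl)
    fix i assume i: "i \<in> {1..n}"
    have "b ^ (2 * k) = b ^ (2 * (j + (n - i))) * b ^ (2 * i)" 
    proof -
      obtain m where "n = i + m" using i le_Suc_ex by auto
      then have "2 * k = 2 * (j + (n - i)) + 2 * i" using n by simp
      then show ?thesis by (metis power_add)
    qed
    then show "- (b ^ (2 * (j + (n - i))) * k1 * Ub i) = - k1 * b ^ (2 * k) * (Ub i / b ^ (2 * i))"
      using b0 by simp
  qed
  finally show ?thesis using n by (simp add: Sb_def sum_distrib_left)
qed

text \<open>Summation by parts: multiplying the terms of \<open>Sb\<close> by the decreasing
factors \<open>b ^ (2 N)\<close> keeps the sums nonnegative.\<close>
lemma sum_Ub_ge: assumes "\<And>k. k \<le> N \<Longrightarrow> 0 \<le> Sb k" shows "b ^ (2 * N) * Sb N \<le> (\<Sum>j=1..N. Ub j)"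
  using assms
proof (induction N)
  case (Suc N)
  have IH: "b ^ (2 * N) * Sb N \<le> (\<Sum>j=1..N. Ub j)" using Suc by simp
  have "b ^ (2 * Suc N) * Sb (Suc N) = b ^ (2 * Suc N) * Sb N + Ub (Suc N)"
    using b0 by (simp add: Sb_Suc distrib_left)
  also have "b ^ (2 * Suc N) * Sb N \<le> b ^ (2 * N) * Sb N"
    using b0 b1 Suc.prems by (intro mult_right_mono power_decreasing) auto
  finally show ?case using IH by simp
qed simp
lemma sum_Ub_nonneg: assumes "\<And>k. k \<le> N \<Longrightarrow> 0 \<le> Sb k" shows "0 \<le> (\<Sum>j=1..N. Ub j)"
  using sum_Ub_ge[of N] assms b0 by (meson order.trans le_refl mult_nonneg_nonneg zero_le_power less_imp_le)

lemma Ub_div_rec: "b\<^sup>2 * (Ub (Suc (Suc n)) / b ^ (2 * Suc (Suc n)))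
  = (2 * b - a\<^sup>2) * (Ub (Suc n) / b ^ (2 * Suc n)) - Ub n / b ^ (2 * n)"
proof -
  have stays_left: "\<And>X Y T q c::real. q \<noteq> 0 \<Longrightarrow> c \<noteq> 0 \<Longrightarrow> q * ((T * X - q * Y) / (q * (q * c))) = T * (X / (q * c)) - Y / c"
    by (simp add: field_simps)
  have p: "b ^ (2 * Suc n) = b\<^sup>2 * b ^ (2 * n)" "b ^ (2 * Suc (Suc n)) = b\<^sup>2 * (b\<^sup>2 * b ^ (2 * n))"
    by (simp_all add: power2_eq_square)
  show ?thesis unfolding p Ub.simps by (rule stays_left) (use b0 in auto)
qed

lemma Sb_rec: "b\<^sup>2 * Sb (Suc (Suc N)) = 1 + (2 * b - a\<^sup>2) * Sb (Suc N) - Sb N"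
proof (induction N)
  case 0
  have "b\<^sup>2 * (1 / b\<^sup>2) = 1" using b0 by simp
  moreover have "Sb (Suc 0) = 1 / b\<^sup>2" by (simp add: Sb_Suc)
  moreover have "b\<^sup>2 * (Ub (Suc (Suc 0)) / b ^ (2 * Suc (Suc 0))) = (2 * b - a\<^sup>2) * (1 / b\<^sup>2)"
    using Ub_div_rec[of 0] by simp
  ultimately show ?case unfolding Sb_Suc[of "Suc 0"] distrib_left by simp
next
  case (Suc N)
  then show ?case
    unfolding Sb_Suc[of "Suc (Suc N)"] distrib_left Ub_div_rec[of "Suc N"] 
    unfolding Sb_Suc[of "Suc N"] Sb_Suc[of N] by (simp only: distrib_left)
qed

text \<open>The corners turn around a centre, so the line through some edge eventually separates
\<open>zz 0\<close> from it. After division by \<open>b ^ N\<close> the deviation of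
\<open>Sb\<close> from its fixed value satisfies a two-term recurrence of rotation type with an
invariant quadratic form. If all sums were nonnegative, a small correction would make the
deviation concave and bounded below, so it would converge to zero; the quadratic form does not
allow this.\<close>
lemma Sb_neg: "\<exists>N. Sb N < 0"
proof (rule ccontr)
  assume "\<not> (\<exists>N. Sb N < 0)"
  then have S: "0 \<le> Sb N" for N by (meson not_less)
  define e where "e = a\<^sup>2 / b"
  have e0: "0 < e" using a0 b0 by (simp add: e_def)
  have eb: "e * b = a\<^sup>2" using b0 by (simp add: e_def)
  have T: "2 * b - a\<^sup>2 = b * (2 - e)" using eb by (simp add: algebra_simps)
  have Sb1: "Sb (Suc 0) = 1 / b\<^sup>2" by (simp add: Sb_Suc)
  have e4: "e < 4"
  proof (rule ccontr)
    assume "\<not> e < 4"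
    have "b\<^sup>2 * Sb (Suc (Suc 0)) = 1 + b * (2 - e) * (1 / b\<^sup>2)" using Sb_rec[of 0] T Sb1 by simp
    also have "\<dots> = 1 + (2 - e) / b" using b0 by (simp add: power2_eq_square)
    also have "(2 - e) / b \<le> (- 2) / b" using b0 \<open>\<not> e < 4\<close> by (intro divide_right_mono) auto
    also have "(- 2) / b < - 1" using b0 b1 by (simp add: field_simps)
    finally have "b\<^sup>2 * Sb (Suc (Suc 0)) < 0" by simp
    then show False using S[of "Suc (Suc 0)"] by (simp add: mult_less_0_iff)
  qed
  define ss where "ss = 1 / ((1 - b)\<^sup>2 + a\<^sup>2)"
  have ss0: "0 < ss" using b1 a0 by (simp add: ss_def add_nonneg_pos)
  have ss: "ss * ((1 - b)\<^sup>2 + a\<^sup>2) = 1" using a0 by (simp add: ss_def add_nonneg_eq_0_iff)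
  define w where "w N = b ^ N * (Sb N - ss)" for N
  have wrec: "w (Suc (Suc N)) = (2 - e) * w (Suc N) - w N" for N
  proof -
    have "w (Suc (Suc N)) = b ^ N * (b\<^sup>2 * Sb (Suc (Suc N)) - b\<^sup>2 * ss)"
      by (simp add: w_def power2_eq_square algebra_simps)
    also have "b\<^sup>2 * Sb (Suc (Suc N)) - b\<^sup>2 * ss = b * (2 - e) * (Sb (Suc N) - ss) - (Sb N - ss)"
      unfolding Sb_rec T using ss eb by (simp add: power2_eq_square) algebra
    finally show ?thesis by (simp add: w_def algebra_simps)
  qed
  have wge: "- ss * b ^ N \<le> w N" for N
    using S[of N] b0 unfolding w_def by (simp add: algebra_simps)
  define ka where "ka = e * ss * b / (1 - b)\<^sup>2"
  have ka: "ka * (1 - b)\<^sup>2 = e * ss * b" using b1 by (simp add: ka_def)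
  have ka0: "0 \<le> ka" using e0 ss0 b0 by (simp add: ka_def)
  define v where "v N = w N - ka * b ^ N" for N
  define d where "d N = v (Suc N) - v N" for N
  have dd: "d N - d (Suc N) = e * w (Suc N) + ka * (1 - b)\<^sup>2 * b ^ N" for N
    unfolding d_def v_def wrec by (simp add: power2_eq_square algebra_simps)
  have dec: "d (Suc N) \<le> d N" for N
  proof -
    have "0 \<le> e * (w (Suc N) + ss * b ^ Suc N)" using wge[of "Suc N"] e0 by simp
    also have "\<dots> = d N - d (Suc N)" unfolding dd ka by (simp add: algebra_simps)
    finally show ?thesis by simp
  qed
  have decs: "decseq d" using dec by (rule decseq_SucI)
  have vlow: "- (ss + ka) \<le> v N" for N
  proof -
    have "b ^ N \<le> 1" using b0 b1 by (simp add: power_le_one)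
    then have "- (ss + ka) * 1 \<le> - (ss + ka) * b ^ N" using ss0 ka0 by (intro mult_left_mono_neg) auto
    also have "\<dots> \<le> v N" using wge[of N] by (simp add: v_def algebra_simps)
    finally show ?thesis by simp
  qed
  have dnn: "0 \<le> d N" for N
  proof (rule ccontr)
    assume neg: "\<not> 0 \<le> d N"
    have lin: "v (N + k) \<le> v N + real k * d N" for k
    proof (induction k)
      case (Suc k)
      have "d (N + k) \<le> d N" using decs by (simp add: decseq_def)
      then show ?case using Suc by (simp add: d_def algebra_simps)
    qed simp
    obtain k where "real k * (- d N) > v N + (ss + ka)"
      using neg reals_Archimedean3[of "- d N"] by auto
    then show False using lin[of k] vlow[of "N + k"] by simp
  qed
  obtain L where L: "d \<longlonglongrightarrow> L" using decseq_convergent[OF decs, of 0] dnn by blast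
  have t1: "(\<lambda>N. d N - d (Suc N)) \<longlonglongrightarrow> 0" using tendsto_diff[OF L LIMSEQ_Suc[OF L]] by simp
  have "(\<lambda>N. b ^ N) \<longlonglongrightarrow> 0" using b0 b1 by (intro LIMSEQ_power_zero) auto
  from tendsto_mult_right_zero[OF this, of "ka * (1 - b)\<^sup>2"]
  have t2: "(\<lambda>N. ka * (1 - b)\<^sup>2 * b ^ N) \<longlonglongrightarrow> 0" .
  have "(\<lambda>N. d N - d (Suc N) - ka * (1 - b)\<^sup>2 * b ^ N) \<longlonglongrightarrow> 0"
    using tendsto_diff[OF t1 t2] by simp
  from tendsto_mult_right_zero[OF this, of "1 / e"]
  have "(\<lambda>N. (1 / e) * (d N - d (Suc N) - ka * (1 - b)\<^sup>2 * b ^ N)) \<longlonglongrightarrow> 0" .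
  moreover have "(1 / e) * (d N - d (Suc N) - ka * (1 - b)\<^sup>2 * b ^ N) = w (Suc N)" for N
    unfolding dd using e0 by simp
  ultimately have "(\<lambda>N. w (Suc N)) \<longlonglongrightarrow> 0" by simp
  then have w0: "w \<longlonglongrightarrow> 0" by (rule LIMSEQ_imp_Suc)
  define En where "En N = (w (Suc N))\<^sup>2 - (2 - e) * w N * w (Suc N) + (w N)\<^sup>2" for N
  have "En (Suc N) = En N" for N unfolding En_def wrec by (simp add: power2_eq_square algebra_simps)
  then have Ec: "En N = En 0" for N by (induction N) auto
  have "En \<longlonglongrightarrow> 0\<^sup>2 - (2 - e) * 0 * 0 + 0\<^sup>2"
    unfolding En_def by (intro tendsto_intros w0 LIMSEQ_Suc[OF w0])
  then have l0: "En \<longlonglongrightarrow> 0" by simp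
  have "En = (\<lambda>N. En 0)" using Ec by (intro ext)
  then have "En \<longlonglongrightarrow> En 0" by (metis tendsto_const)
  then have "En 0 = 0" using l0 LIMSEQ_unique by blast
  moreover have "En 0 = (w 1 - (1 - e / 2) * w 0)\<^sup>2 + (e * (1 - e / 4)) * (w 0)\<^sup>2"
    unfolding En_def One_nat_def by (simp add: power2_eq_square algebra_simps)
  moreover have "0 < (e * (1 - e / 4)) * (w 0)\<^sup>2"
    using e0 e4 ss0 by (intro mult_pos_pos) (auto simp: w_def)
  ultimately show False by (smt (verit) zero_le_power2)
qed

end

section \<open>Convex hulls that trap the odd iterates\<close>

text \<open>A point of a hull on the nonpositive side of an affine function is a combination of
hull generators on that side and of points of the hull on the zero line.\<close>
lemma clip_hull:
  fixes S C :: "(real \<times> real) set" and f :: "real \<times> real \<Rightarrow> real"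
  assumes f: "\<And>t x y. f ((1 - t) *\<^sub>R x + t *\<^sub>R y) = (1 - t) * f x + t * f y"
    and C: "convex C" and S: "\<And>x. x \<in> S \<Longrightarrow> f x \<le> 0 \<Longrightarrow> x \<in> C"
    and Z: "\<And>y. y \<in> convex hull S \<Longrightarrow> f y = 0 \<Longrightarrow> y \<in> C"
    and R: "R \<in> convex hull S" "f R \<le> 0"
  shows "R \<in> C"
proof -
  let ?D = "{R \<in> convex hull S. 0 < f R \<or> R \<in> C}"
  have "(1 - t) *\<^sub>R x + t *\<^sub>R y \<in> ?D" if x: "x \<in> ?D" and y: "y \<in> ?D" and t: "0 \<le> t \<and> t \<le> 1" for x y t
  proof -
    let ?p = "(1 - t) *\<^sub>R x + t *\<^sub>R y"
    have to_lozi: "?p \<in> convex hull S" using x y t convex_convex_hull[of S] unfolding convex_alt by blast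
    have key: "0 < f ((1 - t) *\<^sub>R x + t *\<^sub>R y) \<or> (1 - t) *\<^sub>R x + t *\<^sub>R y \<in> C"
      if t: "0 \<le> t" "t \<le> 1" and x: "x \<in> convex hull S" "0 < f x" and y: "y \<in> C" "f y \<le> 0" "y \<in> convex hull S" for x y and t :: real
    proof (cases "0 < f ((1 - t) *\<^sub>R x + t *\<^sub>R y)")
      case False
      define r where "r = f x / (f x - f y)"
      have r: "0 \<le> r" "r \<le> 1" "(1 - r) * f x + r * f y = 0"
        using x y by (auto simp: r_def divide_simps)
      define g where "g = (1 - r) *\<^sub>R x + r *\<^sub>R y"
      have g: "g \<in> convex hull S" unfolding g_def
        using r x y convex_convex_hull[of S] unfolding convex_alt by blast
      have gC: "g \<in> C" using Z[OF g] r f by (simp add: g_def)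
      have tr: "r \<le> t"
      proof -
        have "(1 - t) * f x + t * f y \<le> (1 - r) * f x + r * f y" using False f r by simp
        then have "(r - t) * (f x - f y) \<le> 0" by (simp add: algebra_simps)
        then show ?thesis using x y by (simp add: mult_le_0_iff)
      qed
      show ?thesis
      proof (cases "r = 1")
        case True
        then have "t = 1" using tr t by simp
        then show ?thesis using y by simp
      next
        case False
        define q where "q = (t - r) / (1 - r)"
        have q: "0 \<le> q" "q \<le> 1" "q * (1 - r) = t - r" using tr r False t by (auto simp: q_def divide_simps)
        have "(1 - q) *\<^sub>R g + q *\<^sub>R y = ((1 - q) * (1 - r)) *\<^sub>R x + ((1 - q) * r + q) *\<^sub>R y"
          by (simp add: g_def algebra_simps scaleR_add_left)
        moreover have "(1 - q) * (1 - r) = 1 - t" "(1 - q) * r + q = t" using q(3) by (simp_all add: algebra_simps)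
        ultimately have "(1 - t) *\<^sub>R x + t *\<^sub>R y = (1 - q) *\<^sub>R g + q *\<^sub>R y" by simp
        then show ?thesis using C gC y q unfolding convex_alt by auto
      qed
    qed simp
    have "0 < f ?p \<or> ?p \<in> C"
    proof (cases "f x \<le> 0"; cases "f y \<le> 0")
      assume "f x \<le> 0" "f y \<le> 0"
      then show ?thesis using x y t C unfolding convex_alt by auto
    next
      assume "f x \<le> 0" "\<not> f y \<le> 0"
      then show ?thesis using key[of "1 - t" y x] x y t by (simp add: add.commute)
    next
      assume "\<not> f x \<le> 0" "f y \<le> 0"
      then show ?thesis using key[of t x y] x y t by simp
    next
      assume "\<not> f x \<le> 0" "\<not> f y \<le> 0"
      then have "0 < (1 - t) * f x + t * f y" using t
        by (cases "t = 0") (auto intro!: add_nonneg_pos)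
      then show ?thesis using f by simp
    qed
    then show ?thesis using to_lozi by simp
  qed
  then have "convex ?D" unfolding convex_alt by blast
  moreover have "S \<subseteq> ?D"
  proof
    fix x assume "x \<in> S"
    then show "x \<in> ?D" using S[of x] hull_inc[of x S convex] by (cases "f x \<le> 0") auto
  qed
  ultimately have "convex hull S \<subseteq> ?D" by (intro hull_minimal) auto
  then show ?thesis using R by auto
qed

context lozi_uv begin

text \<open>The point where the stable line of \<open>X\<close> meets the axis \<open>w =
0\<close>.\<close>
definition V1 where "V1 = (1 / (1 + u), 0 :: real)"
definition zm where "zm k = brR (zz k)"
lemma zz_Suc': "zz (Suc k) = brL (zm k)" by (simp add: zz_Suc G_def zm_def)

lemma brR_Xp: "brR Xp = Xp" using stp_Xp xX0 by (simp add: stp_R)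
lemma brR_Zp: "brR Zp = Z1"
proof -
  define z where "z = 1 / (1 - l)"
  have "z * (1 - l) = 1" using l1 by (simp add: z_def)
  then have zl: "z * l = z - 1" by (simp add: algebra_simps)
  have "1 - (u - l) * z = (1 - u) * z" using zl by (simp add: algebra_simps)
  then show ?thesis by (simp add: brR_def Zp_def Z1_def a_def z_def)
qed
lemma T_brR: "T s = brR ((1 - s) *\<^sub>R Xp + s *\<^sub>R Zp)"
  by (simp add: T_def brR_aff brR_Xp brR_Zp)

lemma width: "1 / (1 - l) - 1 / (1 + u) = (u + l) * fst Xp" "u * (1 / (1 + u)) + l * (1 / (1 - l)) = (u + l) * fst Xp"
  using u1 l1 by (simp_all add: Xp_def divide_simps) (simp_all add: algebra_simps)

text \<open>The point is expressed in barycentric coordinates; up to positive factors they are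
the three quantities in the hypotheses.\<close>
lemma triangle_up:
  assumes p: "0 \<le> pf p" "qf p \<le> 0" "0 \<le> snd p"
  shows "p \<in> convex hull {Xp, V1, Zp}"
proof -
  define v where "v = 1 / (1 + u)" define z where "z = 1 / (1 - l)" define xx where "xx = fst Xp"
  have xx: "xx > 0" "snd Xp = xx" using xX0 by (simp_all add: xx_def)
  have W: "z - v = (u + l) * xx" "u * v + l * z = (u + l) * xx"
    using width by (simp_all add: v_def z_def xx_def)
  define D where "D = z - v"
  have D0: "D > 0" using W xx u1 l0 by (simp add: D_def)
  obtain x w where pxw: "p = (x, w)" by force
  define cX where "cX = w / xx"
  define cZ where "cZ = (x - l * w - v) / D"
  define cV where "cV = (z - u * w - x) / D"
  have nn: "0 \<le> cX" "0 \<le> cV" "0 \<le> cZ" using p xx D0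
    by (simp_all add: cX_def cV_def cZ_def pxw pf_def qf_def v_def z_def)
  have cXw: "cX * xx = w" using xx by (simp add: cX_def)
  have cD: "cZ * D = x - l * w - v" "cV * D = z - u * w - x" using D0 by (simp_all add: cZ_def cV_def)
  have "(cX + cV + cZ) * D = D"
    using cXw cD W by (simp add: D_def algebra_simps)
  then have sum: "cX + cV + cZ = 1" using D0 by simp
  have "(cX * xx + cV * v + cZ * z) * D = x * D"
  proof -
    have "(cX * xx + cV * v + cZ * z) * D = w * D + v * (cV * D) + z * (cZ * D)" unfolding cXw by (simp add: algebra_simps)
    also have "\<dots> = w * D + x * (z - v) - w * (u * v + l * z)" unfolding cD by (simp add: algebra_simps)
    also have "\<dots> = x * D" unfolding W(2) W(1)[symmetric] by (simp add: D_def)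
    finally show ?thesis .
  qed
  then have X: "cX * xx + cV * v + cZ * z = x" using D0 by simp
  have "p = cX *\<^sub>R Xp + cV *\<^sub>R V1 + cZ *\<^sub>R Zp"
    using X cXw xx by (simp add: pxw prod_eq_iff V1_def Zp_def v_def z_def xx_def)
  then show ?thesis using nn sum unfolding convex_hull_3 by blast
qed

lemma pf_V1: "pf V1 = 0" by (simp add: pf_def V1_def)
lemma pf_Zp: "0 < pf Zp"
proof -
  have "pf Zp = (u + l) * fst Xp" using width by (simp add: pf_def Zp_def)
  then show ?thesis using xX0 u1 l0 by simp
qed
lemma qf_Zp: "qf Zp = 0" by (simp add: qf_def Zp_def)
lemma fst_Zp: "0 < fst Zp" using l1 by (simp add: Zp_def)

definition chain where "chain i \<longleftrightarrow> (\<forall>m<i. 0 < fst (zz m) \<and> fst (zm m) < 0)"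

text \<open>The parameter of the point \<open>Zinv\<close> on the axis, the preimage of
\<open>Z\<close>. Two steps map \<open>T (s0 * s)\<close> to \<open>T s\<close>, so \<open>s0 <
s \<le> 1\<close> is a fundamental domain, which \<open>par\<close> maps affinely to the unit
interval.\<close>
definition s0 where "s0 = 1 / u\<^sup>2"
lemma s0: "0 < s0" "s0 < 1" using u1 by (simp_all add: s0_def power2_eq_square field_simps) (simp add: less_1_mult)
definition par where "par s = (s - s0) / (1 - s0)"
lemma par: "par s0 = 0" "par 1 = 1" "s0 \<le> s \<Longrightarrow> s \<le> 1 \<Longrightarrow> 0 \<le> par s \<and> par s \<le> 1"
  using s0 by (auto simp: par_def divide_simps)
definition unpar where "unpar t = s0 + t * (1 - s0)"
lemma unpar: "par (unpar t) = t" "0 \<le> t \<Longrightarrow> t \<le> 1 \<Longrightarrow> s0 \<le> unpar t \<and> unpar t \<le> 1"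
proof -
  show "par (unpar t) = t" using s0 by (simp add: par_def unpar_def)
  assume t: "0 \<le> t" "t \<le> 1"
  have "t * (1 - s0) \<le> 1 * (1 - s0)" "0 \<le> t * (1 - s0)" using t s0 by (auto intro: mult_right_mono)
  then show "s0 \<le> unpar t \<and> unpar t \<le> 1" by (simp add: unpar_def)
qed

definition Zinv where "Zinv = (0 :: real, 1 / (u * (1 - l)))"
lemma brL_Zinv: "brL Zinv = Zp"
proof -
  define z where "z = 1 / (1 - l)"
  have zl: "z * l = z - 1" using l1 by (simp add: z_def field_simps)
  have "u * l * (1 / (u * (1 - l))) = l * z" using u1 by (simp add: z_def)
  then show ?thesis using zl by (simp add: brL_def Zinv_def Zp_def b_def z_def algebra_simps)
qed
lemma T_s0: "T s0 = Zinv"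
proof -
  define z q where "z = 1 / (1 - l)" and "q = 1 / u"
  define v where "v = 1 / (1 + u)"
  have q: "q * u = 1" using u1 by (simp add: q_def)
  have v: "v * (1 + u) = 1" using u1 by (simp add: v_def)
  have s: "s0 = q * q" by (simp add: s0_def q_def power2_eq_square)
  have X: "Xp = (v * z, v * z)" by (simp add: Xp_def v_def z_def)
  have 1: "1 - s0 = v * (1 + u) * (1 - q * q)" unfolding v s by simp
  have 2: "v * (1 - q * q) = q * q * (u - 1)"
  proof -
    have "1 - q * q = q * q * (u * u - 1)" 
    proof -
      have "q * q * (u * u) = (q * u) * (q * u)" by (simp only: ac_simps)
      then show ?thesis unfolding q by (simp add: algebra_simps)
    qed
    also have "\<dots> = q * q * (u - 1) * (1 + u)" by (simp add: algebra_simps)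
    finally have "v * (1 - q * q) = q * q * (u - 1) * (v * (1 + u))" by (simp add: algebra_simps)
    then show ?thesis unfolding v by simp
  qed
  have 3: "(1 - s0) * (v * z) = s0 * ((u - 1) * z)" 
  proof -
    have "(1 - q * q) * (v * z) = z * (v * (1 - q * q))" by (simp only: ac_simps)
    also have "\<dots> = q * q * ((u - 1) * z)" unfolding 2 by (simp only: ac_simps)
    finally show ?thesis unfolding s .
  qed
  have "fst (T s0) = 0" using 3 by (simp add: T_def X Z1_def z_def algebra_simps diff_divide_distrib)
  moreover have "qf (T s0) = 0" by (rule qf_T)
  ultimately have f: "fst (T s0) = 0" "u * snd (T s0) = 1 / (1 - l)" by (simp_all add: qf_def)
  have "snd (T s0) = (u * snd (T s0)) / u" using u1 by simp
  also have "\<dots> = 1 / (u * (1 - l))" unfolding f by (simp add: mult.commute)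
  finally show ?thesis using f by (simp add: Zinv_def prod_eq_iff)
qed
lemma T_1: "T 1 = Z1" by (simp add: T_def)
lemma T_par: "T s = (1 - par s) *\<^sub>R Zinv + par s *\<^sub>R Z1"
proof -
  have "s = s0 + par s * (1 - s0)" using s0 by (simp add: par_def)
  then have "T s = T (s0 + par s * (1 - s0))" by simp
  also have "\<dots> = (1 - par s) *\<^sub>R T s0 + par s *\<^sub>R T 1"
    by (simp add: T_def prod_eq_iff algebra_simps)
  finally show ?thesis by (simp add: T_s0 T_1)
qed

definition ze where "ze k = (case k of 0 \<Rightarrow> Zinv | Suc m \<Rightarrow> zm m)"
lemma ze_simps [simp]: "ze 0 = Zinv" "ze (Suc k) = zm k" by (simp_all add: ze_def)
lemma brL_ze: "brL (ze k) = zz k" by (cases k) (simp_all add: brL_Zinv zz_0 zz_Suc')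
lemma zm_0: "zm 0 = Z1" by (simp add: zm_def zz_0 brR_Zp)
lemma zm0_neg: "fst (zm 0) < 0" using u1 l1 by (simp add: zm_0 Z1_def divide_neg_pos)
lemma chain_mono: "chain i \<Longrightarrow> j \<le> i \<Longrightarrow> chain j" by (simp add: chain_def)
lemma chainD: "chain i \<Longrightarrow> j < i \<Longrightarrow> 0 < fst (zz j)" "chain i \<Longrightarrow> j < i \<Longrightarrow> fst (zm j) < 0"
  by (simp_all add: chain_def)
lemma ze_nonpos: "chain k \<Longrightarrow> fst (ze k) \<le> 0"
  by (cases k) (auto simp: Zinv_def chain_def less_imp_le)

lemma conv_nonpos: "0 \<le> t \<Longrightarrow> t \<le> 1 \<Longrightarrow> x \<le> 0 \<Longrightarrow> y \<le> 0 \<Longrightarrow> (1 - t) * x + t * y \<le> (0::real)"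
  by (intro add_nonpos_nonpos) (auto simp: mult_le_0_iff)
lemma conv_nonneg: "0 \<le> t \<Longrightarrow> t \<le> 1 \<Longrightarrow> 0 \<le> x \<Longrightarrow> 0 \<le> y \<Longrightarrow> 0 \<le> (1 - t) * x + t * (y::real)"
  by (intro add_nonneg_nonneg) auto
lemma conv_pos: "0 \<le> t \<Longrightarrow> t < 1 \<Longrightarrow> 0 < x \<Longrightarrow> 0 \<le> y \<Longrightarrow> 0 < (1 - t) * x + t * (y::real)"
  by (intro add_pos_nonneg) auto

text \<open>While the corners alternate, whole segments between consecutive corners alternate,
and the curve \<open>F n\<close> is one affine segment.\<close>
lemma chain_F:
  assumes s: "s0 \<le> s" "s \<le> 1"
  shows "chain k \<Longrightarrow> 0 \<le> fst (zz k) \<Longrightarrow> F (2 * k) s = (1 - par s) *\<^sub>R ze k + par s *\<^sub>R zm k"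
    and "chain k \<Longrightarrow> 0 \<le> fst (zz k) \<Longrightarrow> fst (zm k) \<le> 0 \<Longrightarrow>
      F (Suc (2 * k)) s = (1 - par s) *\<^sub>R zz k + par s *\<^sub>R zz (Suc k)"
proof -
  note p = par(3)[OF s]
  have odd: "F (Suc (2 * k)) s = (1 - par s) *\<^sub>R zz k + par s *\<^sub>R zz (Suc k)"
    if "F (2 * k) s = (1 - par s) *\<^sub>R ze k + par s *\<^sub>R zm k" "chain k" "fst (zm k) \<le> 0" for k
  proof -
    have "fst (F (2 * k) s) \<le> 0" using that p ze_nonpos[of k] by (simp add: conv_nonpos)
    then show ?thesis using that by (simp add: F_Suc stp_L brL_aff brL_ze zz_Suc')
  qed
  show ev: "chain k \<Longrightarrow> 0 \<le> fst (zz k) \<Longrightarrow> F (2 * k) s = (1 - par s) *\<^sub>R ze k + par s *\<^sub>R zm k" for k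
  proof (induction k)
    case 0
    then show ?case by (simp add: T_par zm_0)
  next
    case (Suc k)
    have c: "chain k" "0 < fst (zz k)" "fst (zm k) < 0" using Suc.prems by (auto simp: chain_def)
    have o: "F (Suc (2 * k)) s = (1 - par s) *\<^sub>R zz k + par s *\<^sub>R zz (Suc k)"
      using Suc.IH c by (intro odd) auto
    have "0 \<le> fst (F (Suc (2 * k)) s)" unfolding o using p c Suc.prems by (simp add: conv_nonneg)
    then show ?case using o by (simp add: F_Suc stp_R brR_aff zm_def[symmetric])
  qed
  show "chain k \<Longrightarrow> 0 \<le> fst (zz k) \<Longrightarrow> fst (zm k) \<le> 0 \<Longrightarrow>
      F (Suc (2 * k)) s = (1 - par s) *\<^sub>R zz k + par s *\<^sub>R zz (Suc k)"
    using odd ev by blast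
qed

lemma qf_stp_le: "qf p \<le> 0 \<Longrightarrow> qf (stp p) \<le> 0"
  using l0 a0 by (cases "0 \<le> fst p")
    (auto simp: stp_R stp_L qf_brR qf_brL mult_le_0_iff intro!: add_nonpos_nonpos)
lemma qf_F: "qf (F n s) \<le> 0" by (induction n) (simp_all add: qf_T F_Suc qf_stp_le)

lemma qf_zz: "chain k \<Longrightarrow> qf (zz k) \<le> 0"
proof (induction k)
  case 0 then show ?case by (simp add: zz_0 qf_Zp)
next
  case (Suc k)
  then have "qf (zm k) \<le> 0" "fst (zm k) \<le> 0" using l0 by (auto simp: zm_def qf_brR mult_le_0_iff chain_def)
  then show ?case unfolding zz_Suc' qf_brL using l0 a0 by (intro add_nonpos_nonpos) (auto simp: mult_le_0_iff)
qed

text \<open>In a fan of triangles with apex \<open>zz 0\<close> over the edges, some triangle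
contains the next corner: the angular position \<open>Fm\<close> changes sign because \<open>Sb
J\<close> is not positive, and the corner is inside the edge by positivity of the earlier sums.\<close>
lemma hull_spiral:
  assumes J: "\<And>N. 1 \<le> N \<Longrightarrow> N < J \<Longrightarrow> 0 < Sb N" and SJ: "Sb J \<le> 0" and J1: "1 \<le> J"
    and d0: "0 \<le> dl 0 (zz (Suc J))"
  shows "zz (Suc J) \<in> convex hull (zz ` {..J})"
proof -
  let ?P = "zz (Suc J)"
  define Fm where "Fm m = - crs (zz m - Zp) (?P - Zp)" for m
  have F1: "0 \<le> Fm 1" using d0 by (simp add: Fm_def dl_def zz_0 uu_def)
  have FJ: "Fm J \<le> 0"
  proof -
    have "?P - Zp = uu J + (zz J - Zp)" by (simp add: uu_def)
    then have "Fm J = crs (uu J) (zz J - Zp)"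
      by (simp add: Fm_def crs_def algebra_simps)
    also have "\<dots> = dl J (zz 0)" by (simp add: dl_def zz_0 crs_def algebra_simps)
    also have "\<dots> = - k1 * b ^ (2 * J) * Sb J" using dl_zz_le[of 0 J] by simp
    also have "\<dots> \<le> 0" using SJ k1_neg b0 by (intro mult_nonneg_nonpos mult_nonneg_nonneg) auto
    finally show ?thesis .
  qed
  have "\<exists>m\<ge>1. m < J \<and> 0 \<le> Fm m \<and> Fm (Suc m) \<le> 0"
  proof (rule ccontr)
    assume N: "\<not> ?thesis"
    have "0 < Fm m \<or> m = 1" if "1 \<le> m" "m \<le> J" for m
      using that
    proof (induction m rule: nat_induct_at_least)
      case (Suc m)
      then have "0 \<le> Fm m" "m < J" using F1 by auto
      then have "\<not> Fm (Suc m) \<le> 0" using N Suc by blast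
      then show ?case by simp
    qed simp
    moreover have "J \<noteq> 1"
      using SJ b0 by (auto simp: Sb_Suc)
    ultimately show False using FJ J1 by force
  qed
  then obtain m where m: "1 \<le> m" "m < J" "0 \<le> Fm m" "Fm (Suc m) \<le> 0" by blast
  define D where "D = dl m (zz 0)"
  have D: "D = - k1 * b ^ (2 * m) * Sb m" using dl_zz_le[of 0 m] by (simp add: D_def)
  have D0: "0 < D" unfolding D using J[of m] m k1_neg b0 by (intro mult_pos_pos) auto
  have third: "0 \<le> dl m ?P"
  proof -
    have "?P = zz (Suc m + (J - m))" using m by simp
    then have "dl m ?P = - k1 * b ^ (2 * m) * (\<Sum>j=1..J - m. Ub j)" using dl_zz_ge[of m "J - m"] by simp
    moreover have "0 \<le> (\<Sum>j=1..J - m. Ub j)"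
    proof (rule sum_Ub_nonneg)
      fix k assume "k \<le> J - m"
      then have "k = 0 \<or> (1 \<le> k \<and> k < J)" using m by linarith
      then show "0 \<le> Sb k" using J[of k] by force
    qed
    ultimately show ?thesis using k1_neg b0 by (simp add: mult_nonneg_nonneg mult_nonpos_nonneg mult_nonpos_nonneg)
  qed
  have step: "zz (Suc m) - Zp = (zz m - Zp) + uu m" by (simp add: uu_def)
  have id1: "Fm m - Fm (Suc m) + dl m ?P = D"
    unfolding Fm_def D_def dl_def step zz_0 by (simp add: crs_def algebra_simps)
  have DA: "crs (zz m - Zp) (zz (Suc m) - Zp) = - D"
    unfolding D_def dl_def step zz_0 by (simp add: crs_def algebra_simps)
  have v2: "crs p q *\<^sub>R r = crs r q *\<^sub>R p + crs p r *\<^sub>R q" for p q r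
    by (simp add: crs_def prod_eq_iff algebra_simps)
  have "(- D) *\<^sub>R (?P - Zp) = crs (?P - Zp) (zz (Suc m) - Zp) *\<^sub>R (zz m - Zp) + crs (zz m - Zp) (?P - Zp) *\<^sub>R (zz (Suc m) - Zp)"
    unfolding DA[symmetric] by (rule v2)
  also have "crs (?P - Zp) (zz (Suc m) - Zp) = Fm (Suc m)"
    using crs_swap[of "?P - Zp"] by (simp add: Fm_def)
  also have "crs (zz m - Zp) (?P - Zp) = - Fm m" by (simp add: Fm_def)
  finally have eq: "D *\<^sub>R (?P - Zp) = (- Fm (Suc m)) *\<^sub>R (zz m - Zp) + Fm m *\<^sub>R (zz (Suc m) - Zp)"
    by (simp add: prod_eq_iff)
  define ca cb where "ca = - Fm (Suc m) / D" and "cb = Fm m / D"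
  have cD: "- Fm (Suc m) = D * ca" "Fm m = D * cb" using D0 by (simp_all add: ca_def cb_def)
  have "D *\<^sub>R (?P - Zp) = D *\<^sub>R (ca *\<^sub>R (zz m - Zp) + cb *\<^sub>R (zz (Suc m) - Zp))"
    unfolding eq cD by (simp add: scaleR_right_distrib)
  then have "?P - Zp = ca *\<^sub>R (zz m - Zp) + cb *\<^sub>R (zz (Suc m) - Zp)" using D0 by (metis less_irrefl scaleR_left_imp_eq)
  then have "?P = Zp + (ca *\<^sub>R (zz m - Zp) + cb *\<^sub>R (zz (Suc m) - Zp))" by (metis diff_add_cancel add.commute)
  also have "\<dots> = (1 - ca - cb) *\<^sub>R Zp + ca *\<^sub>R zz m + cb *\<^sub>R zz (Suc m)"
    by (simp add: prod_eq_iff algebra_simps)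
  finally have "?P = (1 - ca - cb) *\<^sub>R Zp + ca *\<^sub>R zz m + cb *\<^sub>R zz (Suc m)" .
  moreover have "0 \<le> ca" "0 \<le> cb" using m D0 by (auto simp: ca_def cb_def divide_nonpos_pos)
  moreover have "0 \<le> 1 - ca - cb"
  proof -
    have "D * (1 - ca - cb) = dl m ?P" using id1 D0 by (simp add: ca_def cb_def algebra_simps)
    then show ?thesis using third D0 by (metis mult_pos_neg not_less)
  qed
  moreover have "1 - ca - cb + ca + cb = 1" by simp
  ultimately have "?P \<in> convex hull {Zp, zz m, zz (Suc m)}"
    unfolding convex_hull_3 by blast
  also have "\<dots> \<subseteq> convex hull (zz ` {..J})" using m zz_0 by (intro hull_mono) force
  finally show ?thesis .
qed

lemma conv_half:
  assumes f: "\<And>t x y. f ((1 - t) *\<^sub>R x + t *\<^sub>R y) = (1 - t) * f x + t * (f (y::real\<times>real) :: real)"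
  shows "convex {p. 0 \<le> f p}" "convex {p. 0 < f p}" "convex {p. f p \<le> 0}"
proof -
  show "convex {p. 0 \<le> f p}" "convex {p. f p \<le> 0}" unfolding convex_alt
    by (auto simp: f conv_nonneg conv_nonpos)
  have "0 < (1 - t) * x + t * y" if "0 \<le> t" "t \<le> 1" "0 < x" "0 < y" for t x y :: real
    using that by (cases "t = 1") (auto intro: conv_pos)
  then show "convex {p. 0 < f p}" unfolding convex_alt by (auto simp: f)
qed

lemma pf_chain_pos: assumes "0 \<le> pf (zz j)" "0 < fst (zz j)" "fst (zm j) < 0" shows "0 < pf (zz j)"
proof (rule ccontr)
  assume "\<not> 0 < pf (zz j)"
  then have "pf (zm j) = 0" using assms by (simp add: zm_def pf_brR)
  then have "fst (zm j) = l * fst (zz j) + 1 / (1 + u)" by (simp add: pf_def zm_def)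
  moreover have "0 < l * fst (zz j)" "0 < 1 / (1 + u)" using l0 u1 assms by auto
  ultimately show False using assms by linarith
qed

text \<open>The point \<open>F n s\<close> is on the local stable manifold of \<open>X\<close>,
so its orbit tends to \<open>X\<close>.\<close>
definition land where "land n s \<longleftrightarrow> 0 \<le> fst (F n s) \<and> pf (F n s) = 0"

lemma land_pred: assumes "land (Suc n) s" "\<not> land n s" shows "fst (F n s) < 0"
proof (rule ccontr)
  assume "\<not> fst (F n s) < 0"
  then show False using assms u1 by (auto simp: land_def F_Suc pf_stp_R)
qed

text \<open>The hull of \<open>X\<close>, \<open>V1\<close> and the corners lies in the right
half plane on one side of the stable line of \<open>X\<close> and is mapped into itself by two
steps of the map: a point that goes left is clipped and then mapped by \<open>G\<close>, under
which corners go to corners, and a point that stays right lands in the triangle of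
\<open>triangle_up\<close>. Only the last corner can be on the stable line.\<close>
lemma hull_trap:
  assumes K: "1 \<le> K" and ch: "chain K" and pos: "\<And>j. j \<le> K \<Longrightarrow> 0 < fst (zz j) \<and> 0 \<le> pf (zz j)"
    and nxt: "fst (zm K) < 0 \<Longrightarrow> zz (Suc K) \<in> convex hull (zz ` {..K})"
    and s: "0 \<le> s" "s \<le> 1"
  shows "odd n \<Longrightarrow> 0 < fst (F n s)" "0 < s \<Longrightarrow> land n s \<Longrightarrow> (\<And>m. m < n \<Longrightarrow> \<not> land m s) \<Longrightarrow> odd n \<and> F n s = zz K"
proof -
  define S where "S = insert Xp (insert V1 (zz ` {..K}))"
  define M where "M = convex hull S"
  have posj: "0 < pf (zz j)" if "j < K" for j
    using pf_chain_pos[of j] pos[of j] chainD(2)[OF ch that] that by auto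
  have posK: "0 < pf (zz K)" if "fst (zm K) < 0" using pf_chain_pos[of K] pos[of K] that by auto
  have qz: "qf (zz j) \<le> 0" if "j \<le> K" for j using qf_zz chain_mono[OF ch that] by blast
  have MX: "0 < fst p \<and> 0 \<le> pf p \<and> qf p \<le> 0" if "p \<in> M" for p
  proof -
    let ?D = "{p. 0 < fst p} \<inter> {p. 0 \<le> pf p} \<inter> {p. qf p \<le> 0}"
    have "convex ?D" by (intro convex_Int conv_half) (auto simp: pf_aff qf_aff)
    moreover have "qf V1 \<le> 0"
      using width(1) xX0 u1 l0 by (simp add: qf_def V1_def) (smt (verit) mult_pos_pos)
    then have "S \<subseteq> ?D" using pos qz u1 xX0 by (auto simp: S_def pf_Xp qf_Xp pf_V1 V1_def[symmetric]) (simp add: V1_def)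
    ultimately have "M \<subseteq> ?D" unfolding M_def by (intro hull_minimal) auto
    then show ?thesis using that by auto
  qed
  have tri: "p \<in> M" if "0 \<le> pf p" "qf p \<le> 0" "0 \<le> snd p" for p
  proof -
    have "{Xp, V1, Zp} \<subseteq> S" using zz_0 by (force simp: S_def)
    then show ?thesis using triangle_up[OF that] hull_mono unfolding M_def by blast
  qed
  have zzM: "zz j \<in> M" if "j \<le> K" for j unfolding M_def using that by (intro hull_inc) (auto simp: S_def)
  have V1b: "0 < fst (brR V1)"
  proof -
    have "fst (brR V1) = (1 + l) / (1 + u)" using u1 by (simp add: brR_def V1_def a_def field_simps)
    then show ?thesis using u1 l0 by simp
  qed
  have faff: "fst (brR ((1 - t) *\<^sub>R x + t *\<^sub>R y)) = (1 - t) * fst (brR x) + t * fst (brR y)" for t x y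
    by (simp add: brR_aff)
  have Gaff: "G ((1 - t) *\<^sub>R x + t *\<^sub>R y) = (1 - t) *\<^sub>R G x + t *\<^sub>R G y" for t x y
    by (simp add: G_def brR_aff brL_aff)
  have zero: "0 < pf (G y) \<and> G y \<in> M" if y: "y \<in> M" "fst (brR y) = 0" for y
  proof -
    have w: "0 < fst y" "qf y \<le> 0" using MX y by auto
    have Gy: "G y = (1 + b * fst y, 0)" using y by (simp add: G_def brL_def)
    have "qf (brR y) \<le> 0" using w l0 by (simp add: qf_brR mult_le_0_iff)
    then have "u * fst y \<le> 1 / (1 - l)" using y by (simp add: qf_def)
    then have "l * (u * fst y) \<le> l * (1 / (1 - l))" using l0 by (intro mult_left_mono) auto
    moreover have "1 + l * (1 / (1 - l)) = 1 / (1 - l)" using l1 by (simp add: field_simps)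
    ultimately have 1: "qf (G y) \<le> 0" unfolding Gy by (simp add: qf_def b_def algebra_simps)
    have "1 / (1 + u) < 1" "0 < b * fst y" using u1 w b0 by auto
    then have 2: "0 < pf (G y)" unfolding Gy pf_def by simp
    show ?thesis using tri[of "G y"] 1 2 by (simp add: Gy)
  qed
  have clip: "G R \<in> C" if R: "R \<in> M" "fst (brR R) \<le> 0" and C: "convex C"
    and zC: "\<And>j. j \<le> K \<Longrightarrow> fst (zm j) < 0 \<Longrightarrow> zz (Suc j) \<in> C" and oC: "\<And>y. 0 < pf y \<Longrightarrow> y \<in> M \<Longrightarrow> y \<in> C" for R C
  proof -
    have "R \<in> {x. G x \<in> C}"
    proof (rule clip_hull[of "\<lambda>x. fst (brR x)" _ S])
      show "convex {x. G x \<in> C}" using C unfolding convex_alt by (auto simp: Gaff)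
      show "x \<in> {x. G x \<in> C}" if xS: "x \<in> S" "fst (brR x) \<le> 0" for x
      proof (cases "fst (brR x) = 0")
        case True
        have "x \<in> M" using xS by (simp add: M_def hull_inc)
        then show ?thesis using zero[of x] True oC by auto
      next
        case False
        have "x \<noteq> Xp" "x \<noteq> V1" using xS V1b xX0 by (auto simp: brR_Xp)
        then obtain j where j: "j \<le> K" "x = zz j" using xS(1) unfolding S_def by blast
        then have "fst (zm j) < 0" using False xS by (simp add: zm_def)
        then show ?thesis using zC[of j] j by (simp add: zz_Suc)
      qed
      show "y \<in> {x. G x \<in> C}" if "y \<in> convex hull S" "fst (brR y) = 0" for y
        using zero[of y] that oC by (auto simp: M_def)
    qed (use R in \<open>auto simp: faff M_def\<close>)
    then show ?thesis by simp
  qed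
  have GM: "G R \<in> M" if R: "R \<in> M" "fst (brR R) \<le> 0" for R
  proof (rule clip[OF R])
    show "convex M" by (simp add: M_def)
    show "zz (Suc j) \<in> M" if "j \<le> K" "fst (zm j) < 0" for j
    proof (cases "j = K")
      case True
      then have "zz (Suc j) \<in> convex hull (zz ` {..K})" using nxt that by simp
      also have "\<dots> \<subseteq> M" unfolding M_def S_def by (intro hull_mono) auto
      finally show ?thesis .
    next
      case False
      then show ?thesis using zzM[of "Suc j"] that by simp
    qed
  qed auto
  have Gz: "G R = zz K \<or> 0 < pf (G R)" if R: "R \<in> M" "fst (brR R) \<le> 0" for R
  proof -
    let ?C = "{y. y = zz K \<or> 0 < pf y}"
    have "G R \<in> ?C"
    proof (rule clip[OF R])
      show "convex ?C" unfolding convex_alt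
      proof (intro ballI allI impI)
        fix x y and t :: real assume x: "x \<in> ?C" and y: "y \<in> ?C" and t: "0 \<le> t \<and> t \<le> 1"
        have nn: "0 \<le> pf x" "0 \<le> pf y" using x y pos[of K] by auto
        show "(1 - t) *\<^sub>R x + t *\<^sub>R y \<in> ?C"
        proof (cases "t = 0 \<or> t = 1 \<or> (x = zz K \<and> y = zz K)")
          case True
          then show ?thesis using x y by (auto simp: scaleR_add_left[symmetric])
        next
          case False
          then have t': "0 < t" "0 < 1 - t" using t by auto
          have "0 < (1 - t) * pf x + t * pf y"
          proof (cases "x = zz K")
            case True
            then have "0 < pf y" using y False by auto
            then have "0 < t * pf y" "0 \<le> (1 - t) * pf x" using t' nn by simp_all
            then show ?thesis by linarith
          next
            case xn: False
            then have "0 < pf x" using x by auto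
            then have "0 < (1 - t) * pf x" "0 \<le> t * pf y" using t' nn by simp_all
            then show ?thesis by linarith
          qed
          then show ?thesis by (simp add: pf_aff)
        qed
      qed
      show "zz (Suc j) \<in> ?C" if "j \<le> K" "fst (zm j) < 0" for j
      proof (cases "j = K")
        case True
        then have h: "zz (Suc j) \<in> convex hull (zz ` {..K})" using nxt that by simp
        have "convex hull (zz ` {..K}) \<subseteq> {p. 0 < pf p}"
        proof (rule hull_minimal)
          show "zz ` {..K} \<subseteq> {p. 0 < pf p}" using posj posK that True by (force simp: le_less)
          show "convex {p. 0 < pf p}" by (rule conv_half) (rule pf_aff)
        qed
        then show ?thesis using h by auto
      next
        case False
        then show ?thesis using posj[of "Suc j"] that by (cases "Suc j = K") auto
      qed
    qed auto
    then show ?thesis by simp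
  qed
  have inv: "(even n \<longrightarrow> (\<exists>R\<in>M. F n s = brR R)) \<and> (odd n \<longrightarrow> F n s \<in> M)" for n
  proof (induction n)
    case 0
    have "convex M" "Xp \<in> M" "Zp \<in> M"
      using zzM[of 0] zz_0 by (simp_all add: M_def hull_inc S_def)
    then have "(1 - s) *\<^sub>R Xp + s *\<^sub>R Zp \<in> M" using s unfolding convex_alt by blast
    then show ?case using T_brR by auto
  next
    case (Suc n)
    show ?case
    proof (cases "even n")
      case True
      then obtain R where R: "R \<in> M" "F n s = brR R" using Suc by auto
      have "stp (brR R) \<in> M"
      proof (cases "0 \<le> fst (brR R)")
        case True
        have "0 \<le> pf (brR (brR R))" "qf (brR (brR R)) \<le> 0"
          using MX[OF R(1)] u1 l0 by (auto simp: pf_brR qf_brR mult_le_0_iff)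
        then show ?thesis using True tri by (simp add: stp_R)
      next
        case False
        then show ?thesis using GM[OF R(1)] by (simp add: stp_L G_def)
      qed
      then show ?thesis using True R by (simp add: F_Suc)
    next
      case False
      then have "F n s \<in> M" using Suc by auto
      then show ?thesis using False MX by (auto simp: F_Suc stp_R less_imp_le)
    qed
  qed
  show odd: "odd n \<Longrightarrow> 0 < fst (F n s)" for n using inv[of n] MX by auto
  show "odd n \<and> F n s = zz K" if "0 < s" "land n s" "\<And>m. m < n \<Longrightarrow> \<not> land m s"
  proof (cases n)
    case 0
    then show ?thesis using that pf_T[of s] s by (auto simp: land_def)
  next
    case (Suc m)
    then have neg: "fst (F m s) < 0" using land_pred[of m s] that by auto
    then have ev: "even m" using odd[of m] by auto
    then obtain R where R: "R \<in> M" "F m s = brR R" using inv[of m] by auto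
    then have "F n s = G R" using neg Suc by (simp add: F_Suc stp_L G_def)
    then show ?thesis using Gz[OF R(1)] R neg that ev Suc by (auto simp: land_def)
  qed
qed

section \<open>Where the crossing edge meets the axis\<close>

text \<open>If \<open>GL\<close> has real eigenvalues then only the first edge can cross the
axis, and the intersection is explicit.\<close>
lemma tau_c_real:
  assumes ab: "4 * b \<le> a\<^sup>2" and k: "\<And>N. 1 \<le> N \<Longrightarrow> N \<le> k \<Longrightarrow> 0 < Sb N"
    and z: "\<And>m. m \<le> k \<Longrightarrow> 0 < fst (zz m)" and t: "0 \<le> t" "t \<le> 1"
    and c: "c = zz k + t *\<^sub>R uu k" "fst c = 0"
  shows "0 < tau c"
proof -
  have ul5: "5 * l < u"
  proof (rule ccontr)
    assume "\<not> 5 * l < u"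
    then have "0 \<le> (5 * l - u) * (u - l)" using lu by (intro mult_nonneg_nonneg) auto
    moreover have "a\<^sup>2 - 4 * b = (u - l)\<^sup>2 - 4 * u * l" by (simp add: a_def b_def)
    ultimately have "a\<^sup>2 - 4 * b \<le> - 4 * l\<^sup>2" by (simp add: power2_eq_square algebra_simps)
    moreover have "0 < l\<^sup>2" using l0 by simp
    ultimately show False using ab by linarith
  qed
  have l2: "2 * l < 1"
  proof (rule ccontr)
    assume "\<not> 2 * l < 1"
    then have "1 / 2 \<le> l" "5 / 2 \<le> u" using ul5 by auto
    then have "(5 / 2) * (1 / 2) \<le> u * l" by (intro mult_mono) auto
    then show False using ul1 by simp
  qed
  have k1': "k \<le> 1"
  proof (rule ccontr)
    assume "\<not> k \<le> 1"
    then have "0 < Sb 2" using k[of 2] by simp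
    moreover have "b\<^sup>2 * Sb (Suc (Suc 0)) = 1 + (2 * b - a\<^sup>2) * Sb (Suc 0)" using Sb_rec[of 0] by simp
    moreover have S1: "Sb (Suc 0) = 1 / b\<^sup>2" by (simp add: Sb_Suc)
    moreover have "(2 * b - a\<^sup>2) * (1 / b\<^sup>2) \<le> (- 2 * b) * (1 / b\<^sup>2)" using ab by (intro mult_right_mono) auto
    moreover have "(- 2 * b) * (1 / b\<^sup>2) = - 2 / b" using b0 by (simp add: power2_eq_square)
    moreover have "- 2 / b < - 1" using b0 b1 by (simp add: field_simps)
    moreover have "0 < b\<^sup>2 * Sb (Suc (Suc 0))" using \<open>0 < Sb 2\<close> b0 by (simp add: numeral_2_eq_2)
    ultimately show False by (smt (verit))
  qed
  have k0: "k = 0"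
  proof (rule ccontr)
    assume "k \<noteq> 0"
    then have k1: "k = 1" using k1' by simp
    have "fst (uu 1) = mm * ((a\<^sup>2 - b) * (u - 2 * l) - a * b)"
      unfolding One_nat_def uu_Suc uu_0 by (simp add: GL_def power2_eq_square algebra_simps)
    moreover have "(3 * b) * (u - 2 * l) \<le> (a\<^sup>2 - b) * (u - 2 * l)" using ab ul5 l0 by (intro mult_right_mono) auto
    moreover have "(3 * b) * (u - 2 * l) - a * b = b * (2 * u - 5 * l)" by (simp add: a_def algebra_simps)
    moreover have "0 < b * (2 * u - 5 * l)" using b0 ul5 u1 by (intro mult_pos_pos) auto
    ultimately have "0 < fst (uu 1)" using mm0 by simp
    then have "0 \<le> t * fst (uu k)" using t k1 by simp
    then have "0 < fst c" using z[of k] c by simp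
    then show False using c by simp
  qed
  define z0 where "z0 = 1 / (1 - l)"
  have zp: "0 < z0" using l1 by (simp add: z0_def)
  have x: "z0 = t * (mm * (u - 2 * l))" "snd c = - (t * mm)"
    using c k0 by (simp_all add: zz_0 uu_0 Zp_def z0_def)
  have key: "l * (u - 1) < (1 - l) * (u - 2 * l)"
  proof -
    have "(1 - l) * (u - 2 * l) - l * (u - 1) = (u - l) * (1 - 2 * l)" by (simp add: algebra_simps)
    moreover have "0 < (u - l) * (1 - 2 * l)" using lu l2 by (intro mult_pos_pos) auto
    ultimately show ?thesis by linarith
  qed
  have tm: "0 \<le> t * mm" using t mm0 by simp
  have "t * mm * (l * (u - 1)) \<le> t * mm * ((1 - l) * (u - 2 * l))" using key tm by (intro mult_left_mono) auto
  also have "\<dots> = (1 - l) * z0" unfolding x(1) by (simp only: ac_simps)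
  also have "\<dots> = 1" using l1 by (simp add: z0_def)
  finally have le: "t * mm * (l * (u - 1)) \<le> 1" .
  have "t * mm \<noteq> 0" using x zp by (metis mult.assoc mult_zero_left less_irrefl)
  then have "0 < t * mm" using tm by linarith
  then have "t * mm * (l * (u - 1)) < t * mm * ((1 - l) * (u - 2 * l))" using key by (rule mult_strict_left_mono[rotated])
  then have "t * mm * (l * (u - 1)) < 1" using le \<open>t * mm * ((1 - l) * (u - 2 * l)) = (1 - l) * z0\<close> \<open>(1 - l) * z0 = 1\<close> by simp
  then have "(u - 1) * (l * (t * mm)) < 1" by (simp add: ac_simps)
  then have "l * (t * mm) < 1 / (u - 1)" using u1 by (simp add: field_simps)
  then show ?thesis using c x by (simp add: tau_def)
qed

text \<open>\<open>Rc\<close> is the fixed point of \<open>G\<close>, and \<open>q0\<close> is a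
quadratic form that \<open>GL\<close> multiplies by its determinant. In the rotating case it is
definite, and the corners move inwards on ellipses around \<open>Rc\<close>.\<close>
definition Dl where "Dl = (1 - b)\<^sup>2 + a\<^sup>2"
lemma Dl0: "0 < Dl" using a0 by (simp add: Dl_def add_nonneg_pos)
definition Rc where "Rc = ((1 - b + a) / Dl, (1 - b - a) / Dl)"
definition q0 where "q0 v = (fst v)\<^sup>2 - a * fst v * snd v + b * (snd (v::real\<times>real))\<^sup>2"

lemma G_Rc: "G Rc = Rc"
proof -
  define x w where "x = fst Rc" and "w = snd Rc"
  have D: "x * Dl = 1 - b + a" "w * Dl = 1 - b - a" using Dl0 by (simp_all add: x_def w_def Rc_def)
  have "(1 + b * w - a * x - w) * Dl = Dl - (1 - b) * (w * Dl) - a * (x * Dl)" by (simp add: algebra_simps)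
  also have "\<dots> = 0" unfolding D by (simp add: Dl_def power2_eq_square algebra_simps)
  finally have 1: "1 + b * w - a * x = w" using Dl0 by simp
  have "(1 + b * x + a * w - x) * Dl = Dl - (1 - b) * (x * Dl) + a * (w * Dl)" by (simp add: algebra_simps)
  also have "\<dots> = 0" unfolding D by (simp add: Dl_def power2_eq_square algebra_simps)
  finally have 2: "1 + b * x + a * w = x" using Dl0 by simp
  show ?thesis using 1 2 by (simp add: G_def brR_def brL_def prod_eq_iff x_def w_def)
qed

lemma q0_GL: "q0 (GL v) = b\<^sup>2 * q0 v"
  by (simp add: q0_def GL_def power2_eq_square algebra_simps)

definition Qe where "Qe p = q0 (p - Rc)"
lemma Qe_G: "Qe (G p) = b\<^sup>2 * Qe p"
  using G_diff[of p Rc] by (simp add: Qe_def G_Rc q0_GL)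

text \<open>The axis point of the stable line of \<open>Y\<close> lies on a larger ellipse than
\<open>zz 0\<close>.\<close>
lemma Qe_cmp: "Qe (0, - (1 / (l * (u - 1)))) > Qe Zp"
proof -
  define z W where "z = 1 / (1 - l)" and "W = 1 / (l * (u - 1))"
  define x w where "x = fst Rc" and "w = snd Rc"
  have D: "x * Dl = 1 - b + a" "w * Dl = 1 - b - a" using Dl0 by (simp_all add: x_def w_def Rc_def)
  have zz1: "z * (1 - l) = 1" and WW: "W * (l * (u - 1)) = 1" using l1 l0 u1 by (simp_all add: z_def W_def)
  define c d where "c = 1 - l" and "d = l * (u - 1)"
  have cd: "z * c = 1" "W * d = 1" using zz1 WW by (simp_all add: c_def d_def)
  define L where "L = b * W\<^sup>2 + W * (2 * b * w - a * x) - z\<^sup>2 + z * (2 * x - a * w)"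
  have diff: "Qe (0, - W) - Qe Zp = L"
    by (simp add: Qe_def q0_def Zp_def x_def[symmetric] w_def[symmetric] z_def[symmetric] L_def power2_eq_square algebra_simps)
  have "L * Dl * (c\<^sup>2 * d\<^sup>2) = Dl * (b * (W * d)\<^sup>2 * c\<^sup>2 - (z * c)\<^sup>2 * d\<^sup>2)
     + (W * d) * d * c\<^sup>2 * (2 * b * (w * Dl) - a * (x * Dl)) + (z * c) * c * d\<^sup>2 * (2 * (x * Dl) - a * (w * Dl))"
    by (simp add: L_def power2_eq_square algebra_simps)
  also have "\<dots> = Dl * (b * c\<^sup>2 - d\<^sup>2) + d * c\<^sup>2 * (2 * b * (1 - b - a) - a * (1 - b + a)) + c * d\<^sup>2 * (2 * (1 - b + a) - a * (1 - b - a))"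
    unfolding cd D by simp
  also have "\<dots> = 2 * l * (1 - b) * ((1 - l) ^ 3 + (u - 1) * (1 - l)\<^sup>2 + (u - 1)\<^sup>2 * l * (1 - l) + (u - 1) ^ 3 * l\<^sup>2)"
    unfolding Dl_def c_def d_def a_def b_def power2_eq_square power3_eq_cube by (simp add: algebra_simps)
  also have "\<dots> > 0" using l0 l1 u1 b1
    by (intro mult_pos_pos add_pos_pos) auto
  finally have "0 < L * (Dl * (c\<^sup>2 * d\<^sup>2))" by (simp add: mult.assoc)
  moreover have "0 < Dl * (c\<^sup>2 * d\<^sup>2)" using Dl0 l1 l0 u1 by (simp add: c_def d_def)
  ultimately have "0 < L" by (simp add: zero_less_mult_iff)
  then show ?thesis using diff by (simp add: W_def)
qed

lemma Qe_axis_mono: assumes w: "w \<le> - (1 / (l * (u - 1)))"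
  shows "Qe (0, - (1 / (l * (u - 1)))) \<le> Qe (0, w)"
proof -
  define W where "W = 1 / (l * (u - 1))"
  have WW: "W * (l * (u - 1)) = 1" and W0: "0 < W" using l0 u1 by (simp_all add: W_def)
  define x y where "x = fst Rc" and "y = snd Rc"
  have D: "x * Dl = 1 - b + a" "y * Dl = 1 - b - a" using Dl0 by (simp_all add: x_def y_def Rc_def)
  have "Qe (0, w) - Qe (0, - W) = (w + W) * (b * (w - W) - (2 * b * y - a * x))"
    by (simp add: Qe_def q0_def x_def[symmetric] y_def[symmetric] power2_eq_square algebra_simps)
  moreover have "0 \<le> (w + W) * (b * (w - W) - (2 * b * y - a * x))"
  proof (rule mult_nonpos_nonpos)
    show "w + W \<le> 0" using w by (simp add: W_def)
    define m v where "m = 1 - l" and "v = u - 1"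
    have mv: "0 < m" "0 < v" using l1 u1 by (simp_all add: m_def v_def)
    have bW: "v * (b * W) = u" using WW by (simp add: b_def v_def algebra_simps)
    have "v * ((2 * b * W - (a * x - 2 * b * y)) * Dl) = 2 * (v * (b * W)) * Dl - v * (a * (x * Dl) - 2 * b * (y * Dl))"
      by (simp add: algebra_simps)
    also have "\<dots> = 2 * u * Dl - v * (a * (1 - b + a) - 2 * b * (1 - b - a))" unfolding bW D by simp
    also have "\<dots> = 4 * m\<^sup>2 + 2 * v\<^sup>2 * m\<^sup>2 + 4 * v * m\<^sup>2 + m * (2 * v * m + v ^ 3 + v\<^sup>2 * m)"
      unfolding Dl_def m_def v_def a_def b_def power2_eq_square power3_eq_cube by (simp add: algebra_simps)
    also have "\<dots> > 0" using mv by (intro add_pos_pos mult_pos_pos) auto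
    finally have "0 < v * ((2 * b * W - (a * x - 2 * b * y)) * Dl)" .
    then have "0 < 2 * b * W - (a * x - 2 * b * y)" using mv Dl0 by (simp add: zero_less_mult_iff)
    moreover have "b * (w - W) \<le> b * (- 2 * W)" using w b0 by (intro mult_left_mono) (auto simp: W_def)
    ultimately show "b * (w - W) - (2 * b * y - a * x) \<le> 0" by (simp add: algebra_simps)
  qed
  ultimately show ?thesis by (simp add: W_def)
qed

text \<open>Corners and hence edges lie inside the ellipse through \<open>zz 0\<close>, and the
axis points below the stable line of \<open>Y\<close> lie outside of it.\<close>
lemma tau_c_complex:
  assumes ab: "a\<^sup>2 < 4 * b" and t: "0 \<le> t" "t \<le> 1" and c: "c = zz k + t *\<^sub>R uu k" "fst c = 0"
  shows "0 < tau c"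
proof -
  have q0nn: "0 \<le> q0 v" for v
  proof -
    have "4 * q0 v = (2 * fst v - a * snd v)\<^sup>2 + (4 * b - a\<^sup>2) * (snd v)\<^sup>2"
      by (simp add: q0_def power2_eq_square algebra_simps)
    also have "\<dots> \<ge> 0" using ab by (intro add_nonneg_nonneg mult_nonneg_nonneg) auto
    finally show ?thesis by simp
  qed
  have dec: "Qe (zz m) \<le> Qe Zp" for m
  proof (induction m)
    case (Suc m)
    have "b\<^sup>2 * Qe (zz m) \<le> 1 * Qe (zz m)" using q0nn[of "zz m - Rc"] b0 b1
      by (intro mult_right_mono) (auto simp: Qe_def power_le_one)
    then show ?case using Suc by (simp add: zz_Suc Qe_G)
  qed (simp add: zz_0)
  have c': "c = (1 - t) *\<^sub>R zz k + t *\<^sub>R zz (Suc k)" using c by (simp add: uu_def algebra_simps)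
  have "Qe c = (1 - t) * Qe (zz k) + t * Qe (zz (Suc k)) - t * (1 - t) * q0 (zz k - zz (Suc k))"
    unfolding c' Qe_def q0_def by (simp add: power2_eq_square algebra_simps)
  moreover have "0 \<le> t * (1 - t) * q0 (zz k - zz (Suc k))" using t q0nn by simp
  moreover have "(1 - t) * Qe (zz k) + t * Qe (zz (Suc k)) \<le> (1 - t) * Qe Zp + t * Qe Zp"
    using dec t by (intro add_mono mult_left_mono) auto
  ultimately have Qc: "Qe c \<le> Qe Zp" by (simp add: algebra_simps)
  have cw: "c = (0, snd c)" using c by (simp add: prod_eq_iff)
  have "- (1 / (l * (u - 1))) < snd c"
  proof (rule ccontr)
    assume "\<not> ?thesis"
    then have "Qe (0, - (1 / (l * (u - 1)))) \<le> Qe (0, snd c)" by (intro Qe_axis_mono) simp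
    then show False using Qc Qe_cmp cw by simp
  qed
  then have "l * (- (1 / (l * (u - 1)))) < l * snd c" using l0 by (intro mult_strict_left_mono) auto
  then show ?thesis using c l0 by (simp add: tau_def)
qed

lemma tau_c:
  assumes "\<And>N. 1 \<le> N \<Longrightarrow> N \<le> k \<Longrightarrow> 0 < Sb N" and "\<And>m. m \<le> k \<Longrightarrow> 0 < fst (zz m)" and "0 \<le> t" "t \<le> 1"
    and "c = zz k + t *\<^sub>R uu k" "fst c = 0"
  shows "0 < tau c"
  using tau_c_real[OF _ assms] tau_c_complex[OF _ assms(3-6)] by (cases "4 * b \<le> a\<^sup>2") auto

end

section \<open>An edge that crosses the axis\<close>

text \<open>The first parameter at which a segment leaves an intersection of three half planes,
if it does leave.\<close>
lemma affine_exit: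
  fixes p1 p2 p3 q1 q2 q3 :: real
  assumes p: "0 \<le> p1" "0 \<le> p2" "0 \<le> p3" and q: "q3 < 0"
  shows "\<exists>s. 0 \<le> s \<and> s < 1 \<and> 0 \<le> (1 - s) * p1 + s * q1 \<and> 0 \<le> (1 - s) * p2 + s * q2
    \<and> 0 \<le> (1 - s) * p3 + s * q3
    \<and> ((1 - s) * p1 + s * q1 = 0 \<or> (1 - s) * p2 + s * q2 = 0 \<or> (1 - s) * p3 + s * q3 = 0)"
proof -
  define r where "r p q = (if q < 0 then p / (p - q) else 1)" for p q :: real
  have r01: "0 \<le> r p q" "r p q \<le> 1" "r p q < 1 \<Longrightarrow> q < 0" "q < 0 \<Longrightarrow> r p q < 1" if "0 \<le> p" for p q
    using that by (auto simp: r_def divide_simps split: if_splits)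
  have rz: "(1 - r p q) * p + r p q * q = 0" if "0 \<le> p" "q < 0" for p q
    using that by (simp add: r_def divide_simps)
  have nn: "0 \<le> (1 - s) * p + s * q" if "0 \<le> p" "0 \<le> s" "s \<le> r p q" "s \<le> 1" for p q s
  proof (cases "q < 0")
    case True
    have "0 \<le> (r p q - s) * (p - q)" using that True by (intro mult_nonneg_nonneg) auto
    then have "(1 - r p q) * p + r p q * q \<le> (1 - s) * p + s * q" by (simp add: algebra_simps)
    then show ?thesis using rz[of p q] that True by simp
  next
    case False
    then show ?thesis using that by (intro add_nonneg_nonneg mult_nonneg_nonneg) auto
  qed
  define s where "s = min (r p1 q1) (min (r p2 q2) (r p3 q3))"
  have s: "0 \<le> s" "s \<le> r p1 q1" "s \<le> r p2 q2" "s \<le> r p3 q3" "s \<le> 1" using r01 p by (auto simp: s_def min_def)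
  have s1: "s < 1" using s r01(4)[of p3 q3] p q by auto
  have "s = r p1 q1 \<or> s = r p2 q2 \<or> s = r p3 q3" by (auto simp: s_def min_def)
  then have "(1 - s) * p1 + s * q1 = 0 \<or> (1 - s) * p2 + s * q2 = 0 \<or> (1 - s) * p3 + s * q3 = 0"
    using rz r01(3) p s1 by metis
  then show ?thesis using s s1 nn p by blast
qed

context lozi_uv begin

text \<open>The image of the axis under \<open>G\<close> is the zero set. Points \<open>G
p\<close> with \<open>p\<close> in the right half plane are on the nonnegative side.\<close>
definition hh where "hh p = fst p - 1 - a * snd p"
lemma hh_aff: "hh ((1 - t) *\<^sub>R p + t *\<^sub>R q) = (1 - t) * hh p + t * hh q"
  by (simp add: hh_def algebra_simps)
lemma hh_brL: "hh (brL p) = b * snd p" by (simp add: hh_def brL_def)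
lemma hh_G: "hh (G p) = b * fst p" by (simp add: G_def hh_brL)
lemma sg_hh: "sg p = hh p + l / (1 + l) - l * snd p"
  using l0 by (simp add: sg_def hh_def a_def field_simps)
lemma sg_of_hh: assumes "0 \<le> hh p" "snd p \<le> 0" shows "0 < sg p"
proof -
  have "0 < l / (1 + l)" "l * snd p \<le> 0" using l0 assms by (auto simp: mult_le_0_iff)
  then show ?thesis unfolding sg_hh using assms by linarith
qed
lemma snd_of_hh: assumes "0 \<le> hh p" "fst p \<le> 0" shows "snd p < 0"
proof -
  have "a * snd p \<le> - 1" using assms by (simp add: hh_def)
  then show ?thesis using a0 by (smt (verit) mult_nonneg_nonneg)
qed

definition brLi where "brLi p = (snd p, (fst p - 1 - a * snd p) / b)"
lemma brL_brLi: "brL (brLi p) = p" using b0 by (simp add: brLi_def brL_def prod_eq_iff)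
lemma brL_brLi_iter: "j \<le> n \<Longrightarrow> (brL ^^ j) ((brLi ^^ n) p) = (brLi ^^ (n - j)) p"
proof (induction j)
  case (Suc j)
  then have "n - j = Suc (n - Suc j)" by simp
  then show ?case using Suc by (simp add: brL_brLi)
qed simp
lemma brLi_tau_sg: "tau (brLi p) = tau p / u" "sg (brLi p) = - (sg p / l)"
proof -
  show "tau (brLi p) = tau p / u" using tau_brL[of "brLi p"] u1 by (simp add: brL_brLi)
  have "sg p = - l * sg (brLi p)" using sg_brL[of "brLi p"] by (simp add: brL_brLi)
  then show "sg (brLi p) = - (sg p / l)" using l0 by simp
qed

text \<open>Backward iterates of \<open>brL\<close> on the unstable line of \<open>Y\<close>
move towards \<open>Y\<close>, which is in the left half plane.\<close>
lemma fst_brLi_iter: assumes "sg p = 0" "fst p < 0" shows "fst ((brLi ^^ m) p) < 0"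
proof -
  have ul: "0 < u + l" using u1 l0 by simp
  have "sg ((brLi ^^ m) p) = 0 \<and> u * tau ((brLi ^^ m) p) < dY"
  proof (induction m)
    case 0
    have "(u + l) * fst p < 0" using assms ul by (simp add: mult_pos_neg)
    then show ?case using fst_tau_sg[of p] assms by simp
  next
    case (Suc m)
    let ?q = "(brLi ^^ m) p"
    have "tau ?q / u \<le> tau ?q \<or> tau ?q / u \<le> 0" using u1 by (cases "0 \<le> tau ?q") (auto simp: field_simps mult_le_cancel_left)
    then have "u * (tau ?q / u) \<le> u * tau ?q \<or> u * (tau ?q / u) \<le> 0" using u1 by (auto simp: mult_le_0_iff divide_le_0_iff)
    then have "u * tau (brLi ?q) < dY" using Suc dY0 unfolding brLi_tau_sg by auto
    then show ?case using Suc by (simp add: brLi_tau_sg)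
  qed
  then have "(u + l) * fst ((brLi ^^ m) p) < 0" using fst_tau_sg[of "(brLi ^^ m) p"] by simp
  then show ?thesis using ul by (simp add: mult_less_0_iff)
qed

text \<open>A point on the boundary \<open>sg = 0\<close> of the tooth, close to the axis, where
the other two inequalities are strict.\<close>
lemma beta: "\<exists>p. sg p = 0 \<and> fst p < 0 \<and> pf p < 0 \<and> 0 < pf (brL p)"
proof -
  define ka where "ka = u / (1 + u) - l / (1 + l)"
  have ka: "0 < ka"
  proof -
    have "u / (1 + u) - l / (1 + l) = 1 / (1 + l) - 1 / (1 + u)"
      using u1 l0 by (simp add: divide_simps) (simp add: algebra_simps)
    then show ?thesis using kappa_pos by (simp add: ka_def)
  qed
  define e where "e = ka / (2 * a)"
  have e: "0 < e" "2 * (a * e) = ka" using ka a0 by (simp_all add: e_def)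
  define p where "p = (- e, - (e + 1 / (1 + l)) / u)"
  have f: "fst p = - e" by (simp add: p_def)
  have us: "u * snd p = - e - 1 / (1 + l)" using u1 by (simp add: p_def)
  have s: "sg p = 0" using us by (simp add: sg_def f)
  have "u * pf p = u * fst p - l * (u * snd p) - u / (1 + u)" by (simp add: pf_def algebra_simps)
  also have "\<dots> = - (a * e) - ka" unfolding f us by (simp add: a_def ka_def algebra_simps)
  finally have up: "u * pf p = - (a * e) - ka" .
  then have "u * pf p < 0" using e ka a0 by (smt (verit) mult_pos_pos)
  then have "pf p < 0" using u1 by (simp add: mult_less_0_iff)
  have "pf (brL p) = a * e + ka - 2 * (a * e)" using up by (simp add: pf_brL f)
  moreover have "0 < a * e" using a0 e by simp
  ultimately have "0 < pf (brL p)" "pf p < 0" using e(2) \<open>pf p < 0\<close> by linarith+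
  then show ?thesis using s f e by (intro exI[of _ p]) simp
qed

text \<open>The first \<open>n\<close> left iterates are iterates of the map itself.\<close>
definition stays_left where "stays_left n p \<longleftrightarrow> (\<forall>j<n. fst ((brL ^^ j) p) \<le> 0)"
lemma F_gen: "stays_left n (F m s) \<Longrightarrow> j \<le> n \<Longrightarrow> F (m + j) s = (brL ^^ j) (F m s)"
  by (induction j) (simp_all add: stays_left_def F_Suc stp_L)

lemma uu_ne0: "uu j \<noteq> 0"
proof
  assume "uu j = 0"
  then have "crs (uu j) (uu (Suc j)) = 0" by (simp add: crs_def)
  then show False using crs_uu_Suc[of j] k1_neg b0 by simp
qed
lemma dl_zero_line: assumes "dl j p = 0" shows "\<exists>t. p = zz j + t *\<^sub>R uu j"
proof -
  have c: "fst (uu j) * snd (p - zz j) = snd (uu j) * fst (p - zz j)" using assms by (simp add: dl_def crs_def)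
  have "fst (uu j) \<noteq> 0 \<or> snd (uu j) \<noteq> 0" using uu_ne0[of j] by (auto simp: prod_eq_iff)
  then obtain t where "p - zz j = t *\<^sub>R uu j"
  proof
    assume h: "fst (uu j) \<noteq> 0"
    show ?thesis by (rule that[of "fst (p - zz j) / fst (uu j)"]) (use h c in \<open>simp add: prod_eq_iff field_simps\<close>)
  next
    assume h: "snd (uu j) \<noteq> 0"
    show ?thesis by (rule that[of "snd (p - zz j) / snd (uu j)"]) (use h c in \<open>simp add: prod_eq_iff field_simps\<close>)
  qed
  then show ?thesis by (metis add.commute diff_add_cancel)
qed
lemma dl_form: "dl j p = - fst (uu j) * (snd p - snd (zz j)) + snd (uu j) * (fst p - fst (zz j))"
  by (simp add: dl_def crs_def)
lemma dl_line: "dl k (zz (Suc k) + t *\<^sub>R uu (Suc k)) = - t * (b ^ (2 * k) * k1)"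
  "dl (Suc k) (zz k + t *\<^sub>R uu k) = - (1 - t) * (b ^ (2 * k) * k1)"
proof -
  have "zz (Suc k) + t *\<^sub>R uu (Suc k) - zz k = uu k + t *\<^sub>R uu (Suc k)"
    by (subst (2) uu_def) simp
  then show "dl k (zz (Suc k) + t *\<^sub>R uu (Suc k)) = - t * (b ^ (2 * k) * k1)"
    unfolding dl_def by (simp only: crs_lin crs_uu_Suc)
  have "zz k + t *\<^sub>R uu k - zz (Suc k) = (- (1 - t)) *\<^sub>R uu k" by (simp add: uu_def algebra_simps)
  then have "dl (Suc k) (zz k + t *\<^sub>R uu k) = (1 - t) * crs (uu (Suc k)) (uu k)"
    by (simp only: dl_def crs_lin minus_minus mult_minus_left)
  also have "crs (uu (Suc k)) (uu k) = - (b ^ (2 * k) * k1)" using crs_swap[of "uu (Suc k)"] by (simp add: crs_uu_Suc)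
  finally show "dl (Suc k) (zz k + t *\<^sub>R uu k) = - (1 - t) * (b ^ (2 * k) * k1)"
    by (simp only: mult_minus_left mult_minus_right)
qed
lemma bk1_neg: "b ^ (2 * k) * k1 < 0" using b0 k1_neg by (simp add: mult_pos_neg)

lemma snd_tooth: assumes "sg p > 0" "pf p \<le> 0 \<or> fst p \<le> 0" shows "snd p < 0"
  using sg_pf_snd_neg[of p] sg_kappa_snd_neg[of p] assms by auto

end

text \<open>The edge from \<open>zz k\<close> to \<open>zz (k + 1)\<close> is the first one to
cross the axis, and it does so before the corners spiral inwards. By \<open>AV\<close>, points
of this edge and of the next one do not reach the tooth while they stay in the left half plane.
In this form the assumption follows from the absence of crossings for finitely many curves
together with a bound on \<open>tau\<close>, and so it is available for parameters near the
frontier.\<close>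
locale lozi_C = lozi_uv +
  fixes k :: nat
  assumes ch: "chain (Suc k)" and zneg: "fst (zz (Suc k)) \<le> 0"
    and SbP: "\<And>N. 1 \<le> N \<Longrightarrow> N \<le> k \<Longrightarrow> 0 < Sb N"
    and AV: "\<And>s m n. s0 \<le> s \<Longrightarrow> s \<le> 1 \<Longrightarrow> m = 2 * k + 1 \<or> m = 2 * k + 3 \<Longrightarrow> even n \<Longrightarrow>
      (\<And>j. j < n \<Longrightarrow> fst (F (m + j) s) \<le> 0) \<Longrightarrow> \<not> tooth (F (m + n) s)"
begin

lemma AVg: assumes "s0 \<le> s" "s \<le> 1" "m = 2 * k + 1 \<or> m = 2 * k + 3" "even n" "stays_left n (F m s)"
  shows "\<not> tooth ((brL ^^ n) (F m s))"
proof -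
  have "fst (F (m + j) s) \<le> 0" if "j < n" for j
    using F_gen[OF assms(5), of j] assms(5) that by (simp add: stays_left_def)
  then have "\<not> tooth (F (m + n) s)" using AV assms by blast
  then show ?thesis using F_gen[OF assms(5), of n] by simp
qed

lemma zz_pos: "j \<le> k \<Longrightarrow> 0 < fst (zz j)" "j \<le> k \<Longrightarrow> fst (zm j) < 0"
  using ch by (simp_all add: chain_def)
lemma SbN: "N \<le> k \<Longrightarrow> 0 \<le> Sb N" using SbP[of N] by (cases "N = 0") auto

text \<open>The parameter of the point \<open>cc = (0, wc)\<close> where the edge crosses the
axis.\<close>
definition th where "th = fst (zz k) / (fst (zz k) - fst (zz (Suc k)))"
lemma th: "0 < th" "th \<le> 1"
  using zz_pos(1)[of k] zneg by (auto simp: th_def divide_simps)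
definition cc where "cc = zz k + th *\<^sub>R uu k"
lemma al_neg: "fst (uu k) < 0" using zz_pos(1)[of k] zneg by (simp add: uu_def)
lemma fst_cc: "fst cc = 0"
proof -
  have "th * (fst (zz k) - fst (zz (Suc k))) = fst (zz k)" using al_neg by (simp add: th_def uu_def)
  then show ?thesis by (simp add: cc_def uu_def algebra_simps)
qed
definition wc where "wc = snd cc"
lemma cc: "cc = (0, wc)" by (simp add: wc_def fst_cc prod_eq_iff)
lemma cc_conv: "cc = (1 - th) *\<^sub>R zz k + th *\<^sub>R zz (Suc k)" by (simp add: cc_def uu_def algebra_simps)
lemma fst_line_th: assumes "fst (zz k + t *\<^sub>R uu k) \<le> 0" shows "th \<le> t"
proof (rule ccontr)
  assume "\<not> th \<le> t"
  then have "th * fst (uu k) < t * fst (uu k)" using al_neg by (simp add: mult_strict_right_mono_neg)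
  then show False using assms fst_cc by (simp add: cc_def)
qed
lemma fst_line_th': assumes "0 \<le> fst (zz k + t *\<^sub>R uu k)" shows "t \<le> th"
proof (rule ccontr)
  assume "\<not> t \<le> th"
  then have "t * fst (uu k) < th * fst (uu k)" using al_neg by (simp add: mult_strict_right_mono_neg)
  then show False using assms fst_cc by (simp add: cc_def)
qed

lemma F_edge1: assumes "s0 \<le> s" "s \<le> 1" shows "F (2 * k + 1) s = zz k + par s *\<^sub>R uu k"
proof -
  have "F (Suc (2 * k)) s = (1 - par s) *\<^sub>R zz k + par s *\<^sub>R zz (Suc k)"
    using chain_F(2)[OF assms, of k] chain_mono[OF ch, of k] zz_pos[of k] by simp
  then show ?thesis by (simp add: uu_def algebra_simps)
qed

text \<open>The two sign conditions cut the part of the edge in the left half plane out of the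
line.\<close>
lemma edge1:
  assumes "dl k p = 0" "0 \<le> dl (Suc k) p" "fst p \<le> 0"
  shows "\<exists>s. s0 \<le> s \<and> s \<le> 1 \<and> p = F (2 * k + 1) s"
proof -
  obtain t where t: "p = zz k + t *\<^sub>R uu k" using dl_zero_line assms by blast
  have "0 \<le> (1 - t) * (- (b ^ (2 * k) * k1))" using assms(2) unfolding t dl_line by linarith
  then have "t \<le> 1" using bk1_neg[of k] by (smt (verit) mult_neg_pos)
  moreover have "0 \<le> t" using fst_line_th[of t] assms(3) t th by simp
  ultimately show ?thesis using F_edge1[of "unpar t"] unpar[of t] t by (intro exI[of _ "unpar t"]) simp
qed

text \<open>The point is \<open>G R\<close> with \<open>R\<close> on the line through the
crossing edge; the hypotheses place \<open>R\<close> on the right part of the edge, and the edge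
is mapped by the map itself.\<close>
lemma edge2:
  assumes "dl (Suc k) p = 0" "0 \<le> dl k p" "0 \<le> hh p" "snd p \<le> 0"
  shows "\<exists>s. s0 \<le> s \<and> s \<le> 1 \<and> p = F (2 * k + 3) s \<and> 0 \<le> fst (F (2 * k + 1) s) \<and> fst (F (2 * k + 2) s) \<le> 0"
proof -
  obtain t where t: "p = zz (Suc k) + t *\<^sub>R uu (Suc k)" using dl_zero_line assms by blast
  have "0 \<le> t * (- (b ^ (2 * k) * k1))" using assms(2) unfolding t dl_line by simp
  then have t0: "0 \<le> t" using bk1_neg[of k] by (smt (verit) mult_neg_pos)
  define R where "R = zz k + t *\<^sub>R uu k"
  have pG: "p = G R"
  proof -
    have "G R - G (zz k) = GL (t *\<^sub>R uu k)" unfolding G_diff R_def by simp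
    then have "G R = zz (Suc k) + t *\<^sub>R uu (Suc k)" by (simp add: GL_lin zz_Suc uu_Suc algebra_simps)
    then show ?thesis using t by simp
  qed
  have R0: "0 \<le> fst R" using assms(3) b0 unfolding pG hh_G by (simp add: zero_le_mult_iff)
  then have t1: "t \<le> 1" using fst_line_th'[of t] th by (simp add: R_def)
  have 1: "F (2 * k + 1) (unpar t) = R" using F_edge1[of "unpar t"] unpar[of t] t0 t1 by (simp add: R_def)
  then have 2: "F (2 * k + 2) (unpar t) = brR R" using R0 F_Suc[of "2 * k + 1"] by (simp add: stp_R)
  have s: "snd p = fst (brR R)" by (simp add: pG G_def)
  then have "F (2 * k + 3) (unpar t) = brL (brR R)" using assms(4) 2 F_Suc[of "2 * k + 2"]
    by (simp add: stp_L numeral_3_eq_3)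
  then show ?thesis using 1 2 s R0 assms(4) unpar[of t] t0 t1 pG by (intro exI[of _ "unpar t"]) (simp add: G_def)
qed

lemma dl_zz: assumes "m \<le> k" "j \<le> Suc k" shows "0 \<le> dl m (zz j)"
proof (cases "j \<le> m")
  case True
  then show ?thesis using dl_zz_le[OF True] SbN[of "m - j"] k1_neg b0 assms
    by (simp add: mult_nonneg_nonneg mult_nonpos_nonneg)
next
  case False
  then have j: "j = Suc m + (j - Suc m)" by simp
  have "0 \<le> (\<Sum>i=1..j - Suc m. Ub i)" by (rule sum_Ub_nonneg) (use SbN assms in auto)
  then show ?thesis using dl_zz_ge[of m "j - Suc m"] j k1_neg b0
    by (simp add: mult_nonneg_nonneg mult_nonpos_nonneg)
qed
lemma dl_Zp: "m \<le> k \<Longrightarrow> 0 \<le> dl m Zp" using dl_zz[of m 0] by (simp add: zz_0)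
lemma dl_cc: "m \<le> k \<Longrightarrow> 0 \<le> dl m cc" unfolding cc_conv dl_aff using dl_zz th by (intro conv_nonneg) auto
lemma dl_k_cc: "dl k cc = 0" by (simp add: cc_def dl_def crs_lin)

text \<open>Edges that once turned left cannot turn right again: otherwise \<open>zz (k +
1)\<close> would lie in a wedge at \<open>zz (j + 1)\<close> that is contained in the right half
plane.\<close>
lemma wedge: assumes "Suc j \<le> k" "fst (uu j) < 0" shows "fst (uu (Suc j)) < 0"
proof (rule ccontr)
  assume n: "\<not> fst (uu (Suc j)) < 0"
  define p where "p = zz (Suc k) - zz (Suc j)"
  have 1: "crs (uu (Suc j)) p \<le> 0" using dl_zz[of "Suc j" "Suc k"] assms by (simp add: dl_def p_def)
  have "zz (Suc k) - zz j = p + uu j" by (simp add: p_def uu_def)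
  then have 2: "crs (uu j) p \<le> 0" using dl_zz[of j "Suc k"] assms by (simp add: dl_def crs_lin)
  define ka where "ka = crs (uu j) (uu (Suc j))"
  have ka: "ka < 0" unfolding ka_def crs_uu_Suc by (rule bk1_neg)
  have "ka * fst p = - crs (uu (Suc j)) p * fst (uu j) + crs (uu j) p * fst (uu (Suc j))"
    by (simp add: ka_def crs_def algebra_simps)
  also have "\<dots> \<le> 0"
  proof -
    have "0 \<le> crs (uu (Suc j)) p * fst (uu j)" using 1 assms(2) by (intro mult_nonpos_nonpos) auto
    moreover have "crs (uu j) p * fst (uu (Suc j)) \<le> 0" using 2 n by (intro mult_nonpos_nonneg) auto
    ultimately show ?thesis by simp
  qed
  finally have "0 \<le> fst p" using ka by (simp add: mult_le_0_iff)
  then show False using zz_pos(1)[OF assms(1)] zneg by (simp add: p_def)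
qed

text \<open>An initial run of edge vectors points to the right and down. Their direction then
controls the position of \<open>X\<close> and of points of the axis relative to the edges.\<close>
lemma run: "m \<le> k \<Longrightarrow> 0 \<le> fst (uu m) \<Longrightarrow> snd (uu m) \<le> 0 \<and> fst (uu m) + u * snd (uu m) \<le> 0"
proof (induction m)
  case 0
  have "fst (uu 0) + u * snd (uu 0) = - (mm * (2 * a))" by (simp add: uu_0 a_def algebra_simps)
  then show ?case using mm0 a0 by (simp add: uu_0)
next
  case (Suc m)
  define al be where "al = fst (uu m)" and "be = snd (uu m)"
  have al: "0 \<le> al" using wedge[of m] Suc.prems unfolding al_def by (meson not_less)
  have IH: "be \<le> 0" "al + u * be \<le> 0" using Suc al by (auto simp: al_def be_def)
  have s: "snd (uu (Suc m)) = b * be - a * al" by (simp add: uu_Suc GL_def al_def be_def)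
  have f: "fst (uu (Suc m)) = a * (b * be - a * al) + b * al" by (simp add: uu_Suc GL_def al_def be_def)
  have 1: "b * be \<le> 0" "0 \<le> a * al" using IH al a0 b0 by (auto simp: mult_le_0_iff)
  have "fst (uu (Suc m)) + u * snd (uu (Suc m)) = b * (al + u * be) + a * (b * be) - (a + u) * (a * al)"
    unfolding s f by (simp add: algebra_simps)
  also have "\<dots> \<le> 0" using 1 IH a0 b0 u1
    by (smt (verit) mult_nonneg_nonneg mult_nonneg_nonpos)
  finally show ?case using s 1 by simp
qed

lemma hh_cc: "0 < hh cc" "wc < 0"
proof -
  show "0 < hh cc"
  proof (cases k)
    case 0
    have kk: "zz k = zz 0" "uu k = uu 0" using 0 by simp_all
    have x: "fst cc = fst Zp + th * (- mm * (u - 2 * l))" "snd cc = - (th * mm)"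
      using kk unfolding cc_def by (simp_all add: zz_0 uu_0 Zp_def)
    define z where "z = fst Zp"
    have z: "z * (1 - l) = 1" "1 \<le> z" using l1 l0 by (simp_all add: z_def Zp_def divide_simps)
    have tz: "th * mm * (u - 2 * l) = z" using x(1) fst_cc by (simp add: z_def algebra_simps)
    have tm: "0 < th * mm" using th mm0 by simp
    have "1 \<le> th * mm * (u - 2 * l)" using tz z by simp
    also have "\<dots> < th * mm * a" using tm l0 by (intro mult_strict_left_mono) (auto simp: a_def)
    finally show ?thesis using x(2) fst_cc by (simp add: hh_def algebra_simps)
  next
    case (Suc i)
    have kk: "zz k = zz (Suc i)" "uu k = uu (Suc i)" using Suc by simp_all
    define R where "R = zz i + th *\<^sub>R uu i"
    have "R = (1 - th) *\<^sub>R zz i + th *\<^sub>R zz (Suc i)" by (simp add: R_def uu_def algebra_simps)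
    then have "0 < fst R" using th zz_pos(1)[of i] zz_pos(1)[of "Suc i"] Suc
      by (simp add: add_nonneg_pos)
    moreover have "cc = G R"
    proof -
      have "G R - G (zz i) = GL (th *\<^sub>R uu i)" unfolding G_diff R_def by simp
      then show ?thesis using kk by (simp add: GL_lin zz_Suc uu_Suc algebra_simps cc_def)
    qed
    ultimately show ?thesis using b0 by (simp add: hh_G)
  qed
  then show "wc < 0" using snd_of_hh[of cc] fst_cc by (simp add: wc_def)
qed

text \<open>If the edge vector points to the left, compare with \<open>cc\<close> along the
axis, otherwise with \<open>Zp\<close>.\<close>
lemma dl_0w: assumes "m \<le> k" "wc \<le> w" "w \<le> 0" shows "0 \<le> dl m (0, w)"
proof (cases "fst (uu m) < 0")
  case True
  have "dl m (0, w) - dl m cc = - fst (uu m) * (w - wc)" by (simp add: dl_form cc algebra_simps)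
  moreover have "0 \<le> - fst (uu m) * (w - wc)" using True assms by (intro mult_nonneg_nonneg) auto
  ultimately show ?thesis using dl_cc[OF assms(1)] by linarith
next
  case False
  then have r: "snd (uu m) \<le> 0" using run[OF assms(1)] by auto
  have "dl m (0, w) - dl m Zp = - fst (uu m) * w - snd (uu m) * fst Zp" by (simp add: dl_form Zp_def algebra_simps)
  moreover have "fst (uu m) * w \<le> 0" "snd (uu m) * fst Zp \<le> 0" using False r assms fst_Zp by (auto simp: mult_le_0_iff)
  ultimately show ?thesis using dl_Zp[OF assms(1)] by linarith
qed
lemma dl_x0: assumes "m \<le> k" "0 \<le> x" "x \<le> fst Zp" shows "0 \<le> dl m (x, 0)"
proof -
  define t where "t = x / fst Zp"
  have t: "0 \<le> t" "t \<le> 1" "t * fst Zp = x" using assms fst_Zp by (auto simp: t_def)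
  have "(x, 0) = (1 - t) *\<^sub>R (0, 0) + t *\<^sub>R Zp" using t by (simp add: prod_eq_iff) (simp add: Zp_def)
  then have "dl m (x, 0) = (1 - t) * dl m (0, 0) + t * dl m Zp" using dl_aff by metis
  then show ?thesis using dl_0w[of m 0] hh_cc dl_Zp assms t by (simp add: conv_nonneg)
qed
lemma dl_Xp: assumes "m \<le> k" shows "0 \<le> dl m Xp"
proof -
  define x where "x = fst Xp"
  have x: "0 < x" "Xp = (x, x)" using xX0 by (simp_all add: x_def prod_eq_iff)
  have q: "fst Zp = x + u * x" using qf_Xp by (simp add: qf_def x Zp_def)
  show ?thesis
  proof (cases "fst (uu m) < 0")
    case True
    have "dl m Xp - dl m (x, 0) = - fst (uu m) * x" by (simp add: dl_form x algebra_simps)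
    moreover have "0 \<le> - fst (uu m) * x" using True x by (simp add: mult_le_0_iff)
    moreover have "0 \<le> dl m (x, 0)" using q x u1 by (intro dl_x0 assms) auto
    ultimately show ?thesis by linarith
  next
    case False
    then have r: "fst (uu m) + u * snd (uu m) \<le> 0" using run[OF assms(1)] by auto
    have "dl m Xp - dl m Zp = - x * (fst (uu m) + u * snd (uu m))"
      using q by (simp add: dl_form x Zp_def) (simp add: algebra_simps)
    moreover have "0 \<le> - x * (fst (uu m) + u * snd (uu m))" using r x by (simp add: mult_le_0_iff)
    ultimately show ?thesis using dl_Zp[OF assms(1)] by linarith
  qed
qed
lemma V1_Zp: "0 < fst V1" "fst V1 \<le> fst Zp" "V1 = (fst V1, 0)"
  using width(1) xX0 u1 l0 l1 by (auto simp: V1_def Zp_def divide_simps)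
lemma dl_V1: "m \<le> k \<Longrightarrow> 0 \<le> dl m V1" using dl_x0[of m "fst V1"] V1_Zp by simp

text \<open>The point \<open>cc\<close> is on an edge and thus not in the tooth, so it is not
above the point \<open>V\<close>.\<close>
lemma pf_cc: "0 \<le> pf cc" "l * wc \<le> - (1 / (1 + u))"
proof -
  have sgc: "0 < sg cc" using sg_of_hh[of cc] hh_cc by (simp add: wc_def)
  have "F (2 * k + 1) (unpar th) = cc" using F_edge1[of "unpar th"] unpar[of th] th by (simp add: cc_def)
  then have nt: "\<not> tooth cc" using AV[of "unpar th" "2 * k + 1" 0] unpar[of th] th by simp
  show p: "0 \<le> pf cc"
  proof (rule ccontr)
    assume "\<not> 0 \<le> pf cc"
    then have "0 < pf (stp cc)" using u1 by (simp add: pf_stp_R fst_cc mult_less_0_iff zero_less_mult_iff)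
    then show False using nt sgc by (simp add: tooth_iff)
  qed
  then show "l * wc \<le> - (1 / (1 + u))" by (simp add: pf_def cc)
qed

text \<open>Such a point lies on a horizontal segment from the axis to the segment between
\<open>V\<close> and \<open>V1\<close>. Both ends are inside the edge.\<close>
lemma dl_tooth_pos: assumes "0 < fst p" "pf p \<le> 0" "snd p \<le> 0" shows "0 < dl k p"
proof -
  obtain x w where p: "p = (x, w)" by force
  have x: "0 < x" "x \<le> l * w + 1 / (1 + u)" "w \<le> 0" using assms by (auto simp: p pf_def)
  define y where "y = l * w + 1 / (1 + u)"
  have y: "0 < y" "x \<le> y" using x by (auto simp: y_def)
  have "l * wc < l * w" using pf_cc(2) y by (simp add: y_def)
  then have wcw: "wc < w" using l0 by simp
  have al: "fst (uu k) < 0" by (rule al_neg)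
  have d0: "0 < dl k (0, w') " if "wc < w'" for w'
  proof -
    have "dl k (0, w') - dl k cc = - fst (uu k) * (w' - wc)" by (simp add: dl_form cc algebra_simps)
    moreover have "0 < - fst (uu k) * (w' - wc)" using al that by (simp add: mult_neg_pos)
    ultimately show ?thesis using dl_k_cc by linarith
  qed
  have dy': "0 < dl k (y, w)"
  proof (rule ccontr)
    assume n: "\<not> 0 < dl k (y, w)"
    define t where "t = - w * (l * (1 + u))"
    have "0 \<le> t" using x l0 u1 by (simp add: t_def mult_le_0_iff)
    have ty: "1 - t = (1 + u) * y" using u1 by (simp add: t_def y_def field_simps)
    have t: "0 \<le> t" "t < 1" using \<open>0 \<le> t\<close> ty u1 y by (auto simp: mult_pos_pos) (smt (verit) mult_pos_pos)
    define wV where "wV = - (1 / (l * (1 + u)))"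
    have "l * wV = - (1 / (1 + u))" using l0 by (simp add: wV_def)
    then have "l * wc \<le> l * wV" using pf_cc(2) by simp
    then have "wc \<le> wV" using l0 by simp
    then have wV: "wc \<le> wV" "wV \<le> 0" using l0 u1 by (auto simp: wV_def)
    have "t * wV = w" using l0 u1 by (simp add: t_def wV_def)
    moreover have "(1 - t) * fst V1 = y" using u1 by (simp add: ty V1_def)
    ultimately have "(y, w) = (1 - t) *\<^sub>R V1 + t *\<^sub>R (0, wV)" by (simp add: prod_eq_iff) (simp add: V1_def)
    then have e: "dl k (y, w) = (1 - t) * dl k V1 + t * dl k (0, wV)" using dl_aff by metis
    have "0 < dl k V1"
    proof -
      define r where "r = fst V1 / fst Zp"
      have r: "0 \<le> r" "r < 1" "r * fst Zp = fst V1" using V1_Zp fst_Zp width(1) xX0 u1 l0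
        by (auto simp: r_def) (simp add: V1_def Zp_def, smt (verit) mult_pos_pos)
      have "V1 = (1 - r) *\<^sub>R (0, 0) + r *\<^sub>R Zp" using r V1_Zp(3) by (simp add: prod_eq_iff Zp_def)
      then have "dl k V1 = (1 - r) * dl k (0, 0) + r * dl k Zp" using dl_aff by metis
      then show ?thesis using d0[of 0] hh_cc(2) dl_Zp[of k] r by (simp add: conv_pos)
    qed
    then have "0 < dl k (y, w)" unfolding e using t dl_0w[of k wV] wV by (intro conv_pos) auto
    then show False using n by simp
  qed
  define r where "r = x / y"
  have r: "0 \<le> r" "r \<le> 1" "r * y = x" using x y by (auto simp: r_def)
  have "p = (1 - r) *\<^sub>R (0, w) + r *\<^sub>R (y, w)" using r by (simp add: p prod_eq_iff algebra_simps)
  then have e: "dl k p = (1 - r) * dl k (0, w) + r * dl k (y, w)" using dl_aff by metis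
  show ?thesis
  proof (cases "r = 1")
    case True then show ?thesis using e dy' by simp
  next
    case False
    then show ?thesis unfolding e using r d0[OF wcw] dy' by (intro conv_pos) auto
  qed
qed

lemma tau_cc: "0 < tau cc"
  using tau_c[of k th cc] SbP zz_pos th fst_cc by (simp add: cc_def)
lemma tau_axis: "wc \<le> w \<Longrightarrow> tau cc \<le> tau (0, w)" using l0 by (simp add: tau_def cc)

text \<open>Points of the axis that are not below \<open>cc\<close> have at least the
\<open>tau\<close> of \<open>cc\<close>, which is positive, so their left iterates are in the
right half plane from a common time on.\<close>
lemma regress_bound: "\<exists>N0. \<forall>n\<ge>N0. \<forall>w. wc \<le> w \<longrightarrow> w \<le> 0 \<longrightarrow> 0 < fst ((brL ^^ n) (0, w))"
proof -
  define M where "M = dY + l * (u * (- wc) + 1)"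
  obtain N0 where N0: "M / tau cc < u ^ N0" using real_arch_pow[OF u1] by blast
  have "0 < fst ((brL ^^ n) (0, w))" if n: "N0 \<le> n" and w: "wc \<le> w" "w \<le> 0" for n w
  proof -
    let ?p = "(brL ^^ n) (0, w)"
    have "u ^ N0 \<le> u ^ n" using u1 n by (intro power_increasing) auto
    then have "M / tau cc < u ^ n" using N0 by simp
    then have "M < u ^ n * tau cc" using tau_cc by (simp add: pos_divide_less_eq)
    also have "\<dots> \<le> u ^ n * tau (0, w)" using tau_axis[OF w(1)] u1 by (intro mult_left_mono) auto
    also have "\<dots> = 1 * tau ?p" by (simp add: tau_iter)
    also have "\<dots> \<le> u * tau ?p" using tau_cc tau_axis[OF w(1)] u1 by (intro mult_right_mono) (auto simp: tau_iter)
    finally have 1: "M < u * tau ?p" .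
    have s0': "\<bar>sg (0, w)\<bar> \<le> u * (- wc) + 1"
    proof -
      have "0 \<le> 1 / (1 + l)" "1 / (1 + l) \<le> 1" "u * wc \<le> u * w" "u * w \<le> 0" using l0 u1 w by (auto simp: mult_le_0_iff)
      moreover have "sg (0, w) = - (u * w) - 1 / (1 + l)" by (simp add: sg_def)
      ultimately show ?thesis unfolding abs_le_iff by linarith
    qed
    have "\<bar>sg ?p\<bar> = l ^ n * \<bar>sg (0, w)\<bar>" using l0 by (simp add: sg_iter abs_mult power_abs)
    also have "\<dots> \<le> 1 * \<bar>sg (0, w)\<bar>" using l0 l1 by (intro mult_right_mono power_le_one) auto
    finally have "\<bar>sg ?p\<bar> \<le> u * (- wc) + 1" using s0' by simp
    then have "l * (- (u * (- wc) + 1)) \<le> l * sg ?p" using l0 by (intro mult_left_mono) auto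
    then have "0 < (u + l) * fst ?p" using 1 unfolding fst_tau_sg M_def by (simp add: algebra_simps)
    then show ?thesis using u1 l0 by (simp add: zero_less_mult_iff)
  qed
  then show ?thesis by blast
qed

text \<open>The region bounded by the lines of two consecutive edges and by the
\<open>G\<close>-image of the axis.\<close>
definition turn_region where "turn_region p \<longleftrightarrow> 0 \<le> dl k p \<and> 0 \<le> dl (Suc k) p \<and> 0 \<le> hh p"

lemma F_Gcc: assumes "fst (brR cc) \<le> 0" shows "F (2 * k + 3) (unpar th) = G cc" "s0 \<le> unpar th" "unpar th \<le> 1"
proof -
  show s: "s0 \<le> unpar th" "unpar th \<le> 1" using unpar(2)[of th] th by auto
  have "F (2 * k + 1) (unpar th) = cc" using F_edge1[OF s] unpar(1)[of th] by (simp add: cc_def)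
  then have "F (2 * k + 2) (unpar th) = brR cc" using F_Suc[of "2 * k + 1"] fst_cc by (simp add: stp_R)
  then show "F (2 * k + 3) (unpar th) = G cc" using F_Suc[of "2 * k + 2"] assms
    by (simp add: stp_L numeral_3_eq_3 G_def)
qed

text \<open>On the part of the boundary \<open>hh = 0\<close> the point is the second left
iterate of a point on the axis.\<close>
lemma hh0_pred: assumes "hh r = 0" "0 \<le> dl (Suc k) r"
  obtains w where "r = brL (brL (0, w))" "brL (0, w) = (snd r, 0)" "wc \<le> w" "0 \<le> dl k (0, w)"
proof
  define w where "w = (snd r - 1) / b"
  have bw: "b * w = snd r - 1" using b0 by (simp add: w_def)
  show 1: "brL (0, w) = (snd r, 0)" using bw by (simp add: brL_def)
  show 2: "r = brL (brL (0, w))" unfolding 1 using assms by (simp add: brL_def hh_def prod_eq_iff)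
  have "brR (0, w) = brL (0, w)" by (simp add: brL_def brR_def)
  then have "r = G (0, w)" using 2 by (simp add: G_def)
  then have "dl (Suc k) r = b\<^sup>2 * dl k (0, w)" by (simp add: dl_G)
  then show d: "0 \<le> dl k (0, w)" using assms b0 by (simp add: zero_le_mult_iff)
  have "dl k (0, w) - dl k cc = - fst (uu k) * (w - wc)" by (simp add: dl_form cc algebra_simps)
  then have "fst (uu k) * (w - wc) \<le> 0" using d dl_k_cc by simp
  then show "wc \<le> w" using al_neg by (simp add: mult_le_0_iff)
qed

lemma dl_Suc_cc: "0 \<le> dl (Suc k) cc"
  unfolding cc_def dl_line using th bk1_neg[of k] by (intro mult_nonpos_nonpos) auto

text \<open>If \<open>G cc\<close> were in the left half plane, the second edge, which is
steeper than the line \<open>hh = 0\<close>, would have the axis point on its inner side. Once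
\<open>G cc\<close> is known to be in the right half plane, the avoidance of the tooth and
convexity between \<open>G cc\<close> and \<open>(1, 0)\<close> give the second inequality.\<close>
lemma Gcc_pos:
  assumes w: "wc < w" and d: "dl (Suc k) (0, w) \<le> 0" and hP: "0 \<le> hh (0, w)" and bw: "1 + b * w \<le> 0"
  shows "0 < fst (brL (brL (0, w))) \<and> 0 < pf (brL (brL (0, w)))"
proof -
  have aw: "1 + a * w \<le> 0" using hP by (simp add: hh_def)
  define v where "v = 1 + b * wc"
  have vw: "v < 1 + b * w" using w b0 by (simp add: v_def)
  have Gc: "brR cc = (v, 0)" "G cc = (1 + a * v, v)"
    by (simp_all add: G_def brR_def brL_def cc v_def)
  have F3: "F (2 * k + 3) (unpar th) = G cc" "s0 \<le> unpar th" "unpar th \<le> 1"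
    using F_Gcc Gc vw bw by simp_all
  define al be' where "al = fst (uu (Suc k))" and "be' = snd (uu (Suc k))"
  have al_be: "al = a * be' + b * fst (uu k)" by (simp add: al_def be'_def uu_Suc GL_def)
  have "dl (Suc k) (0, w) - dl (Suc k) cc = - al * (w - wc)" by (simp add: dl_form cc al_def algebra_simps)
  then have "0 \<le> al * (w - wc)" using d dl_Suc_cc by simp
  then have alp: "0 \<le> al" using w by (simp add: zero_le_mult_iff)
  have fG: "0 \<le> 1 + a * v"
  proof (rule ccontr)
    assume n: "\<not> ?thesis"
    have "dl (Suc k) (G cc) = 0" by (simp add: dl_G dl_k_cc)
    then have dw: "dl (Suc k) (0, w) = - al * (w - v) - be' * (1 + a * v)"
      by (simp add: dl_form Gc al_def be'_def algebra_simps)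
    have "a * dl (Suc k) (0, w) = al * (a * v - a * w) - a * be' * (1 + a * v)"
      unfolding dw by (simp add: algebra_simps)
    moreover have "al * (1 + a * v) \<le> al * (a * v - a * w)" using aw alp by (intro mult_left_mono) auto
    moreover have "al * (1 + a * v) - a * be' * (1 + a * v) = b * fst (uu k) * (1 + a * v)"
      unfolding al_be by (simp add: algebra_simps)
    ultimately have "b * fst (uu k) * (1 + a * v) \<le> a * dl (Suc k) (0, w)" by linarith
    moreover have "0 < b * fst (uu k) * (1 + a * v)" using n al_neg b0
      by (intro mult_neg_neg) (auto simp: mult_pos_neg)
    moreover have "a * dl (Suc k) (0, w) \<le> 0" using d a0 by (simp add: mult_nonneg_nonpos)
    ultimately show False by linarith
  qed
  have pG: "0 \<le> pf (G cc)"
  proof (rule ccontr)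
    assume n: "\<not> 0 \<le> pf (G cc)"
    have "0 < sg (G cc)" using sg_of_hh[of "G cc"] vw bw fst_cc unfolding hh_G by (simp add: Gc(2))
    moreover have "0 < pf (stp (G cc))" using n u1 fG by (simp add: pf_stp_R Gc(2) mult_less_0_iff zero_less_mult_iff)
    ultimately have "tooth (G cc)" by (simp add: tooth_iff)
    then show False using AVg[of "unpar th" "2 * k + 3" 0] F3 by (simp add: stays_left_def)
  qed
  define x where "x = 1 + b * w"
  have r: "brL (brL (0, w)) = (1 + a * x, x)" by (simp add: brL_def x_def)
  define t where "t = x / v"
  have t: "0 \<le> t" "t < 1" "t * v = x" using vw bw by (auto simp: t_def x_def divide_simps)
  have "(1 + a * x, x) = (1 - t) *\<^sub>R (1, 0) + t *\<^sub>R G cc"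
    using t(3) by (simp add: Gc prod_eq_iff) (simp add: algebra_simps)
  then have "pf (1 + a * x, x) = (1 - t) * pf (1, 0) + t * pf (G cc)" using pf_aff by metis
  moreover have "0 < pf (1, 0)" using u1 by (simp add: pf_def)
  ultimately have "0 < pf (1 + a * x, x)" using t(1,2) pG by (simp add: conv_pos)
  moreover have "0 < 1 + a * x" using fG vw a0 unfolding x_def[symmetric]
    by (smt (verit) mult_strict_left_mono)
  ultimately show ?thesis by (simp add: r)
qed

lemma sg_brLi_iter: "sg p = 0 \<Longrightarrow> sg ((brLi ^^ n) p) = 0"
  by (induction n) (simp_all add: brLi_tau_sg)

text \<open>Suppose that a point of the region reaches the tooth after \<open>n\<close> left
steps. Join it to the \<open>n\<close>-th left preimage of a point on the boundary \<open>sg =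
0\<close>, which is outside the region. All points on the way have the same property, in
particular the one at which the segment leaves the region. If this is on one of the edges,
\<open>AV\<close> is violated. If it is on \<open>hh = 0\<close>, it is the second left iterate
of a point on the axis; this point is again in the region and reaches the tooth after \<open>n +
2\<close> steps. By \<open>regress_bound\<close> this cannot be repeated forever, hence the
induction on \<open>N0 - n\<close>.\<close>
lemma no_tooth: "even n \<Longrightarrow> turn_region p \<Longrightarrow> stays_left n p \<Longrightarrow> \<not> tooth ((brL ^^ n) p)"
proof -
  obtain N0 where N0: "\<And>n w. N0 \<le> n \<Longrightarrow> wc \<le> w \<Longrightarrow> w \<le> 0 \<Longrightarrow> 0 < fst ((brL ^^ n) (0, w))"
    using regress_bound by blast
  obtain be where be: "sg be = 0" "fst be < 0" "pf be < 0" "0 < pf (brL be)" using beta by blast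
  show "even n \<Longrightarrow> turn_region p \<Longrightarrow> stays_left n p \<Longrightarrow> \<not> tooth ((brL ^^ n) p)"
  proof (induction "N0 - n" arbitrary: n p rule: less_induct)
    case less
    note ev = less.prems(1) and Omp = less.prems(2) and gp = less.prems(3)
    show ?case
    proof
      assume tt: "tooth ((brL ^^ n) p)"
      define qq where "qq = (brLi ^^ n) be"
      have qn: "(brL ^^ n) qq = be" using brL_brLi_iter[of n n be] by (simp add: qq_def)
      have "sg qq = 0" "fst qq < 0" using sg_brLi_iter fst_brLi_iter be by (simp_all add: qq_def)
      then have hq: "hh qq < 0" using sg_of_hh[of qq] snd_of_hh[of qq] by (smt (verit))
      obtain s where s: "0 \<le> s" "s < 1"
        and ex: "0 \<le> (1 - s) * dl k p + s * dl k qq" "0 \<le> (1 - s) * dl (Suc k) p + s * dl (Suc k) qq"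
          "0 \<le> (1 - s) * hh p + s * hh qq"
          "(1 - s) * dl k p + s * dl k qq = 0 \<or> (1 - s) * dl (Suc k) p + s * dl (Suc k) qq = 0 \<or> (1 - s) * hh p + s * hh qq = 0"
        using affine_exit[OF _ _ _ hq, of "dl k p" "dl (Suc k) p" "hh p" "dl k qq" "dl (Suc k) qq"] Omp
        unfolding turn_region_def by blast
      define r where "r = (1 - s) *\<^sub>R p + s *\<^sub>R qq"
      have Omr: "0 \<le> dl k r" "0 \<le> dl (Suc k) r" "0 \<le> hh r"
        and zr: "dl k r = 0 \<or> dl (Suc k) r = 0 \<or> hh r = 0"
        using ex by (simp_all add: r_def dl_aff hh_aff)
      have gr: "stays_left n r" unfolding stays_left_def
      proof (intro allI impI)
        fix j assume j: "j < n"
        have "fst ((brL ^^ j) p) \<le> 0" using gp j by (simp add: stays_left_def)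
        moreover have "fst ((brL ^^ j) qq) \<le> 0"
          using brL_brLi_iter[of j n be] fst_brLi_iter[OF be(1,2), of "n - j"] j by (simp add: qq_def)
        ultimately show "fst ((brL ^^ j) r) \<le> 0" unfolding r_def brL_iter_aff fst_aff
          using s by (intro conv_nonpos) auto
      qed
      have tr: "tooth ((brL ^^ n) r)"
      proof -
        have e: "(brL ^^ n) r = (1 - s) *\<^sub>R (brL ^^ n) p + s *\<^sub>R be" by (simp add: r_def brL_iter_aff qn)
        have 1: "0 < sg ((brL ^^ n) p)" "pf ((brL ^^ n) p) < 0" "0 < pf (brL ((brL ^^ n) p))"
          using tt by (auto simp: tooth_def)
        have "0 < sg ((brL ^^ n) r)" unfolding e sg_aff using 1 be s by simp
        moreover have "0 < - pf ((brL ^^ n) r)"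
          using conv_pos[of s "- pf ((brL ^^ n) p)" "- pf be"] 1 be s unfolding e pf_aff by simp
        moreover have "0 < pf (brL ((brL ^^ n) r))" unfolding e brL_aff pf_aff
          using 1 be s by (intro conv_pos) auto
        ultimately show ?thesis by (simp add: tooth_def)
      qed
      have sr: "snd r < 0"
      proof (cases "n = 0")
        case True then show ?thesis using tr snd_tooth[of r] by (auto simp: tooth_def)
      next
        case False
        then have "fst r \<le> 0" using gr by (auto simp: stays_left_def dest: spec[of _ 0])
        then show ?thesis using snd_of_hh Omr by blast
      qed
      have n0: "n = 0" if "0 < fst r" using gr that by (auto simp: stays_left_def dest: spec[of _ 0])
      show False using zr
      proof (elim disjE)
        assume d: "dl k r = 0"
        show False
        proof (cases "fst r \<le> 0")
          case True
          then obtain s' where "s0 \<le> s'" "s' \<le> 1" "r = F (2 * k + 1) s'" using edge1 d Omr by blast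
          then show False using AVg[of s' "2 * k + 1" n] gr tr ev by simp
        next
          case False
          then have "pf r < 0" using tr n0 by (simp add: tooth_def)
          then show False using dl_tooth_pos[of r] False sr d by simp
        qed
      next
        assume d: "dl (Suc k) r = 0"
        then obtain s' where "s0 \<le> s'" "s' \<le> 1" "r = F (2 * k + 3) s'" using edge2[of r] Omr sr by auto
        then show False using AVg[of s' "2 * k + 3" n] gr tr ev by simp
      next
        assume h0: "hh r = 0"
        obtain w where w: "r = brL (brL (0, w))" "brL (0, w) = (snd r, 0)" "wc \<le> w" "0 \<le> dl k (0, w)"
          using hh0_pred[OF h0 Omr(2)] by blast
        have bw: "b * w = snd r - 1" using w(2) by (simp add: brL_def)
        have fresh: "fst r = 1 + a * snd r" using h0 by (simp add: hh_def)
        have "b \<le> a * (1 - snd r)"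
        proof (cases "fst r \<le> 0")
          case True
          then show ?thesis using fresh a0 b1 by (simp add: algebra_simps)
        next
          case False
          then have t: "pf r < 0" using tr n0 by (simp add: tooth_def)
          have A: "u / (1 + u) < (a - l) * (- snd r)"
          proof -
            have "1 - 1 / (1 + u) = u / (1 + u)" using u1 by (simp add: field_simps)
            then show ?thesis using t unfolding pf_def fresh by (simp add: algebra_simps)
          qed
          have "0 < u / (1 + u)" using u1 by simp
          then have al: "0 < a - l" using A sr by (smt (verit) mult_nonneg_nonpos2 mult_nonneg_nonneg zero_less_mult_iff)
          have "a * (- snd r) < 1" using False fresh by simp
          then have "(a - l) * (a * (- snd r)) < (a - l) * 1" using al by (rule mult_strict_left_mono)
          moreover have "a * (u / (1 + u)) < a * ((a - l) * (- snd r))" using A a0 by (rule mult_strict_left_mono)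
          ultimately have "a * (u / (1 + u)) < a - l" by (simp add: ac_simps)
          then have "a * u < (a - l) * (1 + u)" using u1 by (simp add: field_simps)
          then have "l + b < a" by (simp add: b_def algebra_simps)
          moreover have "a * snd r \<le> 0" using sr a0 by (simp add: mult_le_0_iff)
          ultimately show ?thesis using l0 by (simp add: algebra_simps)
        qed
        moreover have "b * (1 + a * w) = b + a * (b * w)" by (simp add: algebra_simps)
        ultimately have "b * (1 + a * w) \<le> 0" unfolding bw by (simp add: algebra_simps)
        then have aw: "1 + a * w \<le> 0" using b0 by (simp add: mult_le_0_iff)
        then have hP: "0 \<le> hh (0, w)" by (simp add: hh_def)
        have w0: "w < 0" using snd_of_hh[of "(0, w)"] hP by simp
        have gP: "stays_left (Suc (Suc n)) (0, w)" unfolding stays_left_def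
        proof (intro allI impI)
          fix j assume j: "j < Suc (Suc n)"
          consider "j = 0" | "j = 1" | i where "j = Suc (Suc i)" "i < n" using j
            by (metis Suc_less_eq less_Suc_eq_0_disj One_nat_def)
          then show "fst ((brL ^^ j) (0, w)) \<le> 0"
          proof cases
            case 3
            then have "(brL ^^ j) (0, w) = (brL ^^ i) r" unfolding w(1) by (simp add: funpow_swap1)
            then show ?thesis using gr 3 by (simp add: stays_left_def)
          qed (use w(2) sr in auto)
        qed
        have tP: "tooth ((brL ^^ Suc (Suc n)) (0, w))"
          using tr unfolding w(1) by (simp add: funpow_swap1)
        show False
        proof (cases "0 \<le> dl (Suc k) (0, w)")
          case True
          then have "turn_region (0, w)" using w hP by (simp add: turn_region_def)
          moreover have "n < N0"
          proof (rule ccontr)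
            assume "\<not> n < N0"
            then have "0 < fst ((brL ^^ n) (0, w))" using N0 w(3) w0 by simp
            then show False using gP by (auto simp: stays_left_def dest: spec[of _ n])
          qed
          ultimately show False using less.hyps[of "Suc (Suc n)" "(0, w)"] ev gP tP by simp
        next
          case False
          have "wc < w"
          proof (rule ccontr)
            assume "\<not> wc < w"
            then have "(0, w) = cc" using w(3) by (simp add: cc)
            then have "dl (Suc k) (0, w) = dl (Suc k) cc" by simp
            then show False using False dl_Suc_cc by simp
          qed
          then have "0 < fst r \<and> 0 < pf r"
            using Gcc_pos[of w] False hP bw sr w(1) by auto
          then show False using n0 tr by (auto simp: tooth_def)
        qed
      qed
    qed
  qed
qed

text \<open>From the interior of the region a point that reaches the closed tooth can be pushed
into the open tooth, by moving it slightly towards a preimage of the point from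
\<open>beta\<close>.\<close>
lemma no_ctooth:
  assumes ev: "even n" and gp: "stays_left n p" and p: "0 < dl k p" "0 < dl (Suc k) p" "0 < hh p" "0 < sg p"
  shows "\<not> ctooth ((brL ^^ n) p)"
proof
  assume ct: "ctooth ((brL ^^ n) p)"
  obtain be where be: "sg be = 0" "fst be < 0" "pf be < 0" "0 < pf (brL be)" using beta by blast
  define qq where "qq = (brLi ^^ n) be"
  have qn: "(brL ^^ n) qq = be" using brL_brLi_iter[of n n be] by (simp add: qq_def)
  define ra where "ra x y = x / (2 * (x + \<bar>y\<bar>))" for x y :: real
  have ra: "0 < ra x y" "ra x y < 1" "0 < s \<Longrightarrow> s \<le> ra x y \<Longrightarrow> 0 \<le> (1 - s) * x + s * y" if "0 < x" for x y s
  proof -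
    show "0 < ra x y" "ra x y < 1" using that by (auto simp: ra_def divide_simps)
    assume s: "0 < s" "s \<le> ra x y"
    have "ra x y * (x + \<bar>y\<bar>) = x / 2" using that by (simp add: ra_def divide_simps)
    then have "s * (x + \<bar>y\<bar>) \<le> x / 2" using s that by (metis mult_right_mono abs_ge_zero add_nonneg_nonneg less_imp_le)
    moreover have "s * (- \<bar>y\<bar>) \<le> s * y" using s by (intro mult_left_mono) auto
    ultimately show "0 \<le> (1 - s) * x + s * y" using that by (simp add: algebra_simps)
  qed
  define s where "s = min (ra (dl k p) (dl k qq)) (min (ra (dl (Suc k) p) (dl (Suc k) qq)) (ra (hh p) (hh qq)))"
  have s: "0 < s" "s \<le> ra (dl k p) (dl k qq)" "s \<le> ra (dl (Suc k) p) (dl (Suc k) qq)" "s \<le> ra (hh p) (hh qq)"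
    using ra(1) p by (auto simp: s_def)
  have s1: "s < 1" using s(2) ra(2)[OF p(1)] by (meson le_less_trans)
  define r where "r = (1 - s) *\<^sub>R p + s *\<^sub>R qq"
  have "turn_region r" using ra(3) p s by (simp add: turn_region_def r_def dl_aff hh_aff)
  moreover have "stays_left n r" unfolding stays_left_def
  proof (intro allI impI)
    fix j assume j: "j < n"
    have "fst ((brL ^^ j) p) \<le> 0" using gp j by (simp add: stays_left_def)
    moreover have "fst ((brL ^^ j) qq) \<le> 0"
      using brL_brLi_iter[of j n be] fst_brLi_iter[OF be(1,2), of "n - j"] j by (simp add: qq_def)
    ultimately show "fst ((brL ^^ j) r) \<le> 0" unfolding r_def brL_iter_aff fst_aff
      using s s1 by (intro conv_nonpos) auto
  qed
  moreover have "tooth ((brL ^^ n) r)"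
  proof -
    have e: "(brL ^^ n) r = (1 - s) *\<^sub>R (brL ^^ n) p + s *\<^sub>R be" by (simp add: r_def brL_iter_aff qn)
    have "0 < sg ((brL ^^ n) p)" using ev p(4) l0 by (simp add: sg_iter)
    then have "0 < sg ((brL ^^ n) r)" unfolding e sg_aff using be s1 by simp
    moreover have "pf ((brL ^^ n) r) < 0"
      unfolding e pf_aff using ct be s s1 by (intro add_nonpos_neg) (auto simp: ctooth_def mult_le_0_iff mult_less_0_iff)
    moreover have "0 < pf (brL ((brL ^^ n) r))" unfolding e brL_aff pf_aff
      using ct be s s1 by (intro add_nonneg_pos) (auto simp: ctooth_def)
    ultimately show ?thesis by (simp add: tooth_def)
  qed
  ultimately show False using no_tooth[OF ev] by blast
qed

lemma ctooth_edge:
  assumes ev: "even n" and gp: "stays_left n p" and p: "0 \<le> dl k p" "0 \<le> dl (Suc k) p" "0 < hh p" "snd p < 0"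
    and ct: "ctooth ((brL ^^ n) p)"
  shows "\<exists>m s. s0 \<le> s \<and> s \<le> 1 \<and> p = F m s \<and>
    (m = 2 * k + 1 \<and> dl k p = 0 \<and> fst p \<le> 0 \<or>
     m = 2 * k + 3 \<and> dl (Suc k) p = 0 \<and> 0 \<le> fst (F (2 * k + 1) s) \<and> fst (F (2 * k + 2) s) \<le> 0)"
proof -
  have "0 < sg p" using sg_of_hh[of p] p by simp
  then have "dl k p = 0 \<or> dl (Suc k) p = 0" using no_ctooth[OF ev gp] p ct by fastforce
  then show ?thesis
  proof
    assume d: "dl k p = 0"
    show ?thesis
    proof (cases "fst p \<le> 0")
      case True
      then show ?thesis using edge1[OF d p(2)] d by blast
    next
      case False
      then have "n = 0" using gp by (auto simp: stays_left_def dest: spec[of _ 0])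
      then have "pf p \<le> 0" using ct by (simp add: ctooth_def)
      then show ?thesis using dl_tooth_pos[of p] False p d by simp
    qed
  next
    assume d: "dl (Suc k) p = 0"
    obtain s where "s0 \<le> s" "s \<le> 1" "p = F (2 * k + 3) s" "0 \<le> fst (F (2 * k + 1) s)" "fst (F (2 * k + 2) s) \<le> 0"
      using edge2[OF d p(1)] p(3,4) by auto
    then show ?thesis using d by blast
  qed
qed

end

section \<open>Itineraries of the unstable manifold\<close>

context lozi_uv begin
lemma triangle_up_pos: assumes "p \<in> convex hull {Xp, V1, Zp}" shows "0 < fst p" "0 \<le> pf p"
proof -
  have "convex {p::real\<times>real. 0 < fst p}" by (rule conv_half(2)) (rule fst_aff)
  moreover have "{Xp, V1, Zp} \<subseteq> {p. 0 < fst p}" using xX0 fst_Zp u1 by (auto simp: V1_def)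
  ultimately have "convex hull {Xp, V1, Zp} \<subseteq> {p. 0 < fst p}" by (intro hull_minimal)
  then show "0 < fst p" using assms by auto
  have "convex {p. 0 \<le> pf p}" by (rule conv_half(1)) (rule pf_aff)
  moreover have "{Xp, V1, Zp} \<subseteq> {p. 0 \<le> pf p}" using pf_Xp pf_V1 pf_Zp by auto
  ultimately have "convex hull {Xp, V1, Zp} \<subseteq> {p. 0 \<le> pf p}" by (intro hull_minimal)
  then show "0 \<le> pf p" using assms by auto
qed
lemma T_hull: assumes "0 \<le> s" "s \<le> 1"
  obtains R where "T s = brR R" "R \<in> convex hull {Xp, V1, Zp}" "qf R = 0"
proof
  show "T s = brR ((1 - s) *\<^sub>R Xp + s *\<^sub>R Zp)" by (rule T_brR)
  have "Xp \<in> convex hull {Xp, V1, Zp}" "Zp \<in> convex hull {Xp, V1, Zp}" by (auto intro: hull_inc)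
  then show "(1 - s) *\<^sub>R Xp + s *\<^sub>R Zp \<in> convex hull {Xp, V1, Zp}"
    using assms convex_convex_hull[of "{Xp, V1, Zp}"] unfolding convex_alt by blast
  show "qf ((1 - s) *\<^sub>R Xp + s *\<^sub>R Zp) = 0" by (simp add: qf_aff qf_Xp qf_Zp)
qed
lemma stays_left_Suc: "stays_left (Suc n) p \<longleftrightarrow> stays_left n p \<and> fst ((brL ^^ n) p) \<le> 0"
  by (auto simp: stays_left_def less_Suc_eq)
end

context lozi_C begin

lemma dl_hull: assumes "m \<le> k" "p \<in> convex hull {Xp, V1, Zp}" shows "0 \<le> dl m p"
proof -
  have "convex {p. 0 \<le> dl m p}" by (rule conv_half(1)) (rule dl_aff)
  moreover have "{Xp, V1, Zp} \<subseteq> {p. 0 \<le> dl m p}" using dl_Xp dl_V1 dl_Zp assms(1) by auto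
  ultimately have "convex hull {Xp, V1, Zp} \<subseteq> {p. 0 \<le> dl m p}" by (intro hull_minimal)
  then show ?thesis using assms by auto
qed

text \<open>The position of a point at odd time in the right half plane: inside all edges up to
the crossing one.\<close>
definition right_region where "right_region p \<longleftrightarrow> 0 < fst p \<and> 0 \<le> pf p \<and> qf p \<le> 0 \<and> (\<forall>m\<le>k. 0 \<le> dl m p)"

text \<open>The position of a point of the unstable manifold when it enters its phase in the
left half plane.\<close>
definition fresh where "fresh p \<longleftrightarrow> (\<forall>m\<le>Suc k. 0 \<le> dl m p) \<and> 0 < hh p \<and> snd p < 0"
definition left_phase where "left_phase n s \<longleftrightarrow> (\<exists>t j. n = t + j \<and> odd t \<and> fresh (F t s) \<and> stays_left (Suc j) (F t s))"

lemma fresh_turn_region: "fresh p \<Longrightarrow> turn_region p" by (simp add: fresh_def turn_region_def)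
lemma fresh_sg: "fresh p \<Longrightarrow> even j \<Longrightarrow> 0 < sg ((brL ^^ j) p)"
  using sg_of_hh[of p] l0 by (simp add: fresh_def sg_iter)

lemma fresh_G: assumes "right_region R" "fst (brR R) < 0" shows "fresh (G R)"
proof -
  have "0 \<le> dl m (G R)" if "m \<le> Suc k" for m
  proof (cases m)
    case 0
    have "qf (brR R) \<le> 0" using assms l0 by (simp add: right_region_def qf_brR mult_le_0_iff)
    then have "0 \<le> - (mm * l) * qf (brR R)" using mm0 l0 by (intro mult_nonpos_nonpos) auto
    then show ?thesis by (simp add: 0 G_def dl_0_brL)
  next
    case (Suc i)
    then show ?thesis using assms that b0 by (simp add: dl_G right_region_def)
  qed
  moreover have "0 < hh (G R)" using assms b0 by (simp add: hh_G right_region_def)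
  moreover have "snd (G R) < 0" using assms by (simp add: G_def)
  ultimately show ?thesis by (simp add: fresh_def)
qed

lemma pf_of_no_tooth: assumes "\<not> tooth p" "0 < sg p" "0 \<le> fst p" shows "0 \<le> pf p"
proof (rule ccontr)
  assume "\<not> 0 \<le> pf p"
  then have "0 < pf (stp p)" using assms u1 by (simp add: pf_stp_R mult_less_0_iff zero_less_mult_iff)
  then show False using assms by (simp add: tooth_iff)
qed

text \<open>After two left steps the point is on the other side of \<open>hh = 0\<close>. So it
lies in a triangle with vertices on the axes that are inside the edges.\<close>
lemma exit_dl:
  assumes p: "p = brL (brL q)" "fst q \<le> 0" "snd p \<le> 0" "0 < fst p" and m: "m \<le> k"
  shows "0 \<le> dl m p"
proof -
  obtain x w where xw: "p = (x, w)" by force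
  have h: "hh p \<le> 0" using p b0 by (simp add: hh_brL mult_le_0_iff)
  have x: "0 < x" "x \<le> 1 + a * w" "w \<le> 0" using p(3,4) h unfolding xw by (auto simp: hh_def)
  define A where "A = - 1 / a"
  have aA: "a * A = - 1" using a0 by (simp add: A_def)
  have "a * A < a * w" using x aA by linarith
  then have Aw: "A < w" using a0 by simp
  have A0: "A < 0" using a0 by (simp add: A_def)
  have "a * wc < a * A" using hh_cc(1) unfolding aA hh_def wc_def fst_cc by simp
  then have wA: "wc < A" using a0 by simp
  have z1: "1 \<le> fst Zp" using l0 l1 by (simp add: Zp_def field_simps)
  define X where "X = 1 + a * w"
  have "0 \<le> dl m (X, w)"
  proof -
    define t where "t = w / A"
    have t: "0 \<le> t" "t \<le> 1" "t * A = w" using Aw A0 x by (auto simp: t_def divide_simps)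
    have "X = 1 - t" using aA t(3) unfolding X_def by (metis add_uminus_conv_diff mult.left_commute mult_minus1_right)
    then have "(X, w) = (1 - t) *\<^sub>R (1, 0) + t *\<^sub>R (0, A)" using t by (simp add: prod_eq_iff)
    then have "dl m (X, w) = (1 - t) * dl m (1, 0) + t * dl m (0, A)" using dl_aff by metis
    then show ?thesis using dl_x0[OF m, of 1] z1 dl_0w[OF m, of A] wA A0 t by (simp add: conv_nonneg)
  qed
  moreover have "0 \<le> dl m (0, w)" using dl_0w[OF m] wA Aw x by simp
  moreover define r where "r = x / X"
  have X: "0 < X" "x \<le> X" using x by (auto simp: X_def)
  have r: "0 \<le> r" "r \<le> 1" "r * X = x" using x X by (auto simp: r_def)
  have "p = (1 - r) *\<^sub>R (0, w) + r *\<^sub>R (X, w)" using r by (simp add: xw prod_eq_iff algebra_simps)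
  then have "dl m p = (1 - r) * dl m (0, w) + r * dl m (X, w)" using dl_aff by metis
  ultimately show ?thesis using r by (simp add: conv_nonneg)
qed

text \<open>At even times a point of the right half plane is separated from \<open>Zp\<close> by
the stable line of \<open>X\<close>; if a point is in the left half plane it is either the image
of a point of \<open>right_region\<close>, or it continues a left phase.\<close>
definition phase_inv where "phase_inv n s \<longleftrightarrow>
  (even n \<longrightarrow> (0 \<le> fst (F n s) \<and> pf (F n s) \<le> 0) \<or> (fst (F n s) < 0 \<and> (\<exists>R. right_region R \<and> F n s = brR R)) \<or> left_phase n s) \<and>
  (odd n \<longrightarrow> right_region (F n s) \<or> left_phase n s)"

lemma inv: assumes s: "0 \<le> s" "s \<le> 1" shows "phase_inv n s"
proof (induction n)
  case 0
  obtain R where R: "T s = brR R" "R \<in> convex hull {Xp, V1, Zp}" "qf R = 0" using T_hull[OF s] .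
  have "right_region R" using triangle_up_pos[OF R(2)] dl_hull[OF _ R(2)] R(3) by (simp add: right_region_def)
  then have "\<exists>R. right_region R \<and> F 0 s = brR R" using R(1) by (intro exI[of _ R]) simp
  then show ?case using pf_T(1)[OF s(1)] unfolding phase_inv_def
    by (cases "fst (F 0 s) < 0") (simp_all del: split_paired_Ex add: not_less)
next
  case (Suc n)
  have nx: "phase_inv (Suc n) s" if l: "left_phase n s"
  proof -
    obtain t j where tj: "n = t + j" "odd t" "fresh (F t s)" "stays_left (Suc j) (F t s)" using l unfolding left_phase_def by blast
    let ?p = "(brL ^^ Suc j) (F t s)"
    have Fp: "F (Suc n) s = ?p" using F_gen[OF tj(4), of "Suc j"] tj(1) by simp
    show ?thesis
    proof (cases "fst ?p \<le> 0")
      case True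
      then have "stays_left (Suc (Suc j)) (F t s)" using tj(4) by (subst stays_left_Suc) simp
      then have "left_phase (Suc n) s" unfolding left_phase_def using tj by (intro exI[of _ t] exI[of _ "Suc j"]) simp
      then show ?thesis by (simp add: phase_inv_def)
    next
      case False
      show ?thesis
      proof (cases "even j")
        case True
        have "\<not> tooth ((brL ^^ j) (F t s))" using no_tooth[OF True fresh_turn_region[OF tj(3)]] tj(4) stays_left_Suc by blast
        then have "pf (stp ((brL ^^ j) (F t s))) \<le> 0" using fresh_sg[OF tj(3) True] by (auto simp: tooth_iff)
        moreover have "stp ((brL ^^ j) (F t s)) = ?p" using tj(4) stays_left_Suc by (simp add: stp_L)
        ultimately show ?thesis using False True tj(1,2) Fp by (simp add: phase_inv_def)
      next
        case oj: False
        then have es: "even (Suc j)" by simp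
        have "\<not> tooth ?p" using no_tooth[OF es fresh_turn_region[OF tj(3)] tj(4)] .
        then have 1: "0 \<le> pf ?p" using fresh_sg[OF tj(3) es] False by (intro pf_of_no_tooth) auto
        obtain i where i: "j = Suc i" using oj by (cases j) auto
        have 2: "?p = brL (brL ((brL ^^ i) (F t s)))" "fst ((brL ^^ i) (F t s)) \<le> 0" "fst ((brL ^^ j) (F t s)) \<le> 0"
          using tj(4) i by (auto simp: stays_left_def)
        have "snd ?p \<le> 0" using 2(3) by simp
        then have "0 \<le> dl m ?p" if "m \<le> k" for m using exit_dl[OF 2(1,2) _ _ that] False by simp
        then have "right_region ?p" using 1 False qf_F[of "Suc n" s] Fp by (simp add: right_region_def)
        then show ?thesis using Fp tj(1,2) oj by (simp add: phase_inv_def)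
      qed
    qed
  qed
  show ?case
  proof (cases "left_phase n s")
    case True then show ?thesis by (rule nx)
  next
    case nl: False
    show ?thesis
    proof (cases "even n")
      case True
      then consider "0 \<le> fst (F n s)" "pf (F n s) \<le> 0" | R where "fst (F n s) < 0" "right_region R" "F n s = brR R"
        using Suc nl unfolding phase_inv_def by blast
      then show ?thesis
      proof cases
        case 1
        have F: "F (Suc n) s = brR (F n s)" using 1 by (simp add: F_Suc stp_R)
        have "F (Suc n) s \<in> convex hull {Xp, V1, Zp}"
          using 1 u1 qf_F[of "Suc n" s] by (intro triangle_up) (auto simp: F pf_brR mult_le_0_iff)
        then have "right_region (F (Suc n) s)" using triangle_up_pos dl_hull qf_F by (simp add: right_region_def)
        then show ?thesis using True by (simp add: phase_inv_def)
      next
        case 2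
        have F: "F (Suc n) s = G R" using 2 by (simp add: F_Suc stp_L G_def)
        have f: "fresh (G R)" using fresh_G 2 by simp
        show ?thesis
        proof (cases "fst (G R) \<le> 0")
          case True
          then have "left_phase (Suc n) s" unfolding left_phase_def using f F \<open>even n\<close>
            by (intro exI[of _ "Suc n"] exI[of _ 0]) (simp add: stays_left_def)
          then show ?thesis by (simp add: phase_inv_def)
        next
          case False
          have "\<not> tooth (G R)" using no_tooth[of 0 "G R"] fresh_turn_region[OF f] by (simp add: stays_left_def)
          then have "0 \<le> pf (G R)" using fresh_sg[OF f, of 0] False by (intro pf_of_no_tooth) auto
          then have "right_region (G R)" using f False qf_F[of "Suc n" s] F by (simp add: right_region_def fresh_def)
          then show ?thesis using F True by (simp add: phase_inv_def)
        qed
      qed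
    next
      case False
      then have O: "right_region (F n s)" using Suc nl unfolding phase_inv_def by blast
      then have F: "F (Suc n) s = brR (F n s)" by (simp add: F_Suc stp_R right_region_def)
      then have "pf (F (Suc n) s) \<le> 0" using O u1 by (simp add: pf_brR right_region_def)
      moreover have "\<exists>R. right_region R \<and> F (Suc n) s = brR R" using O F by (intro exI[of _ "F n s"]) simp
      ultimately show ?thesis using False unfolding phase_inv_def
        by (cases "fst (F (Suc n) s) < 0") (simp_all del: split_paired_Ex add: not_less)
    qed
  qed
qed

definition edge_point where "edge_point t p s' \<longleftrightarrow>
    (t = 2 * k + 1 \<and> dl k p = 0 \<and> fst p \<le> 0 \<or>
     t = 2 * k + 3 \<and> dl (Suc k) p = 0 \<and> 0 \<le> fst (F (2 * k + 1) s') \<and> fst (F (2 * k + 2) s') \<le> 0)"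

text \<open>The step before a first landing is in the left half plane. By the invariant it
belongs to a left phase or begins one, and the landing puts an iterate of its first point on the
boundary of the tooth; \<open>ctooth_edge\<close> applies.\<close>
lemma landing:
  assumes s: "0 < s" "s \<le> 1" and ln: "land n s" and fi: "\<And>m. m < n \<Longrightarrow> \<not> land m s"
  obtains t r m s' where "n = t + r \<and> pf ((brL ^^ r) (F t s)) = 0 \<or>
      n = t + r + 1 \<and> pf ((brL ^^ Suc r) (F t s)) = 0 \<and> stays_left (Suc r) (F t s)"
    "even r" "fresh (F t s)" "stays_left r (F t s)" "ctooth ((brL ^^ r) (F t s))"
    "s0 \<le> s'" "s' \<le> 1" "F t s = F m s'" "edge_point m (F t s) s'"
proof -
  obtain n' where n': "n = Suc n'" using ln pf_T(2)[of s] s by (cases n) (auto simp: land_def)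
  have neg: "fst (F n' s) < 0" using land_pred[of n' s] ln fi[of n'] n' by auto
  have pz: "0 \<le> fst (F n s)" "pf (F n s) = 0" using ln by (auto simp: land_def)
  have ctz: "ctooth (F n s)" if "0 \<le> sg (F n s)"
    using that pz a0 by (simp add: ctooth_def pf_brL)
  have "\<exists>t r. (n = t + r \<and> pf ((brL ^^ r) (F t s)) = 0 \<or>
      n = t + r + 1 \<and> pf ((brL ^^ Suc r) (F t s)) = 0 \<and> stays_left (Suc r) (F t s)) \<and>
    even r \<and> fresh (F t s) \<and> stays_left r (F t s) \<and> ctooth ((brL ^^ r) (F t s))"
  proof (cases "left_phase n' s")
    case True
    then obtain t j where tj: "n' = t + j" "odd t" "fresh (F t s)" "stays_left (Suc j) (F t s)" unfolding left_phase_def by blast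
    have Fp: "F n s = (brL ^^ Suc j) (F t s)" using F_gen[OF tj(4), of "Suc j"] tj(1) n' by simp
    have Fp': "F n' s = (brL ^^ j) (F t s)" using F_gen[OF tj(4), of j] tj(1) by simp
    show ?thesis
    proof (cases "even j")
      case True
      have "pf (brL (F n' s)) = 0" using pz Fp Fp' by simp
      moreover have "2 * a * fst (F n' s) \<le> 0" using neg a0 by (simp add: mult_le_0_iff)
      ultimately have "pf (brL (F n' s)) = 0" "u * pf (F n' s) \<le> 0" by (simp_all add: pf_brL)
      then have "ctooth (F n' s)" using fresh_sg[OF tj(3) True] u1 unfolding Fp'
        by (simp add: ctooth_def mult_le_0_iff)
      then show ?thesis using tj True pz Fp Fp' n' stays_left_Suc
        by (intro exI[of _ t] exI[of _ j]) auto
    next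
      case False
      then have e: "even (Suc j)" by simp
      have "ctooth (F n s)" using ctz fresh_sg[OF tj(3) e] unfolding Fp by simp
      then show ?thesis using tj e pz(2) n' unfolding Fp by (intro exI[of _ t] exI[of _ "Suc j"]) simp
    qed
  next
    case False
    have "phase_inv n' s" using inv s by simp
    then obtain R where R: "right_region R" "F n' s = brR R" using False neg unfolding phase_inv_def right_region_def
      by (metis less_asym less_le_not_le not_less)
    have F: "F n s = G R" using R neg by (simp add: n' F_Suc stp_L G_def)
    have f: "fresh (F n s)" using fresh_G[OF R(1)] R neg F by simp
    have "ctooth (F n s)" using ctz fresh_sg[OF f, of 0] by simp
    then show ?thesis using f pz by (intro exI[of _ n] exI[of _ 0]) (simp add: stays_left_def)
  qed
  then obtain t r where tr: "n = t + r \<and> pf ((brL ^^ r) (F t s)) = 0 \<or>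
      n = t + r + 1 \<and> pf ((brL ^^ Suc r) (F t s)) = 0 \<and> stays_left (Suc r) (F t s)"
    "even r" "fresh (F t s)" "stays_left r (F t s)" "ctooth ((brL ^^ r) (F t s))" by blast
  have "0 \<le> dl k (F t s)" "0 \<le> dl (Suc k) (F t s)" "0 < hh (F t s)" "snd (F t s) < 0"
    using tr(3) by (auto simp: fresh_def)
  then obtain m s' where "s0 \<le> s'" "s' \<le> 1" "F t s = F m s'" "edge_point m (F t s) s'"
    using ctooth_edge[OF tr(2,4) _ _ _ _ tr(5)] unfolding edge_point_def by blast
  then show thesis using that tr by blast
qed

text \<open>The function \<open>tau\<close> is affine on the two segments, and it is positive at
their endpoints \<open>cc\<close>, \<open>zz (k + 1)\<close> and \<open>G cc\<close>, the last
being the second left iterate of \<open>cc\<close>.\<close>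
lemma tau_edges: assumes tz: "0 < tau (zz (Suc k))"
  shows "th \<le> t \<Longrightarrow> t \<le> 1 \<Longrightarrow> 0 < tau (zz k + t *\<^sub>R uu k)"
    "0 \<le> t \<Longrightarrow> t \<le> th \<Longrightarrow> 0 < tau (zz (Suc k) + t *\<^sub>R uu (Suc k))"
proof -
  have lin: "tau (p + t *\<^sub>R v) = tau p + t * (fst v + l * snd v)" for p v t
    by (simp add: tau_def algebra_simps)
  have pos: "0 < A + t * B" if "0 < A + x * B" "0 < A + y * B" "x \<le> t" "t \<le> y" for A B t x y :: real
  proof (cases "0 \<le> B")
    case True
    then have "x * B \<le> t * B" using that by (intro mult_right_mono)
    then show ?thesis using that by simp
  next
    case False
    then have "y * B \<le> t * B" using that by (intro mult_right_mono_neg) auto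
    then show ?thesis using that by simp
  qed
  have z: "zz (Suc k) = zz k + 1 *\<^sub>R uu k" by (simp add: uu_def)
  show "th \<le> t \<Longrightarrow> t \<le> 1 \<Longrightarrow> 0 < tau (zz k + t *\<^sub>R uu k)"
    using tau_cc tz pos[of "tau (zz k)" th _ 1 t] unfolding cc_def z lin by simp
  have "brL (brL cc) = G cc" by (simp add: G_def brL_def brR_def fst_cc)
  then have "0 < tau (G cc)" using tau_cc u1 tau_brL[of "brL cc"] by (simp add: tau_brL)
  moreover have "G cc = zz (Suc k) + th *\<^sub>R uu (Suc k)"
  proof -
    have "G cc - G (zz k) = GL (th *\<^sub>R uu k)" unfolding G_diff cc_def by simp
    then show ?thesis by (simp add: GL_lin zz_Suc uu_Suc algebra_simps)
  qed
  ultimately have g: "0 < tau (zz (Suc k)) + th * (fst (uu (Suc k)) + l * snd (uu (Suc k)))"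
    by (simp add: lin)
  show "0 \<le> t \<Longrightarrow> t \<le> th \<Longrightarrow> 0 < tau (zz (Suc k) + t *\<^sub>R uu (Suc k))"
    using tz g pos[of "tau (zz (Suc k))" 0 _ th t] unfolding lin by simp
qed

text \<open>Moving the point horizontally to the left decreases \<open>tau\<close> and leads out
of the region. The exit point is on an edge or is an iterate of a point of the axis above
\<open>cc\<close>, where \<open>tau\<close> is positive.\<close>
lemma tau_turn_region: assumes tz: "0 < tau (zz (Suc k))" and p: "turn_region p" "fst p \<le> 0" shows "0 < tau p"
proof (rule ccontr)
  assume n: "\<not> 0 < tau p"
  define M where "M = hh p + 1"
  have M: "0 < M" using p by (simp add: M_def turn_region_def)
  define q where "q = p - (M, 0)"
  have hq: "hh q < 0" by (simp add: q_def M_def hh_def)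
  obtain s where s: "0 \<le> s" "s < 1"
    and ex: "0 \<le> (1 - s) * dl k p + s * dl k q" "0 \<le> (1 - s) * dl (Suc k) p + s * dl (Suc k) q"
      "0 \<le> (1 - s) * hh p + s * hh q"
      "(1 - s) * dl k p + s * dl k q = 0 \<or> (1 - s) * dl (Suc k) p + s * dl (Suc k) q = 0 \<or> (1 - s) * hh p + s * hh q = 0"
    using affine_exit[OF _ _ _ hq, of "dl k p" "dl (Suc k) p" "hh p" "dl k q" "dl (Suc k) q"] p(1)
    unfolding turn_region_def by blast
  define r where "r = (1 - s) *\<^sub>R p + s *\<^sub>R q"
  have Omr: "0 \<le> dl k r" "0 \<le> dl (Suc k) r" "0 \<le> hh r"
    and zr: "dl k r = 0 \<or> dl (Suc k) r = 0 \<or> hh r = 0"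
    using ex by (simp_all add: r_def dl_aff hh_aff)
  have sM: "0 \<le> s * M" using s M by simp
  have fresh: "fst r = fst p - s * M" "snd r = snd p" by (simp_all add: r_def q_def algebra_simps)
  have tr: "tau r \<le> 0" using n sM by (simp add: tau_def fresh)
  have f0: "fst r \<le> 0" using fresh p sM by simp
  have sr: "snd r < 0" using snd_of_hh Omr f0 by blast
  show False using zr
  proof (elim disjE)
    assume d: "dl k r = 0"
    then obtain s' where s': "s0 \<le> s'" "s' \<le> 1" "r = F (2 * k + 1) s'" using edge1 Omr f0 by blast
    have "r = zz k + par s' *\<^sub>R uu k" using F_edge1 s' by simp
    then show False using tau_edges(1)[OF tz, of "par s'"] fst_line_th[of "par s'"] f0 par(3)[OF s'(1,2)] tr by simp
  next
    assume d: "dl (Suc k) r = 0"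
    then obtain t where t: "r = zz (Suc k) + t *\<^sub>R uu (Suc k)" using dl_zero_line by blast
    have "0 \<le> t * (- (b ^ (2 * k) * k1))" using Omr(1) unfolding t dl_line by linarith
    then have t0: "0 \<le> t" using bk1_neg[of k] by (smt (verit) mult_neg_pos)
    define R where "R = zz k + t *\<^sub>R uu k"
    have pG: "r = G R"
    proof -
      have "G R - G (zz k) = GL (t *\<^sub>R uu k)" unfolding G_diff R_def by simp
      then have "G R = zz (Suc k) + t *\<^sub>R uu (Suc k)" by (simp add: GL_lin zz_Suc uu_Suc algebra_simps)
      then show ?thesis using t by simp
    qed
    have "0 \<le> fst R" using Omr(3) b0 unfolding pG hh_G by (simp add: zero_le_mult_iff)
    then have "t \<le> th" using fst_line_th'[of t] by (simp add: R_def)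
    then show False using tau_edges(2)[OF tz t0] tr t by simp
  next
    assume "hh r = 0"
    then obtain w where w: "r = brL (brL (0, w))" "wc \<le> w" using hh0_pred Omr(2) by blast
    have "tau r = u * (u * tau (0, w))" unfolding w(1) tau_brL ..
    then show False using tau_axis[OF w(2)] tau_cc tr u1 by (simp add: mult_le_0_iff)
  qed
qed

lemma tau_left: assumes tz: "0 < tau (zz (Suc k))" and "left_phase n s" shows "0 < tau (F n s)"
proof -
  obtain t j where tj: "n = t + j" "fresh (F t s)" "stays_left (Suc j) (F t s)" using assms(2) unfolding left_phase_def by blast
  have "fst (F t s) \<le> 0" using tj(3) by (auto simp: stays_left_def dest: spec[of _ 0])
  then have "0 < tau (F t s)" using tau_turn_region[OF tz] fresh_turn_region tj by blast
  then show ?thesis using F_gen[OF tj(3), of j] tj(1) u1 by (simp add: tau_iter)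
qed
lemma tau_odd: assumes tz: "0 < tau (zz (Suc k))" and s: "0 \<le> s" "s \<le> 1" "odd n" "fst (F n s) \<le> 0"
  shows "0 < tau (F n s)"
proof -
  have "left_phase n s" using inv[OF s(1,2), of n] s unfolding phase_inv_def right_region_def by auto
  then show ?thesis using tau_left tz by blast
qed

end

section \<open>Orbits that meet the axis before they land\<close>

context lozi_uv begin

lemma stp_inj: "stp p = stp q \<longleftrightarrow> p = q"
  using b0 by (auto simp: stp_def prod_eq_iff)
lemma stp_iter_inj: "(stp ^^ n) p = (stp ^^ n) q \<longleftrightarrow> p = q"
  by (induction n) (simp_all add: stp_inj)
lemma F_add: "F (m + n) s = (stp ^^ m) (F n s)" by (simp add: F_def funpow_add)
lemma F_cancel: "F (n + i) s = F (n + j) s' \<longleftrightarrow> F i s = F j s'"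
  by (simp add: F_add stp_iter_inj)

lemma qf_stp_neg: "qf p < 0 \<or> (qf p \<le> 0 \<and> fst p < 0) \<Longrightarrow> qf (stp p) < 0"
  using l0 a0 by (cases "0 \<le> fst p")
    (auto simp: stp_R stp_L qf_brR qf_brL mult_less_0_iff mult_le_0_iff intro!: add_neg_nonpos add_nonpos_neg)

text \<open>The functional \<open>qf\<close> becomes negative with the first visit to the open
left half plane and stays negative, but it vanishes on \<open>T\<close>. This gives every point
of the unstable manifold a well-defined time.\<close>
lemma qf_after: assumes "fst (F i s) < 0" "i < n" shows "qf (F n s) < 0"
proof -
  have "qf (F (Suc i + d) s) < 0" for d
  proof (induction d)
    case 0 then show ?case using qf_stp_neg[of "F i s"] qf_F[of i s] assms(1) by (simp add: F_Suc)
  next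
    case (Suc d) then show ?case using qf_stp_neg by (simp add: F_Suc)
  qed
  from this[of "n - Suc i"] show ?thesis using assms(2) by simp
qed

lemma T_s0': "F 1 s0 = Zp" "F 2 s0 = T 1" "F 0 s0 = Zinv"
proof -
  show "F 0 s0 = Zinv" by (simp add: T_s0)
  show 1: "F 1 s0 = Zp" using brL_Zinv by (simp add: F_Suc T_s0 stp_L Zinv_def)
  have "F 2 s0 = stp (F 1 s0)" by (simp add: F_Suc numeral_2_eq_2)
  then show "F 2 s0 = T 1" using fst_Zp unfolding 1 T_1 by (simp add: stp_R brR_Zp)
qed
lemma fst_T: assumes "s0 < s" "s \<le> 1" shows "fst (T s) < 0"
proof -
  have "0 < par s" "par s \<le> 1" using assms s0 by (auto simp: par_def)
  then show ?thesis unfolding T_par fst_aff using zm0_neg by (simp add: Zinv_def zm_0 mult_pos_neg)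
qed
lemma fst_T': assumes "s0 \<le> s" "s \<le> 1" shows "fst (T s) \<le> 0"
  using fst_T[of s] assms T_s0 by (cases "s = s0") (auto simp: Zinv_def)
lemma T_inj: "T s = T s' \<longleftrightarrow> s = s'"
proof
  assume e: "T s = T s'"
  have "snd (T x) = fst Xp + x * (1 / (1 - l) - fst Xp)" for x by (simp add: T_def Z1_def xX0 algebra_simps)
  then have "s * (1 / (1 - l) - fst Xp) = s' * (1 / (1 - l) - fst Xp)" using e by (metis add_left_cancel)
  moreover have "1 / (1 - l) - fst Xp = u * fst Xp"
    using qf_Xp by (simp add: qf_def xX0)
  then have "1 / (1 - l) - fst Xp \<noteq> 0" using xX0 u1 by simp
  ultimately show "s = s'" by simp
qed simp

lemma track_le: assumes "s0 < s" "s \<le> 1" "s0 \<le> s'" "s' \<le> 1" "F t s = F m s'" shows "t \<le> m"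
proof (rule ccontr)
  assume "\<not> t \<le> m"
  then obtain d where d: "t = m + Suc d" by (metis add_Suc_right less_imp_Suc_add not_le)
  have "F (m + Suc d) s = F (m + 0) s'" using assms d by simp
  then have "F (Suc d) s = F 0 s'" unfolding F_cancel .
  moreover have "qf (F (Suc d) s) < 0" using qf_after[of 0 s "Suc d"] fst_T assms by simp
  ultimately show False using qf_T by simp
qed
lemma track: assumes "s0 < s" "s < 1" "s0 \<le> s'" "s' \<le> 1" "F t s = F m s'" shows "t = m \<and> s = s'"
proof -
  have "t = m"
  proof (rule ccontr)
    assume "t \<noteq> m"
    then have "t < m" using track_le[of s s' t m] assms by simp
    then obtain d where d: "m = t + Suc d" by (metis add_Suc_right less_imp_Suc_add)
    have "F (t + 0) s = F (t + Suc d) s'" using assms d by simp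
    then have e: "T s = F (Suc d) s'" unfolding F_cancel by simp
    show False
    proof (cases "s0 < s'")
      case True
      then have "qf (F (Suc d) s') < 0" using qf_after[of 0 s' "Suc d"] fst_T assms by simp
      then show False using qf_T[of s] e by simp
    next
      case False
      then have s': "s' = s0" using assms by simp
      consider "d = 0" | "d = 1" | "d \<ge> 2" by linarith
      then show False
      proof cases
        case 1 then show False using e s' T_s0' fst_T[of s] assms fst_Zp by simp
      next
        case 2
        then have "T s = T 1" using e s' T_s0'(2) by (simp add: numeral_2_eq_2)
        then show False using T_inj assms by simp
      next
        case 3
        have "fst (F 2 s0) < 0" unfolding T_s0' by (rule fst_T) (use s0 in auto)
        then have "qf (F (Suc d) s0) < 0" using 3 by (intro qf_after[of 2]) auto
        then show False using e s' qf_T[of s] by simp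
      qed
    qed
  qed
  then show ?thesis using assms(5) F_cancel[of m 0 s 0 s'] T_inj by simp
qed

lemma Vp_iff: assumes "fst p = 0" "pf p = 0" shows "p = Vp"
proof -
  have "l * snd p = - (1 / (1 + u))" using assms by (simp add: pf_def)
  moreover have "snd p = (l * snd p) / l" using l0 by simp
  ultimately have "snd p = - (1 / (1 + u)) / l" by simp
  then show ?thesis using assms by (simp add: Vp_def prod_eq_iff mult.commute)
qed
lemma pf_Vp: "pf Vp = 0" "fst Vp = 0" using l0 by (simp_all add: Vp_def pf_def)

text \<open>At an odd time before the end the next point is in the right half plane and on the
axis \<open>w = 0\<close>. At an even time the point is above \<open>hh = 0\<close>, so two
steps later it is in the right half plane with positive \<open>pf\<close>, hence not in the
closed tooth.\<close>
lemma left_hit: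
  assumes r: "even r" and g: "stays_left r p" and sp: "0 < sg p" and ct: "ctooth ((brL ^^ r) p)"
    and j: "1 \<le> j" "j \<le> r" and z: "fst ((brL ^^ j) p) = 0"
  shows "j = r"
proof (rule ccontr)
  assume "j \<noteq> r"
  then have jr: "j < r" using j by simp
  let ?q = "(brL ^^ j) p"
  define w where "w = snd ?q"
  have n1: "(brL ^^ Suc j) p = (1 + b * w, 0)" using z by (simp add: brL_def w_def)
  have sr: "snd ((brL ^^ r) p) < 0" using ct sg_pf_snd_neg by (simp add: ctooth_def)
  have Sr: "Suc j < r"
  proof (rule ccontr)
    assume "\<not> Suc j < r"
    then have "r = Suc j" using jr by simp
    then show False using sr z by simp
  qed
  have neg: "1 + b * w \<le> 0" using g Sr n1 unfolding stays_left_def by (metis fst_conv)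
  show False
  proof (cases "even j")
    case False
    have "(- l) ^ j < 0" using False l0 by simp
    then have "sg ?q < 0" using sp by (simp add: sg_iter mult_neg_pos)
    then have "- (1 / (1 + l)) < u * w" using z by (simp add: sg_def w_def)
    then have "l * (- (1 / (1 + l))) < l * (u * w)" using l0 by (rule mult_strict_left_mono)
    moreover have "l * (1 / (1 + l)) < 1" using l0 by simp
    ultimately have "0 < 1 + b * w" by (simp add: b_def ac_simps)
    then show False using neg by simp
  next
    case True
    then have "2 \<le> j" using j by presburger
    then obtain i where i: "j = Suc (Suc i)" by (metis add_2_eq_Suc le_Suc_ex)
    have qi: "?q = brL (brL ((brL ^^ i) p))" using i by simp
    have fi: "fst ((brL ^^ i) p) \<le> 0" using g jr i by (simp add: stays_left_def)
    have "hh ?q \<le> 0" unfolding qi hh_brL using fi b0 by (simp add: mult_le_0_iff)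
    then have aw: "- 1 \<le> a * w" using z by (simp add: hh_def w_def)
    define v where "v = 1 + b * w"
    have "(brL ^^ Suc (Suc j)) p = brL ((brL ^^ Suc j) p)" by simp
    then have n2: "(brL ^^ Suc (Suc j)) p = (1 + a * v, v)" unfolding n1 by (simp add: brL_def v_def)
    have av: "a * v = a + b * (a * w)" by (simp add: v_def algebra_simps)
    have "b * (- 1) \<le> b * (a * w)" using aw b0 by (intro mult_left_mono) auto
    then have avb: "a - b \<le> a * v" using av by simp
    have x: "0 < 1 + a * v" using avb b1 a0 by simp
    have v0: "v \<le> 0" using neg by (simp add: v_def)
    have ab: "a \<le> b" using avb v0 a0 by (smt (verit) mult_nonneg_nonpos)
    have "- u < (a - l) * v * (1 + u)"
    proof (cases "a \<le> l")
      case True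
      then have "0 \<le> (a - l) * v" using v0 by (intro mult_nonpos_nonpos) auto
      then have "0 \<le> (a - l) * v * (1 + u)" using u1 by simp
      then show ?thesis using u1 by simp
    next
      case False
      have "u \<le> l * (1 + u)" using ab by (simp add: a_def b_def algebra_simps)
      then have A: "(1 + u) * (a - l) \<le> u * (u - 1)" by (simp add: a_def algebra_simps)
      have "(u - 1) * (b - a) \<le> (u - 1) * 1" using u1 b1 a0 by (intro mult_left_mono) auto
      also have "\<dots> < a" using l1 by (simp add: a_def)
      finally have B: "(u - 1) * (b - a) < a" .
      have "(1 + u) * (a - l) * (b - a) \<le> u * (u - 1) * (b - a)" using A ab by (intro mult_right_mono) auto
      also have "\<dots> < u * a" using B u1 by (simp add: mult.assoc)
      finally have C: "(1 + u) * (a - l) * (b - a) < u * a" .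
      have "(1 + u) * (a - l) * (a - b) \<le> (1 + u) * (a - l) * (a * v)" using avb False u1
        by (intro mult_left_mono) auto
      then have "a * (- u) < a * ((a - l) * v * (1 + u))" using C by (simp add: algebra_simps)
      then show ?thesis using mult_less_cancel_left_pos[OF a0] by blast
    qed
    then have "- u / (1 + u) < (a - l) * v" using u1 by (simp add: field_simps)
    moreover have "1 - 1 / (1 + u) = u / (1 + u)" using u1 by (simp add: field_simps)
    ultimately have pp: "0 < pf (1 + a * v, v)" by (simp add: pf_def algebra_simps)
    show False
    proof (cases "Suc (Suc j) < r")
      case True
      then show False using g n2 x unfolding stays_left_def by (metis fst_conv not_less)
    next
      case False
      then have "r = Suc (Suc j)" using Sr by simp
      then show False using ct n2 pp by (simp add: ctooth_def)
    qed
  qed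
qed

lemma stays_leftD: "stays_left n p \<Longrightarrow> j < n \<Longrightarrow> fst ((brL ^^ j) p) \<le> 0" by (simp add: stays_left_def)
lemma pf_iter_aff: "\<exists>c1 c2 c3. \<forall>p. pf ((brL ^^ n) p) = c1 * fst p + c2 * snd p + c3"
proof (induction n)
  case 0
  have "\<forall>p. pf ((brL ^^ 0) p) = 1 * fst p + (- l) * snd p + (- 1 / (1 + u))" by (simp add: pf_def)
  then show ?case by blast
next
  case (Suc n)
  then obtain c1 c2 c3 where c: "\<And>p. pf ((brL ^^ n) p) = c1 * fst p + c2 * snd p + c3" by blast
  have "\<forall>p. pf ((brL ^^ Suc n) p) = (a * c1 + c2) * fst p + (b * c1) * snd p + (c1 + c3)"
    using c by (simp add: funpow_swap1 brL_def algebra_simps)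
  then show ?case by blast
qed
lemma continuous_brL: "isCont (brL ^^ n) p"
proof -
  have "continuous_on UNIV (brL ^^ n)"
  proof (induction n)
    case (Suc n)
    have "continuous_on UNIV brL" unfolding brL_def by (intro continuous_intros)
    then have "continuous_on UNIV (\<lambda>x. brL ((brL ^^ n) x))" using Suc by (rule continuous_on_compose2) auto
    then show ?case by (simp add: o_def)
  qed simp
  then show ?thesis using continuous_on_eq_continuous_at[OF open_UNIV] by blast
qed
end

context lozi_C begin

lemma second_axis:
  assumes s: "s0 < s" "s < 1" and p: "F (2 * k + 3) s = p" "fst p = 0" "fresh p" "dl (Suc k) p = 0"
    and r: "even r" "stays_left r p" "ctooth ((brL ^^ r) p)"
  shows "r = 0"
proof (rule ccontr)
  assume "r \<noteq> 0"
  then have "2 \<le> r" using r(1) by presburger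
  then obtain i where i: "r = Suc (Suc i)" by (metis add_2_eq_Suc le_Suc_ex)
  define w where "w = snd p"
  have pw: "p = (0, w)" using p by (simp add: w_def prod_eq_iff)
  have "fst ((brL ^^ 1) p) \<le> 0" using stays_leftD[OF r(2), of 1] i by simp
  then have bw: "1 + b * w \<le> 0" by (simp add: pw brL_def)
  have "dl k (0, w) - dl k cc = - fst (uu k) * (w - wc)" by (simp add: dl_form cc algebra_simps)
  moreover have "0 \<le> dl k (0, w)" using p(3) by (simp add: fresh_def pw)
  ultimately have "fst (uu k) * (w - wc) \<le> 0" using dl_k_cc by simp
  then have "wc \<le> w" using al_neg by (simp add: mult_le_0_iff)
  moreover have "w \<noteq> wc"
  proof
    assume "w = wc"
    then have "F (2 * k + 3) s = F (2 * k + 1) (unpar th)"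
      using p(1) pw F_edge1[of "unpar th"] unpar[of th] th cc by (simp add: cc_def)
    then have "2 * k + 3 \<le> 2 * k + 1" using track_le[of s "unpar th"] s unpar[of th] th by simp
    then show False by simp
  qed
  ultimately have G: "0 < fst (brL (brL p)) \<and> 0 < pf (brL (brL p))"
    using Gcc_pos[of w] p(3,4) bw by (simp add: pw fresh_def)
  have p2: "(brL ^^ Suc (Suc 0)) p = brL (brL p)" by simp
  show False
  proof (cases "i = 0")
    case True
    then show False using r(3) i G by (simp add: ctooth_def)
  next
    case False
    then have "fst ((brL ^^ Suc (Suc 0)) p) \<le> 0" using stays_leftD[OF r(2), of "Suc (Suc 0)"] i by simp
    then show False using G p2 by simp
  qed
qed

text \<open>Near \<open>cc\<close> the condition of being in the tooth at the landing time is
\<open>g < 0\<close> for an affine function \<open>g\<close> that vanishes at \<open>cc\<close>.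
Points of the edge to the left of the axis do not satisfy it, nor do points above
\<open>cc\<close> by \<open>no_tooth\<close>, nor points of the edge to the right of the axis,
whose images under the right branch are the left images of points \<open>cc + d v'\<close>. As
\<open>v\<close> and \<open>v'\<close> sum to a downward vector, \<open>g\<close> is constant,
which is absurd.\<close>
lemma fold:
  assumes th1: "th < 1" and r: "even r" "2 \<le> r" "stays_left r cc" "ctooth ((brL ^^ r) cc)" "fst (brL cc) < 0"
    and ln: "pf ((brL ^^ r) cc) = 0 \<or> pf ((brL ^^ Suc r) cc) = 0 \<and> stays_left (Suc r) cc"
  shows "(brL ^^ r) cc = Vp"
proof (rule ccontr)
  assume nV: "(brL ^^ r) cc \<noteq> Vp"
  let ?P = "(brL ^^ r) cc"
  have sgc: "0 < sg cc" using sg_of_hh[of cc] hh_cc by (simp add: wc_def)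
  have sgP: "0 < sg ?P" using r(1) sgc l0 by (simp add: sg_iter)
  have strict: "fst ((brL ^^ j) cc) < 0" if "1 \<le> j" "j < r" for j
  proof -
    have "fst ((brL ^^ j) cc) \<le> 0" using r(3) that by (simp add: stays_left_def)
    moreover have "fst ((brL ^^ j) cc) \<noteq> 0" using left_hit[OF r(1,3) sgc r(4), of j] that by auto
    ultimately show ?thesis by simp
  qed
  \<comment> \<open>the affine functional that detects the tooth near the landing point\<close>
  have "\<exists>g g1 g2 g3. (\<forall>p. g p = g1 * fst p + g2 * snd p + (g3::real)) \<and> g cc = 0 \<and>
     (\<forall>\<^sub>F y in nhds cc. g y < 0 \<longrightarrow> tooth ((brL ^^ r) y)) \<and> (\<exists>q. g q < 0)"
  proof -
    obtain be where be: "sg be = 0" "fst be < 0" "pf be < 0" "0 < pf (brL be)" using beta by blast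
    define qq where "qq = (brLi ^^ r) be"
    have qn: "(brL ^^ r) qq = be" using brL_brLi_iter[of r r be] by (simp add: qq_def)
    have tt: "((\<lambda>y. (brL ^^ r) y) \<longlongrightarrow> ?P) (nhds cc)" using continuous_brL[of cc r]
      by (simp add: isCont_def tendsto_at_iff_tendsto_nhds)
    have e1: "\<forall>\<^sub>F y in nhds cc. 0 < sg ((brL ^^ r) y)"
    proof (rule order_tendstoD)
      show "((\<lambda>y. sg ((brL ^^ r) y)) \<longlongrightarrow> sg ?P) (nhds cc)" unfolding sg_def by (intro tendsto_intros tt)
    qed (rule sgP)
    show ?thesis
    proof (cases "pf ?P = 0")
      case True
      have "fst ?P \<noteq> 0" using nV Vp_iff True by blast
      moreover have "0 \<le> 2 * a * fst ?P" using r(4) True by (simp add: ctooth_def pf_brL)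
      ultimately have "0 < fst ?P" using a0 by (simp add: zero_le_mult_iff)
      then have p1: "0 < pf (brL ?P)" using True a0 by (simp add: pf_brL)
      have "\<forall>\<^sub>F y in nhds cc. 0 < pf (brL ((brL ^^ r) y))"
      proof (rule order_tendstoD)
        show "((\<lambda>y. pf (brL ((brL ^^ r) y))) \<longlongrightarrow> pf (brL ?P)) (nhds cc)"
          unfolding pf_def brL_def by (simp, intro tendsto_intros tt[unfolded brL_def])
      qed (rule p1)
      then have "\<forall>\<^sub>F y in nhds cc. pf ((brL ^^ r) y) < 0 \<longrightarrow> tooth ((brL ^^ r) y)"
        using e1 by eventually_elim (simp add: tooth_def)
      moreover have "\<exists>q. pf ((brL ^^ r) q) < 0" using qn be by (intro exI[of _ qq]) simp
      moreover obtain g1 g2 g3 where "\<forall>p. pf ((brL ^^ r) p) = g1 * fst p + g2 * snd p + g3"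
        using pf_iter_aff[of r] by blast
      ultimately show ?thesis using True by (intro exI[of _ "\<lambda>p. pf ((brL ^^ r) p)"]) blast
    next
      case False
      then have z: "pf (brL ?P) = 0" and "stays_left (Suc r) cc" using ln by auto
      then have f: "fst ?P \<le> 0" by (simp add: stays_left_Suc)
      have "2 * a * fst ?P \<le> 0" using f a0 by (simp add: mult_le_0_iff)
      then have "u * pf ?P \<le> 0" using z by (simp add: pf_brL)
      then have p1: "pf ?P < 0" using u1 False by (simp add: mult_le_0_iff)
      have "\<forall>\<^sub>F y in nhds cc. pf ((brL ^^ r) y) < 0"
      proof (rule order_tendstoD)
        show "((\<lambda>y. pf ((brL ^^ r) y)) \<longlongrightarrow> pf ?P) (nhds cc)" unfolding pf_def by (intro tendsto_intros tt)
      qed (rule p1)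
      then have "\<forall>\<^sub>F y in nhds cc. - pf ((brL ^^ Suc r) y) < 0 \<longrightarrow> tooth ((brL ^^ r) y)"
        using e1 by eventually_elim (simp add: tooth_def)
      moreover have "\<exists>q. - pf ((brL ^^ Suc r) q) < 0" using qn be by (intro exI[of _ qq]) simp
      moreover obtain g1 g2 g3 where g: "\<And>p. pf ((brL ^^ Suc r) p) = g1 * fst p + g2 * snd p + g3"
        using pf_iter_aff[of "Suc r"] by blast
      moreover have "\<forall>p. - pf ((brL ^^ Suc r) p) = (- g1) * fst p + (- g2) * snd p + (- g3)" using g by simp
      moreover have "- pf ((brL ^^ Suc r) cc) = 0" using z by simp
      ultimately show ?thesis by (intro exI[of _ "\<lambda>p. - pf ((brL ^^ Suc r) p)"]) blast
    qed
  qed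
  then obtain g g1 g2 g3 where g: "\<And>p. g p = g1 * fst p + g2 * snd p + (g3::real)" "g cc = 0"
     "\<forall>\<^sub>F y in nhds cc. g y < 0 \<longrightarrow> tooth ((brL ^^ r) y)" and gq: "\<exists>q. g q < 0" by blast
  define la where "la v = g1 * fst v + g2 * snd v" for v :: "real \<times> real"
  have gla: "g (cc + d *\<^sub>R v) = d * la v" for d v using g(2) unfolding g(1) la_def by (simp add: algebra_simps)
  have line: "filterlim (\<lambda>d::real. cc + d *\<^sub>R v) (nhds cc) (at_right 0)" for v
    by (rule tendsto_eq_intros refl | simp)+
  have test: "0 \<le> la v" if "\<forall>\<^sub>F d in at_right 0. \<not> tooth ((brL ^^ r) (cc + d *\<^sub>R v))" for v
  proof -
    have "\<forall>\<^sub>F d in at_right 0. g (cc + d *\<^sub>R v) < 0 \<longrightarrow> tooth ((brL ^^ r) (cc + d *\<^sub>R v))"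
      using g(3) line[of v] unfolding filterlim_iff by blast
    moreover have "\<forall>\<^sub>F d in at_right (0::real). 0 < d" by (rule eventually_at_right_less)
    ultimately have "\<forall>\<^sub>F d in at_right (0::real). 0 < d \<and> \<not> d * la v < 0"
      using that by eventually_elim (auto simp: gla)
    then obtain d where "0 < d" "\<not> d * la v < 0" using eventually_happens trivial_limit_at_right_real by blast
    then show ?thesis by (simp add: mult_less_0_iff not_less)
  qed
  have genev: "\<forall>\<^sub>F d in at_right 0. \<forall>j\<in>{1..<r}. fst ((brL ^^ j) (cc + d *\<^sub>R v)) < 0" for v
  proof (rule eventually_ball_finite)
    show "\<forall>j\<in>{1..<r}. \<forall>\<^sub>F d in at_right 0. fst ((brL ^^ j) (cc + d *\<^sub>R v)) < 0"
    proof
      fix j assume j: "j \<in> {1..<r}"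
      have "((\<lambda>d. (brL ^^ j) (cc + d *\<^sub>R v)) \<longlongrightarrow> (brL ^^ j) cc) (at_right 0)"
        using continuous_brL[of cc j] line[of v] by (rule isCont_tendsto_compose)
      then have "((\<lambda>d. fst ((brL ^^ j) (cc + d *\<^sub>R v))) \<longlongrightarrow> fst ((brL ^^ j) cc)) (at_right 0)" by (rule tendsto_fst)
      then show "\<forall>\<^sub>F d in at_right 0. fst ((brL ^^ j) (cc + d *\<^sub>R v)) < 0"
        by (rule order_tendstoD) (use strict j in auto)
    qed
  qed simp
  have lt: "\<forall>\<^sub>F d in at_right (0::real). 0 < d \<and> d < x" if "0 < x" for x
    using that by (auto simp: eventually_at_right_field)
  define v where "v = uu k"
  have v1: "fst v < 0" using al_neg by (simp add: v_def)
  have left: "0 \<le> la v"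
  proof (rule test)
    have "0 < 1 - th" using th1 by simp
    from lt[OF this] genev[of v] show "\<forall>\<^sub>F d in at_right 0. \<not> tooth ((brL ^^ r) (cc + d *\<^sub>R v))"
    proof eventually_elim
      case (elim d)
      have e: "F (2 * k + 1) (unpar (th + d)) = cc + d *\<^sub>R v" "s0 \<le> unpar (th + d)" "unpar (th + d) \<le> 1"
        using F_edge1[of "unpar (th + d)"] unpar[of "th + d"] th elim by (auto simp: cc_def v_def algebra_simps)
      have "stays_left r (cc + d *\<^sub>R v)" unfolding stays_left_def
      proof (intro allI impI)
        fix j assume "j < r"
        then show "fst ((brL ^^ j) (cc + d *\<^sub>R v)) \<le> 0"
          using elim v1 fst_cc by (cases "j = 0") (auto simp: mult_le_0_iff less_imp_le)
      qed
      then show ?case using AVg[of "unpar (th + d)" "2 * k + 1" r] e r(1) by simp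
    qed
  qed
  have up: "0 \<le> la (0, 1)"
  proof (rule test)
    have h: "\<forall>\<^sub>F d in at_right 0. 0 < hh (cc + d *\<^sub>R (0, 1))"
    proof (rule order_tendstoD)
      show "((\<lambda>d. hh (cc + d *\<^sub>R (0, 1))) \<longlongrightarrow> hh cc) (at_right 0)"
        unfolding hh_def by (intro tendsto_intros line)
    qed (rule hh_cc)
    have "0 < dl (Suc k) cc" unfolding cc_def dl_line using th1 bk1_neg[of k] by (intro mult_neg_neg) auto
    moreover have "((\<lambda>d. dl (Suc k) (cc + d *\<^sub>R (0, 1))) \<longlongrightarrow> dl (Suc k) cc) (at_right 0)"
      unfolding dl_def crs_def by (intro tendsto_intros line)
    ultimately have "\<forall>\<^sub>F d in at_right 0. 0 < dl (Suc k) (cc + d *\<^sub>R (0, 1))" by (intro order_tendstoD)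
    from this h genev[of "(0, 1)"] lt[OF zero_less_one] show "\<forall>\<^sub>F d in at_right 0. \<not> tooth ((brL ^^ r) (cc + d *\<^sub>R (0, 1)))"
    proof eventually_elim
      case (elim d)
      have "0 \<le> dl k (cc + d *\<^sub>R (0, 1))"
      proof -
        have "dl k (cc + d *\<^sub>R (0, 1)) = - fst (uu k) * d + dl k cc" by (simp add: dl_form algebra_simps)
        moreover have "0 \<le> - fst (uu k) * d" using al_neg elim by (simp add: mult_le_0_iff)
        ultimately show ?thesis using dl_k_cc by simp
      qed
      then have "turn_region (cc + d *\<^sub>R (0, 1))" using elim by (simp add: turn_region_def)
      moreover have "stays_left r (cc + d *\<^sub>R (0, 1))" unfolding stays_left_def
      proof (intro allI impI)
        fix j assume "j < r"
        then show "fst ((brL ^^ j) (cc + d *\<^sub>R (0, 1))) \<le> 0"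
          using elim fst_cc by (cases "j = 0") (auto simp: less_imp_le)
      qed
      ultimately show ?case using no_tooth[OF r(1)] by blast
    qed
  qed
  define v' where "v' = (- fst v, - (snd v - 2 * a * fst v / b))"
  have right: "0 \<le> la v'"
  proof (rule test)
    from lt[OF th(1)] genev[of v'] show "\<forall>\<^sub>F d in at_right 0. \<not> tooth ((brL ^^ r) (cc + d *\<^sub>R v'))"
    proof eventually_elim
      case (elim d)
      define x where "x = cc + (- d) *\<^sub>R v"
      have s: "F (2 * k + 1) (unpar (th - d)) = x" "s0 \<le> unpar (th - d)" "unpar (th - d) \<le> 1"
        using F_edge1[of "unpar (th - d)"] unpar[of "th - d"] th elim by (auto simp: cc_def v_def x_def algebra_simps)
      have fx: "0 \<le> fst x" using v1 elim fst_cc by (simp add: x_def mult_le_0_iff)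
      have bx: "brR x = brL (cc + d *\<^sub>R v')" using b0 fst_cc
        by (simp add: brR_def brL_def x_def v'_def field_simps)
      have f2: "F (2 * k + 2) (unpar (th - d)) = brL (cc + d *\<^sub>R v')"
        using s(1) fx F_Suc[of "2 * k + 1"] by (simp add: stp_R bx)
      have "fst (brL (cc + d *\<^sub>R v')) < 0" using elim r(2) by (auto dest: bspec[of _ _ 1])
      then have f3: "F (2 * k + 3) (unpar (th - d)) = brL (brL (cc + d *\<^sub>R v'))"
        using f2 F_Suc[of "2 * k + 2"] by (simp add: stp_L numeral_3_eq_3)
      obtain m where m: "r = Suc (Suc m)" using r(2) by (metis add_2_eq_Suc le_Suc_ex)
      have it: "(brL ^^ i) (brL (brL (cc + d *\<^sub>R v'))) = (brL ^^ Suc (Suc i)) (cc + d *\<^sub>R v')" for i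
        by (simp add: funpow_swap1)
      have "stays_left m (F (2 * k + 3) (unpar (th - d)))" unfolding stays_left_def f3 it
        using elim m by (auto simp: less_imp_le simp del: funpow.simps)
      then show ?case using AVg[of "unpar (th - d)" "2 * k + 3" m] s(2,3) r(1) m f3 it[of m] by simp
    qed
  qed
  have e: "la v + la v' = 2 * a * fst v / b * g2" by (simp add: la_def v'_def algebra_simps)
  have "2 * a * fst v / b < 0" using a0 b0 v1 by (simp add: divide_neg_pos mult_pos_neg)
  moreover have "0 \<le> 2 * a * fst v / b * g2" using e left right by simp
  ultimately have "g2 \<le> 0" by (metis mult_neg_pos not_less)
  then have g2: "g2 = 0" using up by (simp add: la_def)
  have "0 \<le> g1 * fst v" "0 \<le> g1 * (- fst v)" using left right by (simp_all add: la_def g2 v'_def)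
  then have "g1 * fst v = 0" by simp
  then have "g1 = 0" using v1 by simp
  then have "g q = g cc" for q using g(1) g2 by simp
  then show False using gq g(2) by (metis less_irrefl)
qed

text \<open>Before the first edge time the segments of \<open>chain_F\<close> avoid the axis.
Afterwards a hit is at \<open>cc\<close>, where \<open>fold\<close> applies, or excluded by
\<open>second_axis\<close> and \<open>left_hit\<close>, or it is on the stable line of
\<open>X\<close> and thus equal to \<open>V\<close>.\<close>
lemma axis_hit:
  assumes s: "s0 < s" "s < 1" and ln: "land n s" and fi: "\<And>m. m < n \<Longrightarrow> \<not> land m s"
    and j: "j \<le> n" and z: "fst (F j s) = 0"
  shows "\<exists>i. F i s = Vp"
proof -
  have s01: "0 < s" "s \<le> 1" "s0 \<le> s" using s s0 by auto
  have ps: "0 < par s" "par s < 1" using s s0 by (auto simp: par_def divide_simps)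
  obtain t r m s' where tr: "n = t + r \<and> pf ((brL ^^ r) (F t s)) = 0 \<or>
      n = t + r + 1 \<and> pf ((brL ^^ Suc r) (F t s)) = 0 \<and> stays_left (Suc r) (F t s)"
    "even r" "fresh (F t s)" "stays_left r (F t s)" "ctooth ((brL ^^ r) (F t s))"
    "s0 \<le> s'" "s' \<le> 1" "F t s = F m s'" "edge_point m (F t s) s'"
    using landing[OF s01(1,2) ln fi] by metis
  have "t = m" "s = s'" using track[OF s tr(6,7,8)] by auto
  then have ed: "edge_point t (F t s) s" using tr(9) by simp
  have sgt: "0 < sg (F t s)" using fresh_sg[OF tr(3), of 0] by simp
  have jge: "2 * k + 1 \<le> j"
  proof (rule ccontr)
    assume "\<not> 2 * k + 1 \<le> j"
    then have jk: "j \<le> 2 * k" by simp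
    show False
    proof (cases "even j")
      case True
      then obtain i where i: "j = 2 * i" by (elim evenE)
      have "F j s = (1 - par s) *\<^sub>R ze i + par s *\<^sub>R zm i"
        using chain_F(1)[OF s01(3,2), of i] chain_mono[OF ch, of i] zz_pos(1)[of i] i jk by simp
      moreover have "fst (ze i) \<le> 0" using ze_nonpos chain_mono[OF ch, of i] i jk by simp
      moreover have "fst (zm i) < 0" using zz_pos(2)[of i] i jk by simp
      ultimately have "fst (F j s) < 0" using ps by (simp add: add_nonpos_neg mult_nonneg_nonpos mult_pos_neg)
      then show False using z by simp
    next
      case False
      then obtain i where i: "j = Suc (2 * i)" by (metis oddE Suc_eq_plus1)
      have "F j s = (1 - par s) *\<^sub>R zz i + par s *\<^sub>R zz (Suc i)"
        using chain_F(2)[OF s01(3,2), of i] chain_mono[OF ch, of i] zz_pos[of i] i jk by simp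
      moreover have "0 < fst (zz i)" "0 < fst (zz (Suc i))" using zz_pos(1)[of i] zz_pos(1)[of "Suc i"] i jk by simp_all
      ultimately have "0 < fst (F j s)" using ps by (simp add: add_pos_pos)
      then show False using z by simp
    qed
  qed
  show ?thesis
  proof (cases "j = n")
    case True
    then show ?thesis using Vp_iff[of "F n s"] ln z by (auto simp: land_def)
  next
    case False
    then have jn: "j < n" using j by simp
    have ccase: ?thesis if c: "F (2 * k + 1) s = cc"
    proof (cases "pf cc = 0")
      case True then show ?thesis using c Vp_iff[of cc] fst_cc by metis
    next
      case False
      then have pc: "0 < pf cc" using pf_cc(1) by simp
      have "par s = th"
      proof -
        have "zz k + par s *\<^sub>R uu k = cc" using c F_edge1 s01 by simp
        then show ?thesis using fst_line_th[of "par s"] fst_line_th'[of "par s"] fst_cc by simp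
      qed
      then have th1: "th < 1" using ps by simp
      have "\<exists>r'. even r' \<and> 2 \<le> r' \<and> stays_left r' cc \<and> ctooth ((brL ^^ r') cc) \<and>
          (pf ((brL ^^ r') cc) = 0 \<or> pf ((brL ^^ Suc r') cc) = 0 \<and> stays_left (Suc r') cc) \<and> fst (brL cc) < 0 \<and>
          F (2 * k + 1 + r') s = (brL ^^ r') cc"
        using ed unfolding edge_point_def
      proof (elim disjE)
        assume a: "t = 2 * k + 1 \<and> dl k (F t s) = 0 \<and> fst (F t s) \<le> 0"
        then have Ft: "F t s = cc" using c by simp
        have "r \<noteq> 0" using tr(5) pc unfolding Ft by (intro notI) (simp add: ctooth_def)
        then have r2: "2 \<le> r" using tr(2) by presburger
        have "fst ((brL ^^ 1) cc) \<le> 0" using stays_leftD[OF tr(4), of 1] r2 unfolding Ft by simp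
        moreover have "fst ((brL ^^ 1) cc) \<noteq> 0"
          using left_hit[OF tr(2,4) sgt tr(5), of 1] r2 tr(2) unfolding Ft by auto
        ultimately have "fst (brL cc) < 0" by simp
        then show ?thesis using tr(1,2,4,5) r2 F_gen[OF tr(4), of r] a unfolding Ft by (intro exI[of _ r]) auto
      next
        assume a: "t = 2 * k + 3 \<and> dl (Suc k) (F t s) = 0 \<and> 0 \<le> fst (F (2 * k + 1) s) \<and> fst (F (2 * k + 2) s) \<le> 0"
        have F2: "F (2 * k + 2) s = brL cc" using c fst_cc F_Suc[of "2 * k + 1"] by (simp add: stp_L)
        have Ft: "F t s = (brL ^^ Suc (Suc 0)) cc" using a F2 F_Suc[of "2 * k + 2"] by (simp add: stp_L numeral_3_eq_3)
        have sn: "snd (F t s) = fst (brL cc)" by (simp add: Ft)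
        then have neg: "fst (brL cc) < 0" using tr(3) by (simp add: fresh_def)
        have it: "(brL ^^ i) ((brL ^^ Suc (Suc 0)) cc) = (brL ^^ Suc (Suc i)) cc" for i by (simp add: funpow_swap1)
        have gg: "stays_left (Suc (Suc i)) cc" if "stays_left i (F t s)" for i unfolding stays_left_def
        proof (intro allI impI)
          fix j assume j: "j < Suc (Suc i)"
          consider "j = 0" | "j = 1" | i' where "j = Suc (Suc i')" "i' < i" using j
            by (metis Suc_less_eq less_Suc_eq_0_disj One_nat_def)
          then show "fst ((brL ^^ j) cc) \<le> 0"
          proof cases
            case 3
            then show ?thesis using that it[of i'] unfolding stays_left_def Ft by (metis)
          qed (use neg fst_cc in auto)
        qed
        have "F (t + r) s = (brL ^^ r) (F t s)" using F_gen[OF tr(4), of r] by simp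
        then have "F (2 * k + 1 + Suc (Suc r)) s = (brL ^^ Suc (Suc r)) cc"
          using a it[of r] unfolding Ft by (simp add: numeral_3_eq_3 del: funpow.simps)
        then show ?thesis using tr(1,2,5) gg[OF tr(4)] gg[of "Suc r"] neg it[of r] it[of "Suc r"] unfolding Ft
          by (intro exI[of _ "Suc (Suc r)"]) (auto simp del: funpow.simps)
      qed
      then obtain r' where r': "even r'" "2 \<le> r'" "stays_left r' cc" "ctooth ((brL ^^ r') cc)"
          "pf ((brL ^^ r') cc) = 0 \<or> pf ((brL ^^ Suc r') cc) = 0 \<and> stays_left (Suc r') cc" "fst (brL cc) < 0"
          "F (2 * k + 1 + r') s = (brL ^^ r') cc" by blast
      then have "F (2 * k + 1 + r') s = Vp" using fold[OF th1 r'(1-4,6,5)] by simp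
      then show ?thesis by blast
    qed
    have cc_of: "F (2 * k + 1) s = cc" if "fst (F (2 * k + 1) s) = 0"
    proof -
      have f: "F (2 * k + 1) s = zz k + par s *\<^sub>R uu k" using F_edge1 s01 by simp
      then have "par s = th" using fst_line_th[of "par s"] fst_line_th'[of "par s"] that by simp
      then show ?thesis using f by (simp add: cc_def)
    qed
    have late: ?thesis if "j = t + r"
    proof -
      have Fj: "F j s = (brL ^^ r) (F t s)" using F_gen[OF tr(4), of r] that by simp
      have "pf ((brL ^^ Suc r) (F t s)) = 0" using tr(1) jn that by auto
      then have "pf (F j s) = 0" using z u1 unfolding Fj by (simp add: pf_brL)
      then show ?thesis using Vp_iff z by blast
    qed
    have mid: ?thesis if "t < j"
    proof -
      define j' where "j' = j - t"
      have j': "j = t + j'" "1 \<le> j'" "j' \<le> r" using that jn tr(1) by (auto simp: j'_def)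
      have "fst ((brL ^^ j') (F t s)) = 0" using z F_gen[OF tr(4) j'(3)] j'(1) by simp
      then have "j' = r" using left_hit[OF tr(2,4) sgt tr(5) j'(2,3)] by simp
      then show ?thesis using late j'(1) by simp
    qed
    show ?thesis using ed unfolding edge_point_def
    proof (elim disjE)
      assume a: "t = 2 * k + 1 \<and> dl k (F t s) = 0 \<and> fst (F t s) \<le> 0"
      show ?thesis
      proof (cases "j = 2 * k + 1")
        case True then show ?thesis using ccase cc_of z by simp
      next
        case False then show ?thesis using mid a jge by simp
      qed
    next
      assume a: "t = 2 * k + 3 \<and> dl (Suc k) (F t s) = 0 \<and> 0 \<le> fst (F (2 * k + 1) s) \<and> fst (F (2 * k + 2) s) \<le> 0"
      consider "j = 2 * k + 1" | "j = 2 * k + 2" | "j = 2 * k + 3" | "t < j" using jge a by linarith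
      then show ?thesis
      proof cases
        case 1 then show ?thesis using ccase cc_of z by simp
      next
        case 2
        then have "snd (F t s) = 0" using a z F_Suc[of "2 * k + 2" s] by (simp add: numeral_3_eq_3)
        then show ?thesis using tr(3) by (simp add: fresh_def)
      next
        case 3
        have t3: "t = 2 * k + 3" using a by simp
        have "r = 0" by (rule second_axis[OF s refl _ _ _ tr(2)]) (use a z 3 tr(3,4,5) t3 in simp_all)
        then show ?thesis using late 3 a by simp
      next
        case 4 then show ?thesis by (rule mid)
      qed
    qed
  qed
qed

end

section \<open>Landing times\<close>

context lozi_uv begin

text \<open>Let \<open>J\<close> be the first index with \<open>Sb J \<le> 0\<close>. Either the
corners alternate up to \<open>J\<close>, and then the next one is in the hull of the previous
ones, or the alternation stops earlier, in the right or in the left half plane.\<close>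
lemma trichotomy:
  assumes N0: "Sb N0 \<le> 0" "1 \<le> N0"
  shows "(\<exists>K. 1 \<le> K \<and> K \<le> N0 \<and> chain K \<and> (\<forall>j\<le>K. 0 < fst (zz j)) \<and>
      (fst (zm K) < 0 \<longrightarrow> zz (Suc K) \<in> convex hull (zz ` {..K}))) \<or>
    (\<exists>k<N0. chain (Suc k) \<and> fst (zz (Suc k)) \<le> 0 \<and> (\<forall>N. 1 \<le> N \<longrightarrow> N \<le> k \<longrightarrow> 0 < Sb N))"
proof -
  define J where "J = (LEAST N. 1 \<le> N \<and> Sb N \<le> 0)"
  have J: "1 \<le> J" "Sb J \<le> 0" using LeastI[of "\<lambda>N. 1 \<le> N \<and> Sb N \<le> 0" N0] N0 by (auto simp: J_def)
  have JN: "J \<le> N0" unfolding J_def using N0 by (intro Least_le) simp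
  have Jm: "0 < Sb N" if "1 \<le> N" "N < J" for N
    using not_less_Least[of N "\<lambda>N. 1 \<le> N \<and> Sb N \<le> 0"] that by (auto simp: J_def)
  show ?thesis
  proof (cases "chain (Suc J)")
    case True
    have c: "chain J" "\<forall>j\<le>J. 0 < fst (zz j)" "fst (zm J) < 0" using True by (auto simp: chain_def)
    have "qf (zm J) \<le> 0" using qf_zz[OF c(1)] l0 by (simp add: zm_def qf_brR mult_le_0_iff)
    then have "0 \<le> - (mm * l) * qf (zm J)" using mm0 l0 by (intro mult_nonpos_nonpos) auto
    then have "0 \<le> dl 0 (zz (Suc J))" by (simp add: zz_Suc' dl_0_brL)
    then have "zz (Suc J) \<in> convex hull (zz ` {..J})" using hull_spiral[of J] Jm J by simp
    then show ?thesis using c J JN by blast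
  next
    case False
    define i where "i = (LEAST m. \<not> (0 < fst (zz m) \<and> fst (zm m) < 0))"
    obtain m0 where m0: "m0 < Suc J" "\<not> (0 < fst (zz m0) \<and> fst (zm m0) < 0)" using False by (auto simp: chain_def)
    have i: "\<not> (0 < fst (zz i) \<and> fst (zm i) < 0)"
      unfolding i_def by (rule LeastI[of "\<lambda>m. \<not> (0 < fst (zz m) \<and> fst (zm m) < 0)", OF m0(2)])
    have im: "i \<le> m0" unfolding i_def using m0(2) by (rule Least_le)
    have ci: "0 < fst (zz m) \<and> fst (zm m) < 0" if "m < i" for m
      using not_less_Least[of m "\<lambda>m. \<not> (0 < fst (zz m) \<and> fst (zm m) < 0)"] that unfolding i_def by blast
    have ch: "chain i" using ci by (simp add: chain_def)
    have "0 < fst (zz 0) \<and> fst (zm 0) < 0" using zm0_neg fst_Zp by (simp add: zz_0)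
    then have i1: "1 \<le> i" using i by (cases i) auto
    show ?thesis
    proof (cases "0 < fst (zz i)")
      case True
      then have "\<forall>j\<le>i. 0 < fst (zz j)" using ci by (auto simp: le_less)
      then show ?thesis using i True ch i1 im m0(1) JN by (intro disjI1 exI[of _ i]) auto
    next
      case False
      obtain k where k: "i = Suc k" using i1 by (cases i) auto
      then show ?thesis using False ch im m0(1) JN Jm by (intro disjI2 exI[of _ k]) auto
    qed
  qed
qed

lemma zz_F1: assumes "chain (Suc j)" shows "zz (Suc j) = F (Suc (2 * j)) 1"
  using chain_F(2)[of 1 j] s0 par(2) chain_mono[OF assms, of j] chainD[OF assms, of j] by simp

lemma pf_zz: assumes nc: "no_crossing B" and B: "2 * j \<le> B" and ch: "chain j" and p: "0 < fst (zz j)"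
  shows "0 \<le> pf (zz j)"
proof (cases j)
  case 0 then show ?thesis using pf_Zp by (simp add: zz_0)
next
  case (Suc i)
  have z: "zz j = F (Suc (2 * i)) 1" using zz_F1 ch Suc by simp
  then have nt: "\<not> tooth (zz j)" using F_not_tooth[OF nc, of "Suc (2 * i)" 1] B Suc by simp
  have "0 < hh (zz j)" "snd (zz j) < 0"
    using chainD[OF ch, of i] b0 Suc by (simp_all add: zz_Suc hh_G) (simp add: G_def zm_def)
  then have sg: "0 < sg (zz j)" using sg_of_hh by simp
  show ?thesis
  proof (rule ccontr)
    assume "\<not> 0 \<le> pf (zz j)"
    then have "0 < pf (stp (zz j))" using p u1 by (simp add: pf_stp_R mult_less_0_iff zero_less_mult_iff)
    then show False using nt sg by (simp add: tooth_iff)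
  qed
qed

lemma land_Suc: assumes "land n s" shows "land (Suc n) s" "0 < fst (F (Suc n) s)"
proof -
  let ?p = "F n s"
  have z: "0 \<le> fst ?p" "pf ?p = 0" using assms by (auto simp: land_def)
  have e: "F (Suc n) s = brR ?p" using z by (simp add: F_Suc stp_R)
  have "pf (brR ?p) = 0" using z by (simp add: pf_brR)
  then have "fst (brR ?p) = l * fst ?p + 1 / (1 + u)" by (simp add: pf_def)
  moreover have "0 < 1 / (1 + u)" "0 \<le> l * fst ?p" using u1 l0 z by simp_all
  ultimately show "0 < fst (F (Suc n) s)" unfolding e by linarith
  then show "land (Suc n) s" using \<open>pf (brR ?p) = 0\<close> by (simp add: land_def e)
qed
lemma land_mono: assumes "land n s" "n \<le> m" shows "land m s"
  using assms(2,1) by (induction rule: dec_induct) (auto intro: land_Suc)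
lemma land_after: assumes "land n s" "n < m" shows "0 < fst (F m s)"
  using land_Suc(2)[OF land_mono[OF assms(1), of "m - 1"]] assms(2) by simp

text \<open>A lower bound for the distance from the stable line of \<open>Y\<close>, along which
an orbit could stay in the left half plane for an arbitrarily long time.\<close>
definition tau_bound where "tau_bound e M \<longleftrightarrow> (\<forall>n\<le>M. odd n \<longrightarrow> (\<forall>s\<in>{0..1}. fst (F n s) \<le> 0 \<longrightarrow> e \<le> tau (F n s)))"

lemma stays_left_bound:
  assumes e: "0 < e" "e \<le> tau p" and d: "dY < u ^ Nn * e" and g: "stays_left n p" "even n" and s: "0 \<le> sg p"
  shows "n \<le> Nn"
proof (cases "n = 0")
  case False
  then have "2 \<le> n" using g(2) by presburger
  then obtain i where i: "n = Suc (Suc i)" by (metis add_2_eq_Suc le_Suc_ex)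
  have f: "fst ((brL ^^ i) p) \<le> 0" using stays_leftD[OF g(1), of i] i by simp
  have "0 \<le> (- l) ^ i * sg p" using s g(2) i by (simp add: zero_le_even_power)
  then have "0 \<le> l * sg ((brL ^^ i) p)" using l0 by (simp add: sg_iter)
  moreover have "(u + l) * fst ((brL ^^ i) p) \<le> 0" using f u1 l0 by (simp add: mult_le_0_iff)
  ultimately have "u * tau ((brL ^^ i) p) \<le> dY" unfolding fst_tau_sg by linarith
  then have "u ^ Suc i * tau p \<le> dY" by (simp add: tau_iter mult.assoc)
  moreover have "u ^ Suc i * e \<le> u ^ Suc i * tau p" using e u1 by (intro mult_left_mono) auto
  ultimately have "u ^ Suc i * e < u ^ Nn * e" using d by linarith
  then have "u ^ Suc i < u ^ Nn" using e by simp
  then have "Suc i < Nn" using u1 power_strict_increasing_iff by blast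
  then show ?thesis using i by simp
qed simp

lemma tooth_gen_sg: assumes "even n" "0 \<le> sg ((brL ^^ n) p)" shows "0 \<le> sg p"
proof -
  have "0 < (- l) ^ n" using assms(1) l0 by (simp add: zero_less_power_eq)
  then show ?thesis using assms(2) by (simp add: sg_iter zero_le_mult_iff)
qed

text \<open>Long stays in the left half plane are excluded by the bound on \<open>tau\<close>,
and short ones concern only finitely many curves.\<close>
lemma C_of_tau_bound:
  assumes nc: "no_crossing B" and B: "2 * N0 + 2 + Nn \<le> B" and te: "tau_bound e (2 * N0 + 1)" "0 < e" "dY < u ^ Nn * e"
    and k: "k < N0" "chain (Suc k)" "fst (zz (Suc k)) \<le> 0" "\<forall>N. 1 \<le> N \<longrightarrow> N \<le> k \<longrightarrow> 0 < Sb N"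
  shows "lozi_C u l k"
proof unfold_locales
  show "chain (Suc k)" "fst (zz (Suc k)) \<le> 0" "\<And>N. 1 \<le> N \<Longrightarrow> N \<le> k \<Longrightarrow> 0 < Sb N" using k by auto
  fix s m n assume s: "s0 \<le> s" "s \<le> 1" and m: "m = 2 * k + 1 \<or> m = 2 * k + 3" and n: "even n"
    and g: "\<And>j. j < n \<Longrightarrow> fst (F (m + j) s) \<le> 0"
  have s0s: "0 \<le> s" using s s0 by simp
  have it: "j \<le> n \<Longrightarrow> F (m + j) s = (brL ^^ j) (F m s)" for j
  proof (induction j)
    case (Suc j) then show ?case using g[of j] by (simp add: F_Suc stp_L)
  qed simp
  have gn: "stays_left n (F m s)" unfolding stays_left_def using g it by (metis less_imp_le)
  show "\<not> tooth (F (m + n) s)"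
  proof
    assume t: "tooth (F (m + n) s)"
    then have "0 \<le> sg ((brL ^^ n) (F m s))" using it[of n] by (simp add: tooth_def)
    then have sp: "0 \<le> sg (F m s)" using tooth_gen_sg n by blast
    have "n \<le> Nn"
    proof (cases "n = 0")
      case False
      then have "fst (F m s) \<le> 0" using g[of 0] by simp
      moreover have "m \<le> 2 * N0 + 1" "odd m" using m k by auto
      ultimately have "e \<le> tau (F m s)" using te(1) s s0s unfolding tau_bound_def by simp
      then show ?thesis using stays_left_bound[OF te(2) _ te(3) gn n sp] by simp
    qed simp
    then have "Suc (m + n) \<le> B" using m k B by auto
    then show False using F_not_tooth[OF nc _ s0s s(2)] t by blast
  qed
qed

text \<open>In the trapped cases the orbit lands in a corner, whose time is known. Otherwise the
left phase that ends with the landing starts on one of the two edges, and its length is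
controlled by \<open>tau\<close>.\<close>
lemma land_bound:
  assumes N0: "Sb N0 \<le> 0" "1 \<le> N0" and nc: "no_crossing B" and B: "2 * N0 + 2 + Nn \<le> B"
    and te: "tau_bound e (2 * N0 + 1)" "0 < e" "dY < u ^ Nn * e"
    and s: "s0 < s" "s \<le> 1" and ln: "land n0 s"
  shows "land (2 * N0 + 2 + Nn) s"
proof -
  define n where "n = (LEAST n. land n s)"
  have n: "land n s" unfolding n_def using ln by (rule LeastI)
  have fi: "\<not> land m s" if "m < n" for m using not_less_Least that unfolding n_def by blast
  have s': "0 < s" using s s0 by simp
  have "n \<le> 2 * N0 + 2 + Nn"
    using trichotomy[OF N0]
  proof (elim disjE exE conjE)
    fix K assume K: "1 \<le> K" "K \<le> N0" "chain K" "\<forall>j\<le>K. 0 < fst (zz j)"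
      "fst (zm K) < 0 \<longrightarrow> zz (Suc K) \<in> convex hull (zz ` {..K})"
    have "0 \<le> pf (zz j)" if "j \<le> K" for j
      using pf_zz[OF nc, of j] chain_mono[OF K(3) that] K that B by simp
    then have "F n s = zz K" using hull_trap(2)[OF K(1,3) _ _ _ s(2) s' n fi] K s' by simp
    moreover obtain i where "K = Suc i" using K(1) by (cases K) auto
    ultimately have "F n s = F (Suc (2 * i)) 1" using zz_F1 K(3) by simp
    then have "n \<le> Suc (2 * i)" using track_le[OF s, of 1] s0 by simp
    then show ?thesis using \<open>K = Suc i\<close> K by simp
  next
    fix k assume k: "k < N0" "chain (Suc k)" "fst (zz (Suc k)) \<le> 0" "\<forall>N. 1 \<le> N \<longrightarrow> N \<le> k \<longrightarrow> 0 < Sb N"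
    interpret C: lozi_C u l k by (rule C_of_tau_bound[OF nc B te k])
    obtain t r m s' where tr: "n = t + r \<and> pf ((brL ^^ r) (F t s)) = 0 \<or>
        n = t + r + 1 \<and> pf ((brL ^^ Suc r) (F t s)) = 0 \<and> stays_left (Suc r) (F t s)"
      "even r" "C.fresh (F t s)" "stays_left r (F t s)" "ctooth ((brL ^^ r) (F t s))"
      "s0 \<le> s'" "s' \<le> 1" "F t s = F m s'" "C.edge_point m (F t s) s'"
      using C.landing[OF s' s(2) n fi] by metis
    have m: "m \<le> 2 * N0 + 1" "odd m" using tr(9) k(1) by (auto simp: C.edge_point_def)
    have t: "t \<le> m" using track_le[OF s tr(6,7,8)] .
    have "r \<le> Nn"
    proof (cases "r = 0")
      case False
      then have "fst (F m s') \<le> 0" using stays_leftD[OF tr(4), of 0] tr(8) by simp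
      then have "e \<le> tau (F t s)" using te(1) m tr(6-8) s0 unfolding tau_bound_def by auto
      moreover have "0 \<le> sg (F t s)" using C.fresh_sg[OF tr(3), of 0] by simp
      ultimately show ?thesis using stays_left_bound[OF te(2) _ te(3) tr(4,2)] by simp
    qed simp
    then show ?thesis using tr(1) t m by auto
  qed
  then show ?thesis using land_mono n by blast
qed

lemma C_of_no_crossing:
  assumes nc: "\<And>B. no_crossing B" and k: "chain (Suc k)" "fst (zz (Suc k)) \<le> 0" "\<forall>N. 1 \<le> N \<longrightarrow> N \<le> k \<longrightarrow> 0 < Sb N"
  shows "lozi_C u l k"
proof unfold_locales
  show "chain (Suc k)" "fst (zz (Suc k)) \<le> 0" "\<And>N. 1 \<le> N \<Longrightarrow> N \<le> k \<Longrightarrow> 0 < Sb N" using k by auto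
  fix s m n assume s: "s0 \<le> s" "s \<le> 1"
  then show "\<not> tooth (F (m + n) s)" using F_not_tooth[OF nc[of "Suc (m + n)"], of "m + n" s] s0 by simp
qed

end

context lozi_C begin

text \<open>Otherwise \<open>tau\<close> takes small positive values on the crossing edge. A
point where it equals \<open>tau be / u ^ n\<close> with large even \<open>n\<close> passes
close to \<open>Y\<close> and arrives after \<open>n\<close> steps near the point
\<open>be\<close> on the boundary of the tooth, on its inner side.\<close>
lemma tau_z_pos: "0 < tau (zz (Suc k))"
proof (rule ccontr)
  assume neg: "\<not> 0 < tau (zz (Suc k))"
  obtain be where be: "sg be = 0" "fst be < 0" "pf be < 0" "0 < pf (brL be)" using beta by blast
  define ts where "ts = tau be"
  have ul: "0 < u + l" using u1 l0 by simp
  have t1: "u * ts < dY"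
  proof -
    have "(u + l) * fst be < 0" using be ul by (simp add: mult_pos_neg)
    then show ?thesis using fst_tau_sg[of be] be by (simp add: ts_def)
  qed
  have t0: "0 < ts"
  proof -
    have "0 < fst (stp be)" by (rule fst_stp_pos) (use be in \<open>auto simp: stp_L\<close>)
    then have "0 < (u + l) * fst (brL be)" using be ul by (simp add: stp_L)
    then have "dY < u * (u * ts)" using fst_tau_sg[of "brL be"] be by (simp add: ts_def sg_brL tau_brL)
    then have "0 < u * (u * ts)" using dY0 by linarith
    then show ?thesis using u1 by (simp add: zero_less_mult_iff)
  qed
  \<comment> \<open>With these bounds the target value of tau is attained on the edge, the orbit stays in the left half plane, and the endpoint is in the tooth.\<close>
  define e1 where "e1 = min (tau cc / ts) ((dY - l\<^sup>2 * dY) / (u * ts))"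
  define e2 where "e2 = min ((dY - u * ts) / dY) (min ((- pf be) * l / dY) (pf (brL be) * l / (u * dY)))"
  have l2: "l\<^sup>2 < 1" using l0 l1 by (simp add: power_less_one_iff)
  have "0 < (1 - l\<^sup>2) * dY" using l2 dY0 by simp
  then have "0 < e1" using tau_cc t0 u1 by (simp add: e1_def algebra_simps)
  moreover have "1 / u < 1" using u1 by simp
  ultimately obtain N1 where N1: "(1 / u) ^ N1 < e1" using real_arch_pow_inv by blast
  have "0 < e2" using t1 dY0 be l0 u1 by (auto simp: e2_def mult_neg_pos divide_neg_pos)
  then obtain N2 where N2: "l ^ N2 < e2" using real_arch_pow_inv l1 by blast
  define N where "N = max 1 (max N1 N2)"
  define n where "n = 2 * N"
  have evn: "even n" by (simp add: n_def)
  have pu: "(1 / u) ^ i < e1" if "N \<le> i" for i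
  proof -
    have "(1 / u) ^ i \<le> (1 / u) ^ N1" using u1 that by (intro power_decreasing) (auto simp: N_def)
    then show ?thesis using N1 by simp
  qed
  have pl: "l ^ i < e2" if "N \<le> i" for i
  proof -
    have "l ^ i \<le> l ^ N2" using l0 l1 that by (intro power_decreasing) (auto simp: N_def)
    then show ?thesis using N2 by simp
  qed
  have A: "ts * (1 / u) ^ i < tau cc" "u * (ts * (1 / u) ^ i) < dY - l\<^sup>2 * dY" if "N \<le> i" for i
  proof -
    have 1: "(1 / u) ^ i < tau cc / ts" "(1 / u) ^ i < (dY - l\<^sup>2 * dY) / (u * ts)" using pu[OF that] by (auto simp: e1_def)
    show "ts * (1 / u) ^ i < tau cc" using 1(1) t0 by (simp only: pos_less_divide_eq mult.commute)
    have "0 < u * ts" using t0 u1 by simp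
    then have "(1 / u) ^ i * (u * ts) < dY - l\<^sup>2 * dY" using 1(2) by (simp only: pos_less_divide_eq)
    then show "u * (ts * (1 / u) ^ i) < dY - l\<^sup>2 * dY" by (simp only: ac_simps)
  qed
  have Bl: "l ^ i * dY < dY - u * ts" "l ^ i * dY < (- pf be) * l" "u * (l ^ i * dY) < pf (brL be) * l" if "N \<le> i" for i
  proof -
    have 1: "l ^ i < (dY - u * ts) / dY" "l ^ i < (- pf be) * l / dY" "l ^ i < pf (brL be) * l / (u * dY)"
      using pl[OF that] by (auto simp: e2_def)
    show "l ^ i * dY < dY - u * ts" "l ^ i * dY < (- pf be) * l" using 1(1,2) dY0 by (simp_all only: pos_less_divide_eq)
    have "0 < u * dY" using dY0 u1 by simp
    then have "l ^ i * (u * dY) < pf (brL be) * l" using 1(3) by (simp only: pos_less_divide_eq)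
    then show "u * (l ^ i * dY) < pf (brL be) * l" by (simp only: ac_simps)
  qed
  define f where "f x = tau (zz k + x *\<^sub>R uu k)" for x
  have "\<exists>x. th \<le> x \<and> x \<le> 1 \<and> f x = ts * (1 / u) ^ n"
  proof (rule IVT2')
    have "f 1 = tau (zz (Suc k))" by (simp add: f_def uu_def)
    then have "f 1 \<le> 0" using neg by simp
    moreover have "0 < ts * (1 / u) ^ n" using t0 u1 by simp
    ultimately show "f 1 \<le> ts * (1 / u) ^ n" by linarith
    show "ts * (1 / u) ^ n \<le> f th" using A(1)[of n] by (simp add: f_def cc_def[symmetric] n_def)
    show "th \<le> 1" by (rule th)
    show "continuous_on {th..1} f" unfolding f_def tau_def by (intro continuous_intros)
  qed
  then obtain x where x: "th \<le> x" "x \<le> 1" "tau (zz k + x *\<^sub>R uu k) = ts * (1 / u) ^ n" by (auto simp: f_def)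
  define p where "p = zz k + x *\<^sub>R uu k"
  have tp: "tau p = ts * (1 / u) ^ n" using x by (simp add: p_def)
  have fp: "fst p \<le> 0"
  proof -
    have "x * fst (uu k) \<le> th * fst (uu k)" using x al_neg by (intro mult_right_mono_neg) auto
    then show ?thesis using fst_cc by (simp add: p_def cc_def)
  qed
  have hp: "0 < hh p"
  proof -
    have h: "0 < hh (zz j)" if "j \<le> Suc k" for j
    proof (cases j)
      case 0
      have "1 < 1 / (1 - l)" using l0 l1 by simp
      then show ?thesis by (simp add: 0 zz_0 hh_def Zp_def)
    next
      case (Suc i) then show ?thesis using zz_pos(1)[of i] b0 that by (simp add: zz_Suc hh_G)
    qed
    have "p = (1 - x) *\<^sub>R zz k + x *\<^sub>R zz (Suc k)" by (simp add: p_def uu_def algebra_simps)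
    then have "hh p = (1 - x) * hh (zz k) + x * hh (zz (Suc k))" by (simp only: hh_aff)
    moreover have "0 < x * hh (zz (Suc k))" using h[of "Suc k"] x th by simp
    moreover have "0 \<le> (1 - x) * hh (zz k)" using h[of k] x by simp
    ultimately show ?thesis by linarith
  qed
  have sp: "0 < sg p" using sg_of_hh[of p] snd_of_hh[of p] hp fp by simp
  have lsp: "l * sg p \<le> dY"
  proof -
    have "(u + l) * fst p \<le> 0" using fp ul by (simp add: mult_le_0_iff)
    moreover have "0 \<le> u * tau p" using tp t0 u1 by simp
    ultimately show ?thesis using fst_tau_sg[of p] by linarith
  qed
  have tj: "tau ((brL ^^ j) p) = ts * (1 / u) ^ (n - j)" if "j \<le> n" for j
  proof -
    have "n = j + (n - j)" using that by simp
    then have "(1 / u) ^ n = (1 / u) ^ j * (1 / u) ^ (n - j)" by (metis power_add)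
    moreover have "u ^ j * (1 / u) ^ j = 1" using u1 by (simp add: power_divide)
    moreover have "u ^ j * (ts * ((1 / u) ^ j * (1 / u) ^ (n - j))) = (u ^ j * (1 / u) ^ j) * (ts * (1 / u) ^ (n - j))"
      by (simp only: ac_simps)
    ultimately show ?thesis unfolding tau_iter tp by simp
  qed
  have gp: "stays_left n p" unfolding stays_left_def
  proof (intro allI impI)
    fix j assume j: "j < n"
    let ?q = "(brL ^^ j) p"
    have tle: "tau ?q \<le> ts"
    proof -
      have "(1 / u) ^ (n - j) \<le> 1" using u1 by (intro power_le_one) auto
      then show ?thesis using tj[of j] j t0 by (simp add: mult_left_le)
    qed
    have "(u + l) * fst ?q \<le> 0"
    proof (cases "even j")
      case False
      then have "(- l) ^ j < 0" using l0 by simp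
      then have "sg ?q < 0" using sp by (simp add: sg_iter mult_neg_pos)
      then have "l * sg ?q < 0" using l0 by (simp add: mult_pos_neg)
      moreover have "u * tau ?q \<le> u * ts" using tle u1 by simp
      ultimately show ?thesis unfolding fst_tau_sg using t1 by linarith
    next
      case True
      show ?thesis
      proof (cases "j = 0")
        case True then show ?thesis using fp ul by (simp add: mult_le_0_iff)
      next
        case False
        then have j2: "2 \<le> j" using True by presburger
        have "sg ?q = l ^ j * sg p" using True by (simp add: sg_iter)
        then have "l * sg ?q = l ^ j * (l * sg p)" by simp
        also have "\<dots> \<le> l ^ j * dY" using lsp l0 by (intro mult_left_mono) auto
        finally have S: "l * sg ?q \<le> l ^ j * dY" .
        show ?thesis
        proof (cases "N \<le> j")
          case True
          have "u * tau ?q \<le> u * ts" using tle u1 by simp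
          then show ?thesis unfolding fst_tau_sg using S Bl(1)[OF True] by linarith
        next
          case False
          have "l ^ j \<le> l\<^sup>2" using j2 l0 l1 by (intro power_decreasing) auto
          then have "l ^ j * dY \<le> l\<^sup>2 * dY" using dY0 by (intro mult_right_mono) auto
          moreover have "N \<le> n - j" using False by (simp add: n_def)
          ultimately show ?thesis unfolding fst_tau_sg using S A(2)[of "n - j"] tj[of j] j by simp
        qed
      qed
    qed
    then show "fst ?q \<le> 0" using ul by (simp add: mult_le_0_iff)
  qed
  define q where "q = (brL ^^ n) p"
  define S where "S = sg q"
  have S: "S = l ^ n * sg p" using evn by (simp add: S_def q_def sg_iter)
  have S0: "0 < S" using sp l0 by (simp add: S)
  have lS: "l * S \<le> l ^ n * dY"
  proof -
    have "l * S = l ^ n * (l * sg p)" by (simp add: S)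
    also have "\<dots> \<le> l ^ n * dY" using lsp l0 by (intro mult_left_mono) auto
    finally show ?thesis .
  qed
  have Nn: "N \<le> n" by (simp add: n_def)
  have "S * l < (- pf be) * l" "u * S * l < pf (brL be) * l"
  proof -
    show "S * l < (- pf be) * l" using lS Bl(2)[OF Nn] by (simp add: mult.commute)
    have "u * (l * S) \<le> u * (l ^ n * dY)" using lS u1 by (intro mult_left_mono) auto
    then show "u * S * l < pf (brL be) * l" using Bl(3)[OF Nn] by (simp add: ac_simps)
  qed
  then have Sb: "S < - pf be" "u * S < pf (brL be)" using mult_less_cancel_right_pos[OF l0] by blast+
  have tq: "tau q = tau be" using tj[of n] by (simp add: q_def ts_def)
  define dx where "dx = fst q - fst be"
  have dx: "(u + l) * dx = l * S" using fst_tau_sg[of q] fst_tau_sg[of be] tq be by (simp add: dx_def S_def algebra_simps)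
  have dxp: "0 < dx" using dx S0 l0 ul by (metis mult_pos_pos zero_less_mult_pos)
  have dx2: "2 * dx \<le> S"
  proof -
    have "2 * l * dx \<le> (u + l) * dx" using dxp lu by (intro mult_right_mono) auto
    then have "l * (2 * dx) \<le> l * S" using dx by (simp add: ac_simps)
    then show ?thesis using l0 by simp
  qed
  have "l * snd q - l * snd be = - dx" using tq by (simp add: tau_def dx_def)
  then have pq: "pf q = pf be + 2 * dx" by (simp add: pf_def dx_def)
  have "pf (brL q) = pf (brL be) - 2 * u * dx + 2 * a * dx" unfolding pf_brL pq dx_def by (simp add: algebra_simps)
  moreover have "u * (2 * dx) \<le> u * S" "0 \<le> a * dx" using dx2 u1 a0 dxp by simp_all
  ultimately have "0 < pf (brL q)" using Sb by (simp add: ac_simps)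
  moreover have "pf q < 0" using pq dx2 Sb by simp
  ultimately have "tooth q" using S0 by (simp add: tooth_def S_def)
  moreover have "F (2 * k + 1) (unpar x) = p" "s0 \<le> unpar x" "unpar x \<le> 1"
    using F_edge1[of "unpar x"] unpar[of x] x th by (auto simp: p_def)
  ultimately show False using AVg[of "unpar x" "2 * k + 1" n] evn gp by (simp add: q_def)
qed

end

context lozi_uv begin

lemma hull_pos: assumes nc: "\<And>B. no_crossing B" and K: "chain K" "\<forall>j\<le>K. 0 < fst (zz j)" and j: "j \<le> K"
  shows "0 < fst (zz j) \<and> 0 \<le> pf (zz j)"
  using pf_zz[OF nc, of j "2 * j"] chain_mono[OF K(1) j] K(2) j by simp

lemma tau_pos_odd:
  assumes nc: "\<And>B. no_crossing B" and s: "0 \<le> s" "s \<le> 1" and n: "odd n" "fst (F n s) \<le> 0"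
  shows "0 < tau (F n s)"
proof -
  obtain N0 where "Sb N0 < 0" using Sb_neg by blast
  moreover from this have "N0 \<noteq> 0" by (intro notI) simp
  ultimately have N0: "Sb N0 \<le> 0" "1 \<le> N0" by simp_all
  show ?thesis using trichotomy[OF N0]
  proof (elim disjE exE conjE)
    fix K assume K: "1 \<le> K" "K \<le> N0" "chain K" "\<forall>j\<le>K. 0 < fst (zz j)"
      "fst (zm K) < 0 \<longrightarrow> zz (Suc K) \<in> convex hull (zz ` {..K})"
    have "0 < fst (F n s)" using hull_trap(1)[OF K(1,3) hull_pos[OF nc K(3,4)] _ s n(1)] K(5) by blast
    then show ?thesis using n by simp
  next
    fix k assume k: "chain (Suc k)" "fst (zz (Suc k)) \<le> 0" "\<forall>N. 1 \<le> N \<longrightarrow> N \<le> k \<longrightarrow> 0 < Sb N"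
    interpret C: lozi_C u l k by (rule C_of_no_crossing[OF nc k])
    show ?thesis using C.tau_odd[OF C.tau_z_pos s n] .
  qed
qed

lemma axis_hit_V:
  assumes nc: "\<And>B. no_crossing B" and s: "s0 < s" "s < 1" and ln: "land n s" and fi: "\<And>m. m < n \<Longrightarrow> \<not> land m s"
    and j: "j \<le> n" and z: "fst (F j s) = 0"
  shows "\<exists>i. F i s = Vp"
proof -
  obtain N0 where "Sb N0 < 0" using Sb_neg by blast
  moreover from this have "N0 \<noteq> 0" by (intro notI) simp
  ultimately have N0: "Sb N0 \<le> 0" "1 \<le> N0" by simp_all
  show ?thesis using trichotomy[OF N0]
  proof (elim disjE exE conjE)
    fix K assume K: "1 \<le> K" "K \<le> N0" "chain K" "\<forall>j\<le>K. 0 < fst (zz j)"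
      "fst (zm K) < 0 \<longrightarrow> zz (Suc K) \<in> convex hull (zz ` {..K})"
    have s': "0 < s" "s \<le> 1" using s s0 by auto
    have "F n s = zz K" using hull_trap(2)[OF K(1,3) hull_pos[OF nc K(3,4)] _ _ s'(2) s'(1) ln fi] K(5) s' by simp
    moreover obtain i where "K = Suc i" using K(1) by (cases K) auto
    ultimately have "F n s = F (Suc (2 * i)) 1" using zz_F1 K(3) by simp
    then have "s = 1" using track[OF s, of 1] s0 by simp
    then show ?thesis using s by simp
  next
    fix k assume k: "chain (Suc k)" "fst (zz (Suc k)) \<le> 0" "\<forall>N. 1 \<le> N \<longrightarrow> N \<le> k \<longrightarrow> 0 < Sb N"
    interpret C: lozi_C u l k by (rule C_of_no_crossing[OF nc k])
    show ?thesis using C.axis_hit[OF s ln fi j z] .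
  qed
qed

end

section \<open>The set of landing parameters\<close>

context lozi_uv begin

lemma T_affine: "T ((1 - t) * x + t * y) = (1 - t) *\<^sub>R T x + t *\<^sub>R T y"
  by (simp add: T_def prod_eq_iff algebra_simps)

lemma F_affine:
  assumes sgn: "\<And>j. j < n \<Longrightarrow> (\<forall>s\<in>{x..y}. 0 \<le> fst (F j s)) \<or> (\<forall>s\<in>{x..y}. fst (F j s) \<le> 0)"
    and xy: "x \<le> y" and t: "0 \<le> t" "t \<le> 1"
  shows "F n ((1 - t) * x + t * y) = (1 - t) *\<^sub>R F n x + t *\<^sub>R F n y"
  using sgn
proof (induction n)
  case 0 then show ?case by (simp add: T_affine)
next
  case (Suc n)
  have IH: "F n ((1 - t) * x + t * y) = (1 - t) *\<^sub>R F n x + t *\<^sub>R F n y" using Suc by simp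
  have m: "(1 - t) * x + t * y \<in> {x..y}"
  proof -
    have "0 \<le> t * (y - x)" using t xy by simp
    moreover have "t * (y - x) \<le> 1 * (y - x)" using t xy by (intro mult_right_mono) auto
    ultimately show ?thesis by (simp add: algebra_simps)
  qed
  have e: "x \<in> {x..y}" "y \<in> {x..y}" using xy by auto
  show ?case using Suc.prems[OF lessI]
  proof
    assume "\<forall>s\<in>{x..y}. 0 \<le> fst (F n s)"
    then have "F (Suc n) s = brR (F n s)" if "s \<in> {x..y}" for s using that by (simp add: F_Suc stp_R)
    then show ?thesis using m e IH by (simp add: brR_aff)
  next
    assume "\<forall>s\<in>{x..y}. fst (F n s) \<le> 0"
    then have "F (Suc n) s = brL (F n s)" if "s \<in> {x..y}" for s using that by (simp add: F_Suc stp_L)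
    then show ?thesis using m e IH by (simp add: brL_aff)
  qed
qed

lemma V_unique: assumes "s0 < s" "s < 1" "s0 < s'" "s' < 1" "F i s = Vp" "F j s' = Vp" shows "s = s'"
  using track[OF assms(1,2), of s' i j] assms by simp

text \<open>The curves \<open>F j\<close> with \<open>j \<le> n\<close> stay off the axis near
\<open>s\<close>, so \<open>pf (F n s')\<close> is affine in \<open>s'\<close> near its zero
\<open>s\<close>. Since it does not change sign, it vanishes identically there.\<close>
lemma land_open:
  assumes nc: "\<And>B. no_crossing B" and s: "s0 < s" "s < 1" and ln: "land n0 s" and nV: "\<And>i. F i s \<noteq> Vp"
  shows "\<exists>d>0. \<forall>s'. dist s' s < d \<longrightarrow> (\<exists>n. land n s')"
proof -
  define n where "n = (LEAST n. land n s)"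
  have n: "land n s" unfolding n_def using ln by (rule LeastI)
  have fi: "\<not> land m s" if "m < n" for m using not_less_Least that unfolding n_def by blast
  have nz: "fst (F j s) \<noteq> 0" if "j \<le> n" for j using axis_hit_V[OF nc s n fi that] nV by blast
  have "\<forall>\<^sub>F x in nhds s. \<forall>j\<in>{..n}. 0 < fst (F j x) * fst (F j s)"
  proof (rule eventually_ball_finite)
    show "\<forall>j\<in>{..n}. \<forall>\<^sub>F x in nhds s. 0 < fst (F j x) * fst (F j s)"
    proof
      fix j assume j: "j \<in> {..n}"
      have "isCont (\<lambda>x. fst (F j x)) s" using cont_comp(3)[of j] by (simp add: continuous_on_eq_continuous_at)
      then have "((\<lambda>x. fst (F j x)) \<longlongrightarrow> fst (F j s)) (nhds s)"
        using tendsto_at_iff_tendsto_nhds[of "\<lambda>x. fst (F j x)" s] by (simp add: isCont_def)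
      then have "((\<lambda>x. fst (F j x) * fst (F j s)) \<longlongrightarrow> fst (F j s) * fst (F j s)) (nhds s)" by (rule tendsto_mult_right)
      moreover have "fst (F j s) \<noteq> 0" using nz j by simp
      then have "0 < fst (F j s) * fst (F j s)" by (metis not_real_square_gt_zero)
      ultimately show "\<forall>\<^sub>F x in nhds s. 0 < fst (F j x) * fst (F j s)" by (rule order_tendstoD)
    qed
  qed simp
  moreover have "\<forall>\<^sub>F x in nhds s. x \<in> {0<..<1}"
    using s s0 by (intro eventually_nhds_in_open) auto
  ultimately have "\<forall>\<^sub>F x in nhds s. (\<forall>j\<in>{..n}. 0 < fst (F j x) * fst (F j s)) \<and> 0 < x \<and> x < 1"
    by eventually_elim auto
  then obtain d where d: "0 < d" "\<And>x. dist x s < d \<Longrightarrow> (\<forall>j\<in>{..n}. 0 < fst (F j x) * fst (F j s)) \<and> 0 < x \<and> x < 1"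
    unfolding eventually_nhds_metric by blast
  have fpos: "0 < fst (F n s)" using nz[of n] n by (auto simp: land_def)
  have key: "land n x" if x: "dist x s < d" for x
  proof -
    define e where "e = \<bar>x - s\<bar>"
    have e: "0 \<le> e" "e < d" using x by (auto simp: e_def dist_real_def)
    define x1 x2 where "x1 = s - e" and "x2 = s + e"
    have D: "(\<forall>j\<in>{..n}. 0 < fst (F j y) * fst (F j s)) \<and> 0 < y \<and> y < 1" if "y \<in> {x1..x2}" for y
      using that e d(2)[of y] by (auto simp: x1_def x2_def dist_real_def)
    have sgn: "(\<forall>y\<in>{x1..x2}. 0 \<le> fst (F j y)) \<or> (\<forall>y\<in>{x1..x2}. fst (F j y) \<le> 0)" if "j < n" for j
    proof (cases "0 < fst (F j s)")
      case True
      then have "0 \<le> fst (F j y)" if "y \<in> {x1..x2}" for y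
        using D[OF that] \<open>j < n\<close> by (auto simp: zero_less_mult_iff dest: bspec[of _ _ j])
      then show ?thesis by blast
    next
      case False
      then have "fst (F j y) \<le> 0" if "y \<in> {x1..x2}" for y
        using D[OF that] \<open>j < n\<close> by (auto simp: zero_less_mult_iff dest: bspec[of _ _ j])
      then show ?thesis by blast
    qed
    have pos: "0 < fst (F n y)" if "y \<in> {x1..x2}" for y
      using D[OF that] fpos by (auto simp: zero_less_mult_iff dest: bspec[of _ _ n])
    have half: "F n ((1 - 1/2) * x1 + 1/2 * x2) = (1 - 1/2) *\<^sub>R F n x1 + (1/2) *\<^sub>R F n x2"
      by (rule F_affine[OF sgn]) (use e in \<open>auto simp: x1_def x2_def\<close>)
    moreover have "(1 - 1/2) * x1 + 1/2 * x2 = s" by (simp add: x1_def x2_def field_simps)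
    ultimately have "pf (F n s) = (1 - 1/2) * pf (F n x1) + 1/2 * pf (F n x2)" by (simp only: pf_aff)
    then have op: "pf (F n x2) = - pf (F n x1)" using n by (simp add: land_def)
    have "\<not> pf (F n x1) * pf (F n x2) < 0"
      using nc[of n] pos D[of x1] D[of x2] e unfolding no_crossing_def by (auto simp: x1_def x2_def less_imp_le)
    then have "pf (F n x1) = 0" unfolding op by (auto simp: not_less mult_le_0_iff zero_le_mult_iff)
    then have "pf (F n x1) = 0" "pf (F n x2) = 0" using op by simp_all
    moreover have "x = x1 \<or> x = x2" by (auto simp: x1_def x2_def e_def)
    ultimately show ?thesis using pos[of x] e by (auto simp: land_def x1_def x2_def less_imp_le)
  qed
  then show ?thesis using d(1) by blast
qed

lemma land_closed: "closed {s. land M s}"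
proof -
  have "closed {s. 0 \<le> fst (F M s) \<and> pf (F M s) = 0}"
    by (intro closed_Collect_conj closed_Collect_le closed_Collect_eq continuous_intros cont_comp)
  then show ?thesis by (simp add: land_def)
qed

lemma land_clopen:
  assumes nc: "\<And>B. no_crossing B" and M: "\<And>s n. s0 < s \<Longrightarrow> s \<le> 1 \<Longrightarrow> land n s \<Longrightarrow> land M s"
    and xy: "s0 \<le> x" "y \<le> 1" and nV: "\<And>s i. x < s \<Longrightarrow> s < y \<Longrightarrow> F i s \<noteq> Vp"
  shows "(\<forall>s. x < s \<and> s < y \<longrightarrow> \<not> land M s) \<or> (\<forall>s. x < s \<and> s < y \<longrightarrow> land M s)"
proof -
  define S where "S = {x<..<y}"
  define A where "A = S \<inter> {s. land M s}"
  have c1: "closedin (top_of_set S) A" unfolding A_def using land_closed by (rule closedin_closed_Int)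
  have "open A" unfolding open_dist
  proof
    fix s assume s: "s \<in> A"
    then have s': "s0 < s" "s < 1" "x < s" "s < y" "land M s" using xy by (auto simp: A_def S_def)
    obtain d where d: "d > 0" "\<And>s'. dist s' s < d \<Longrightarrow> \<exists>n. land n s'"
      using land_open[OF nc s'(1,2,5) nV[OF s'(3,4)]] by blast
    define e where "e = min d (min (s - x) (y - s))"
    have "e > 0" using d s' by (simp add: e_def)
    moreover have "s' \<in> A" if di: "dist s' s < e" for s'
    proof -
      have i: "x < s'" "s' < y" using di by (auto simp: e_def dist_real_def)
      have "dist s' s < d" using di by (simp add: e_def)
      then obtain n where "land n s'" using d(2)[of s'] by blast
      then have "land M s'" using M[of s' n] i xy by simp
      then show ?thesis using i by (simp add: A_def S_def)
    qed
    ultimately show "\<exists>e>0. \<forall>s'. dist s' s < e \<longrightarrow> s' \<in> A" by blast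
  qed
  then have c2: "openin (top_of_set S) A" by (intro open_subset) (auto simp: A_def)
  have "connected S" by (simp add: S_def)
  then have "openin (top_of_set S) A \<and> closedin (top_of_set S) A \<longrightarrow> A = {} \<or> A = S"
    unfolding connected_clopen by (rule spec)
  then have "A = {} \<or> A = S" using c1 c2 by simp
  moreover have "s \<in> A \<longleftrightarrow> (x < s \<and> s < y) \<and> land M s" for s by (simp add: A_def S_def)
  moreover have "s \<in> S \<longleftrightarrow> x < s \<and> s < y" for s by (simp add: S_def)
  ultimately show ?thesis by (metis empty_iff)
qed

lemma pq_eq: assumes "pf p = pf q" "qf p = qf q" shows "p = q"
proof -
  have e: "fst p - l * snd p = fst q - l * snd q" "fst p + u * snd p = fst q + u * snd q"
    using assms by (simp_all add: pf_def qf_def)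
  then have "(u + l) * snd p = (u + l) * snd q" by (simp add: algebra_simps)
  then have "snd p = snd q" using u1 l0 by simp
  then show ?thesis using e by (simp add: prod_eq_iff)
qed

text \<open>If every parameter landed by time \<open>M\<close>, the curve \<open>F M\<close>
would parametrise a piece of the landing half-line from an iterate of \<open>Zinv\<close> to the
second iterate of that point. By the intermediate value theorem it would contain the first
iterate as well, although this belongs to \<open>Z\<close> and not to \<open>T\<close>.\<close>
lemma not_all_land: "\<exists>s. s0 < s \<and> s < 1 \<and> \<not> land M s"
proof (rule ccontr)
  assume "\<not> ?thesis"
  then have all: "{s0<..<1} \<subseteq> {s. land M s}" by auto
  then have "closure {s0<..<1} \<subseteq> {s. land M s}" using land_closed by (rule closure_minimal)
  then have L: "land M s" if "s0 \<le> s" "s \<le> 1" for s using that s0 by auto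
  define q where "q = qf (F M s0)"
  have q0: "q \<le> 0" by (simp add: q_def qf_F)
  have st: "qf (F (Suc n) s) = l * qf (F n s)" if "land n s" for n s
    using that by (simp add: land_def F_Suc stp_R qf_brR)
  have q1: "qf (F (Suc M) s0) = l * q" using st[OF L[of s0]] s0 by (simp add: q_def)
  have L1: "land (Suc M) s0" using land_Suc L[of s0] s0 by simp
  have q2: "qf (F M 1) = l * (l * q)"
  proof -
    have "F (M + 2) s0 = F (M + 0) 1" unfolding F_cancel using T_s0'(2) by simp
    then have "F M 1 = F (Suc (Suc M)) s0" by simp
    then show ?thesis using st[OF L1] q1 by simp
  qed
  have "\<exists>x\<ge>s0. x \<le> 1 \<and> qf (F M x) = l * q"
  proof (rule IVT')
    have lq: "q \<le> l * q" using q0 l1 by (simp add: mult_le_cancel_right2 mult_le_cancel_right1)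
    then show "qf (F M s0) \<le> l * q" by (simp add: q_def)
    show "l * q \<le> qf (F M 1)" unfolding q2 using lq l0 by (intro mult_left_mono) auto
    show "s0 \<le> 1" using s0 by simp
    show "continuous_on {s0..1} (\<lambda>x. qf (F M x))" unfolding qf_def
      by (intro continuous_intros continuous_on_subset[OF continuous_F]) auto
  qed
  then obtain x where x: "s0 \<le> x" "x \<le> 1" "qf (F M x) = l * q" by blast
  have "F M x = F (Suc M) s0" using x q1 L[of x] L1 by (intro pq_eq) (auto simp: land_def)
  then have "F (M + 0) x = F (M + 1) s0" by simp
  then have "T x = Zp" unfolding F_cancel T_s0' by simp
  then show False using fst_T'[OF x(1,2)] fst_Zp by simp
qed

text \<open>Neither before nor after landing do the orbits meet the axis, so the interval has a
constant itinerary.\<close>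
lemma F_seg:
  assumes nc: "\<And>B. no_crossing B" and xy: "s0 \<le> x" "x < y" "y \<le> 1"
    and L: "\<And>s. x < s \<Longrightarrow> s < y \<Longrightarrow> land M s" and nV: "\<And>s i. x < s \<Longrightarrow> s < y \<Longrightarrow> F i s \<noteq> Vp"
  shows "F i ` {x..y} = closed_segment (F i x) (F i y)"
proof -
  have nz: "fst (F j s) \<noteq> 0" if s: "x < s" "s < y" for s j
  proof -
    define n where "n = (LEAST n. land n s)"
    have n: "land n s" unfolding n_def using L[OF s] by (rule LeastI)
    have fi: "\<not> land m s" if "m < n" for m using not_less_Least that unfolding n_def by blast
    show ?thesis
    proof (cases "j \<le> n")
      case True
      then show ?thesis using axis_hit_V[OF nc _ _ n fi True] nV[OF s] s xy by auto
    next
      case False then show ?thesis using land_after[OF n, of j] by simp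
    qed
  qed
  have sgn: "(\<forall>s\<in>{x..y}. 0 \<le> fst (F j s)) \<or> (\<forall>s\<in>{x..y}. fst (F j s) \<le> 0)" for j
  proof -
    have "(\<forall>s\<in>{x<..<y}. 0 \<le> fst (F j s)) \<or> (\<forall>s\<in>{x<..<y}. fst (F j s) \<le> 0)"
    proof (rule ccontr)
      assume "\<not> ?thesis"
      then obtain s s' where s: "x < s" "s < y" "fst (F j s) < 0" "x < s'" "s' < y" "0 < fst (F j s')" by (auto simp: not_le)
      have "connected ((\<lambda>s. fst (F j s)) ` {x<..<y})"
        by (intro connected_continuous_image continuous_on_subset[OF cont_comp(3)]) auto
      then have "0 \<in> (\<lambda>s. fst (F j s)) ` {x<..<y}"
        by (rule connectedD_interval[of _ "fst (F j s)" "fst (F j s')"]) (use s in auto)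
      then show False using nz by auto
    qed
    moreover have cl: "closed {s. 0 \<le> fst (F j s)}" "closed {s. fst (F j s) \<le> 0}"
      by (intro closed_Collect_le continuous_intros cont_comp)+
    moreover have xyc: "closure {x<..<y} = {x..y}" using xy by simp
    ultimately show ?thesis
    proof (elim disjE)
      assume "\<forall>s\<in>{x<..<y}. 0 \<le> fst (F j s)"
      then have "{x<..<y} \<subseteq> {s. 0 \<le> fst (F j s)}" by blast
      then have "{x..y} \<subseteq> {s. 0 \<le> fst (F j s)}" using closure_minimal cl(1) xyc by metis
      then show ?thesis by blast
    next
      assume "\<forall>s\<in>{x<..<y}. fst (F j s) \<le> 0"
      then have "{x<..<y} \<subseteq> {s. fst (F j s) \<le> 0}" by blast
      then have "{x..y} \<subseteq> {s. fst (F j s) \<le> 0}" using closure_minimal cl(2) xyc by metis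
      then show ?thesis by blast
    qed
  qed
  have a: "F i ((1 - t) * x + t * y) = (1 - t) *\<^sub>R F i x + t *\<^sub>R F i y" if "0 \<le> t" "t \<le> 1" for t
    using F_affine[OF sgn _ that] xy by simp
  have "{x..y} = (\<lambda>t. (1 - t) * x + t * y) ` {0..1}"
    using closed_segment_eq_real_ivl1[of x y] xy by (simp add: closed_segment_image_interval)
  then have "F i ` {x..y} = (\<lambda>t. (1 - t) *\<^sub>R F i x + t *\<^sub>R F i y) ` {0..1}"
    using a by (simp add: image_image)
  then show ?thesis by (simp add: closed_segment_image_interval)
qed

lemma landing_set:
  assumes nc: "\<And>B. no_crossing B" and M': "\<forall>s n. s0 < s \<longrightarrow> s \<le> 1 \<longrightarrow> land n s \<longrightarrow> land M s"
  shows "(\<forall>s. s0 < s \<and> s < 1 \<longrightarrow> \<not> land M s) \<or>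
    (\<exists>v i. s0 < v \<and> v < 1 \<and> F i v = Vp \<and>
      ((\<forall>s. s0 < s \<and> s < 1 \<longrightarrow> (land M s \<longleftrightarrow> s = v)) \<or>
       (land M 1 \<and> (\<forall>s. s0 < s \<and> s < 1 \<longrightarrow> (land M s \<longleftrightarrow> v \<le> s)) \<and> F i ` {v..1} = closed_segment Vp (F i 1)) \<or>
       (land M s0 \<and> (\<forall>s. s0 < s \<and> s < 1 \<longrightarrow> (land M s \<longleftrightarrow> s \<le> v)) \<and> F i ` {s0..v} = closed_segment Vp (F i s0))))"
proof -
  have M: "land M s" if "s0 < s" "s \<le> 1" "land n s" for s n using M' that by blast
  show ?thesis
proof (cases "\<exists>v i. s0 < v \<and> v < 1 \<and> F i v = Vp")
  case False
  then have "(\<forall>s. s0 < s \<and> s < 1 \<longrightarrow> \<not> land M s) \<or> (\<forall>s. s0 < s \<and> s < 1 \<longrightarrow> land M s)"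
    by (intro land_clopen[OF nc M]) auto
  then show ?thesis using not_all_land[of M] by blast
next
  case True
  then obtain v i where v: "s0 < v" "v < 1" "F i v = Vp" by blast
  have nV: "F j s \<noteq> Vp" if "s0 < s" "s < 1" "s \<noteq> v" for s j using V_unique[OF that(1,2) v(1,2) _ v(3)] that(3) by blast
  have "land i v" using v(3) pf_Vp by (simp add: land_def)
  then have Lv: "land M v" using M v by simp
  have 1: "(\<forall>s. s0 < s \<and> s < v \<longrightarrow> \<not> land M s) \<or> (\<forall>s. s0 < s \<and> s < v \<longrightarrow> land M s)"
    using v nV by (intro land_clopen[OF nc M]) auto
  have 2: "(\<forall>s. v < s \<and> s < 1 \<longrightarrow> \<not> land M s) \<or> (\<forall>s. v < s \<and> s < 1 \<longrightarrow> land M s)"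
    using v nV by (intro land_clopen[OF nc M]) auto
  have cl: "land M x \<and> land M y" if "x < y" "\<forall>s. x < s \<and> s < y \<longrightarrow> land M s" for x y
  proof -
    have "{x<..<y} \<subseteq> {s. land M s}" using that by auto
    then have "closure {x<..<y} \<subseteq> {s. land M s}" using land_closed by (rule closure_minimal)
    then have "{x..y} \<subseteq> {s. land M s}" using that(1) by simp
    moreover have "x \<in> {x..y}" "y \<in> {x..y}" using that(1) by auto
    ultimately show ?thesis by blast
  qed
  show ?thesis
  proof (cases "\<forall>s. v < s \<and> s < 1 \<longrightarrow> land M s")
    case R: True
    have "\<not> (\<forall>s. s0 < s \<and> s < v \<longrightarrow> land M s)"
      using not_all_land[of M] R Lv by (metis linorder_neqE_linordered_idom)
    then have "\<forall>s. s0 < s \<and> s < v \<longrightarrow> \<not> land M s" using 1 by blast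
    then have "\<forall>s. s0 < s \<and> s < 1 \<longrightarrow> (land M s \<longleftrightarrow> v \<le> s)" using R Lv by (metis le_less not_less)
    moreover have "F i ` {v..1} = closed_segment (F i v) (F i 1)"
      by (rule F_seg[OF nc]) (use v R nV in auto)
    ultimately show ?thesis using cl[OF v(2) R] v by auto
  next
    case False
    then have R: "\<forall>s. v < s \<and> s < 1 \<longrightarrow> \<not> land M s" using 2 by blast
    show ?thesis
    proof (cases "\<forall>s. s0 < s \<and> s < v \<longrightarrow> land M s")
      case L: True
      have "\<forall>s. s0 < s \<and> s < 1 \<longrightarrow> (land M s \<longleftrightarrow> s \<le> v)" using L R Lv by (metis le_less not_less)
      moreover have "F i ` {s0..v} = closed_segment (F i s0) (F i v)"
        by (rule F_seg[OF nc]) (use v L nV in auto)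
      ultimately show ?thesis using cl[OF v(1) L] v by (auto simp: closed_segment_commute)
    next
      case False
      then have "\<forall>s. s0 < s \<and> s < v \<longrightarrow> \<not> land M s" using 1 by blast
      then have "\<forall>s. s0 < s \<and> s < 1 \<longrightarrow> (land M s \<longleftrightarrow> s = v)" using R Lv by (metis linorder_neqE_linordered_idom)
      then show ?thesis using v by blast
    qed
  qed
qed
qed

section \<open>Stable and unstable manifolds\<close>

lemma T_two: assumes "0 \<le> s" "s \<le> 1" shows "stp (stp (T (s * s0))) = T s"
proof -
  have e: "T (s * s0) = (1 - s) *\<^sub>R Xp + s *\<^sub>R T s0" by (simp add: T_def prod_eq_iff algebra_simps)
  have "0 \<le> fst (T (s * s0))" unfolding e T_s0 using assms xX0 by (simp add: Zinv_def)
  then have "stp (T (s * s0)) = (1 - s) *\<^sub>R Xp + s *\<^sub>R Zp"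
  proof -
    assume f: "0 \<le> fst (T (s * s0))"
    have "brR Zinv = Zp" using brL_Zinv by (simp add: brR_def brL_def Zinv_def)
    then show ?thesis using f by (simp add: stp_R) (simp add: e brR_aff brR_Xp T_s0)
  qed
  moreover have "0 \<le> fst ((1 - s) *\<^sub>R Xp + s *\<^sub>R Zp)" using assms xX0 fst_Zp by simp
  ultimately show ?thesis by (simp add: stp_R T_brR)
qed

text \<open>Two steps multiply a small parameter by \<open>u\<^sup>2\<close>.\<close>
lemma fundamental: assumes "0 < s" "s \<le> 1" shows "\<exists>s' n. s0 < s' \<and> s' \<le> 1 \<and> F n s = T s'"
proof -
  have "\<exists>N. s0 ^ N < s" using real_arch_pow_inv[OF assms(1) s0(2)] .
  then obtain N where "s0 ^ N < s" by blast
  then show ?thesis using assms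
  proof (induction N arbitrary: s)
    case 0 then show ?case by simp
  next
    case (Suc N)
    show ?case
    proof (cases "s0 < s")
      case True then show ?thesis using Suc by (intro exI[of _ s] exI[of _ 0]) simp
    next
      case False
      define r where "r = s / s0"
      have rs: "r * s0 = s" using s0 by (simp add: r_def)
      have r: "0 < r" "r \<le> 1" using False Suc s0 by (auto simp: r_def)
      have "s0 ^ N < r" using Suc.prems(1) s0 by (simp add: r_def pos_less_divide_eq mult.commute)
      then obtain s' n where sn: "s0 < s'" "s' \<le> 1" "F n r = T s'" using Suc.IH r by blast
      have "F 2 s = T r" using T_two[of r] r rs by (simp add: F_Suc numeral_2_eq_2)
      moreover have "F (n + 2) s = (stp ^^ n) (F 2 s)" by (rule F_add)
      ultimately have "F (n + 2) s = F n r" by (simp only: F_def[of n r])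
      then show ?thesis using sn by (intro exI[of _ s'] exI[of _ "n + 2"]) simp
    qed
  qed
qed

text \<open>Near \<open>X\<close> only the right branch acts, and it expands \<open>pf\<close>
and contracts \<open>qf\<close>.\<close>
lemma stable_iff: "(\<lambda>n. (stp ^^ n) p) \<longlonglongrightarrow> Xp \<longleftrightarrow> (\<exists>n. 0 \<le> fst ((stp ^^ n) p) \<and> pf ((stp ^^ n) p) = 0)"
proof
  assume lim: "(\<lambda>n. (stp ^^ n) p) \<longlonglongrightarrow> Xp"
  have "(\<lambda>n. fst ((stp ^^ n) p)) \<longlonglongrightarrow> fst Xp" using lim by (rule tendsto_fst)
  then have "\<forall>\<^sub>F n in sequentially. 0 < fst ((stp ^^ n) p)" using xX0 by (intro order_tendstoD)
  then obtain N where N: "\<And>n. N \<le> n \<Longrightarrow> 0 < fst ((stp ^^ n) p)" by (auto simp: eventually_sequentially)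
  have pw: "pf ((stp ^^ (N + k)) p) = (- u) ^ k * pf ((stp ^^ N) p)" for k
  proof (induction k)
    case (Suc k) then show ?case using N[of "N + k"] by (simp add: pf_stp_R)
  qed simp
  have "(\<lambda>n. pf ((stp ^^ n) p)) \<longlonglongrightarrow> pf Xp" unfolding pf_def by (intro tendsto_intros lim)
  then have z: "(\<lambda>k. pf ((stp ^^ (N + k)) p)) \<longlonglongrightarrow> 0" using LIMSEQ_ignore_initial_segment[of _ _ N] by (simp add: pf_Xp add.commute)
  have "pf ((stp ^^ N) p) = 0"
  proof (rule ccontr)
    assume n: "pf ((stp ^^ N) p) \<noteq> 0"
    have "\<forall>\<^sub>F k in sequentially. \<bar>pf ((stp ^^ (N + k)) p)\<bar> < \<bar>pf ((stp ^^ N) p)\<bar>"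
      using tendsto_rabs[OF z] n by (intro order_tendstoD) auto
    then obtain k where "\<bar>pf ((stp ^^ (N + k)) p)\<bar> < \<bar>pf ((stp ^^ N) p)\<bar>" by (auto simp: eventually_sequentially)
    moreover have "1 * \<bar>pf ((stp ^^ N) p)\<bar> \<le> u ^ k * \<bar>pf ((stp ^^ N) p)\<bar>" using u1 by (intro mult_right_mono) auto
    ultimately show False unfolding pw using u1 by (simp add: abs_mult power_abs)
  qed
  then show "\<exists>n. 0 \<le> fst ((stp ^^ n) p) \<and> pf ((stp ^^ n) p) = 0" using N[of N] by (intro exI[of _ N]) auto
next
  assume "\<exists>n. 0 \<le> fst ((stp ^^ n) p) \<and> pf ((stp ^^ n) p) = 0"
  then obtain N where N: "0 \<le> fst ((stp ^^ N) p)" "pf ((stp ^^ N) p) = 0" by blast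
  have st: "0 \<le> fst ((stp ^^ (N + k)) p) \<and> pf ((stp ^^ (N + k)) p) = 0 \<and> qf ((stp ^^ (N + k)) p) = l ^ k * qf ((stp ^^ N) p)" for k
  proof (induction k)
    case (Suc k)
    let ?q = "(stp ^^ (N + k)) p"
    have z: "0 \<le> fst ?q" "pf ?q = 0" using Suc by auto
    have p0: "pf (brR ?q) = 0" using z by (simp add: pf_brR)
    then have "fst (brR ?q) = l * fst ?q + 1 / (1 + u)" by (simp add: pf_def)
    moreover have "0 < 1 / (1 + u)" "0 \<le> l * fst ?q" using u1 l0 z by simp_all
    ultimately have "0 \<le> fst (brR ?q)" by linarith
    then show ?case using z p0 Suc by (simp add: stp_R qf_brR)
  qed (use N in simp)
  define q where "q k = (stp ^^ (N + k)) p" for k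
  have "(\<lambda>k. l ^ k * qf ((stp ^^ N) p)) \<longlonglongrightarrow> 0 * qf ((stp ^^ N) p)"
    using l0 l1 by (intro tendsto_intros LIMSEQ_power_zero) auto
  then have qz: "(\<lambda>k. qf (q k)) \<longlonglongrightarrow> 0" using st by (simp add: q_def)
  have pz: "pf (q k) = 0" for k using st by (simp add: q_def)
  have s: "snd (q k) = fst Xp + qf (q k) / (u + l)" for k
  proof -
    have "(u + l) * snd (q k) = (u + l) * fst Xp + qf (q k)" using pz[of k] width(1) unfolding pf_def qf_def by (simp add: algebra_simps)
    then show ?thesis using u1 l0 by (simp add: field_simps)
  qed
  have f: "fst (q k) = l * snd (q k) + 1 / (1 + u)" for k using pz[of k] by (simp add: pf_def)
  have "(\<lambda>k. fst Xp + qf (q k) / (u + l)) \<longlonglongrightarrow> fst Xp + 0 / (u + l)" using u1 l0 by (intro tendsto_intros qz) auto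
  then have sl: "(\<lambda>k. snd (q k)) \<longlonglongrightarrow> fst Xp" by (simp add: s)
  have "(\<lambda>k. l * snd (q k) + 1 / (1 + u)) \<longlonglongrightarrow> l * fst Xp + 1 / (1 + u)" by (intro tendsto_intros sl)
  moreover have "l * fst Xp + 1 / (1 + u) = fst Xp" using pf_Xp xX0 by (simp add: pf_def)
  ultimately have fl: "(\<lambda>k. fst (q k)) \<longlonglongrightarrow> fst Xp" by (simp only: f)
  have "(\<lambda>k. (fst (q k), snd (q k))) \<longlonglongrightarrow> (fst Xp, fst Xp)" by (intro tendsto_Pair sl fl)
  then have "q \<longlonglongrightarrow> Xp" using xX0 by (metis (no_types, lifting) ext prod.collapse)
  then have "(\<lambda>k. (stp ^^ (k + N)) p) \<longlonglongrightarrow> Xp" by (simp add: q_def[abs_def] add.commute)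
  then show "(\<lambda>n. (stp ^^ n) p) \<longlonglongrightarrow> Xp" by (rule LIMSEQ_offset)
qed

text \<open>Backwards in time \<open>qf\<close> expands near \<open>X\<close>, so an orbit that
tends to \<open>X\<close> is eventually on the unstable line; since the eigenvalue there is
negative, one of two consecutive points is on the side of \<open>Z1\<close>.\<close>
lemma unstable_iff:
  assumes q: "\<And>n. stp (q (Suc n)) = q n"
  shows "q \<longlonglongrightarrow> Xp \<longleftrightarrow> (\<exists>n s. 0 \<le> s \<and> s \<le> 1 \<and> q 0 = F n s)"
proof
  assume lim: "q \<longlonglongrightarrow> Xp"
  have qi: "(stp ^^ n) (q (n + m)) = q m" for n m
    by (induction n) (simp_all add: q funpow_swap1)
  have "(\<lambda>n. fst (q n)) \<longlonglongrightarrow> fst Xp" using lim by (rule tendsto_fst)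
  then have "\<forall>\<^sub>F n in sequentially. 0 < fst (q n)" using xX0 by (intro order_tendstoD)
  moreover have "(\<lambda>n. snd (q n)) \<longlonglongrightarrow> snd Xp" using lim by (rule tendsto_snd)
  then have "\<forall>\<^sub>F n in sequentially. snd (q n) < 1 / (1 - l)"
  proof (rule order_tendstoD)
    show "snd Xp < 1 / (1 - l)" using u1 l1 by (simp add: Xp_def divide_simps)
  qed
  ultimately have "\<forall>\<^sub>F n in sequentially. 0 < fst (q n) \<and> snd (q n) < 1 / (1 - l)" by eventually_elim simp
  then obtain N where N: "\<And>n. N \<le> n \<Longrightarrow> 0 < fst (q n) \<and> snd (q n) < 1 / (1 - l)" by (auto simp: eventually_sequentially)
  have qfz: "qf (q n) = 0" if n: "N \<le> n" for n
  proof (rule ccontr)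
    assume nz: "qf (q n) \<noteq> 0"
    have pw: "qf (q n) = l ^ k * qf (q (n + k))" for k
    proof (induction k)
      case (Suc k)
      have "q (n + k) = brR (q (Suc (n + k)))" using q[of "n + k"] N[of "Suc (n + k)"] n by (simp add: stp_R)
      then show ?case using Suc by (simp add: qf_brR)
    qed simp
    have "(\<lambda>k. qf (q k)) \<longlonglongrightarrow> qf Xp" unfolding qf_def by (intro tendsto_intros lim)
    then have z: "(\<lambda>k. qf (q (n + k))) \<longlonglongrightarrow> 0" using LIMSEQ_ignore_initial_segment[of _ _ n] by (simp add: qf_Xp add.commute)
    have "\<forall>\<^sub>F k in sequentially. \<bar>qf (q (n + k))\<bar> < \<bar>qf (q n)\<bar>"
      using tendsto_rabs[OF z] nz by (intro order_tendstoD) auto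
    then obtain k where k: "\<bar>qf (q (n + k))\<bar> < \<bar>qf (q n)\<bar>" by (auto simp: eventually_sequentially)
    have "l ^ k * \<bar>qf (q (n + k))\<bar> \<le> 1 * \<bar>qf (q (n + k))\<bar>" using l0 l1 by (intro mult_right_mono power_le_one) auto
    moreover have "\<bar>qf (q n)\<bar> = l ^ k * \<bar>qf (q (n + k))\<bar>" using pw[of k] l0 by (simp add: abs_mult)
    ultimately show False using k by linarith
  qed
  define sn where "sn n = (snd (q n) - fst Xp) / (1 / (1 - l) - fst Xp)" for n
  have den: "1 / (1 - l) - fst Xp = u * fst Xp" using qf_Xp by (simp add: qf_def xX0)
  have denp: "0 < 1 / (1 - l) - fst Xp" unfolding den using u1 xX0 by simp
  have qT: "q n = T (sn n)" if "N \<le> n" for n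
  proof -
    have "sn n * (1 / (1 - l) - fst Xp) = snd (q n) - fst Xp" using denp by (simp add: sn_def)
    then have "snd (T (sn n)) = snd (q n)" by (simp add: T_def Z1_def xX0 algebra_simps)
    moreover have "qf (T (sn n)) = qf (q n)" using qf_T qfz[OF that] by simp
    ultimately show ?thesis by (simp add: qf_def prod_eq_iff)
  qed
  have le1: "sn n \<le> 1" if "N \<le> n" for n using N[OF that] denp by (simp add: sn_def)
  show "\<exists>n s. 0 \<le> s \<and> s \<le> 1 \<and> q 0 = F n s"
  proof (cases "0 \<le> sn N")
    case True
    then show ?thesis using qi[of N 0] qT[of N] le1[of N] by (intro exI[of _ N] exI[of _ "sn N"]) (simp add: F_def)
  next
    case False
    have "0 \<le> sn (Suc N)"
    proof (rule ccontr)
      assume n: "\<not> 0 \<le> sn (Suc N)"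
      have "q N = brR (q (Suc N))" using q[of N] N[of "Suc N"] by (simp add: stp_R)
      then have "snd (q N) = fst (q (Suc N))" by simp
      moreover have "snd (q N) < fst Xp" using False denp by (auto simp: sn_def zero_le_divide_iff)
      moreover have "snd (q (Suc N)) < fst Xp" using n denp by (auto simp: sn_def zero_le_divide_iff)
      moreover have "fst (q (Suc N)) = 1 / (1 - l) - u * snd (q (Suc N))" using qfz[of "Suc N"] by (simp add: qf_def)
      moreover have "u * snd (q (Suc N)) < u * fst Xp" using calculation(3) u1 by simp
      ultimately show False using den by linarith
    qed
    then show ?thesis using qi[of "Suc N" 0] qT[of "Suc N"] le1[of "Suc N"]
      by (intro exI[of _ "Suc N"] exI[of _ "sn (Suc N)"]) (simp add: F_def)
  qed
next
  assume "\<exists>n s. 0 \<le> s \<and> s \<le> 1 \<and> q 0 = F n s"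
  then obtain n s where s: "0 \<le> s" "s \<le> 1" "q 0 = F n s" by blast
  have qi: "(stp ^^ n) (q (n + m)) = q m" for n m
    by (induction n) (simp_all add: q funpow_swap1)
  have "(stp ^^ n) (q n) = (stp ^^ n) (T s)" using qi[of n 0] s by (simp add: F_def)
  then have qn: "q n = T s" by (simp add: stp_iter_inj)
  have s0k: "0 \<le> s * s0 ^ k \<and> s * s0 ^ k \<le> 1" for k
  proof -
    have "s * s0 ^ k \<le> 1 * 1" using s s0 by (intro mult_mono power_le_one) auto
    then show ?thesis using s s0 by simp
  qed
  have ev: "q (n + 2 * k) = T (s * s0 ^ k)" for k
  proof (induction k)
    case (Suc k)
    have "stp (stp (q (n + 2 * Suc k))) = q (n + 2 * k)" using q[of "Suc (n + 2 * k)"] q[of "n + 2 * k"] by simp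
    also have "\<dots> = stp (stp (T (s * s0 ^ k * s0)))" using T_two[of "s * s0 ^ k"] s0k[of k] Suc by simp
    finally show ?case by (simp add: stp_inj ac_simps)
  qed (simp add: qn)
  have "(\<lambda>k. s0 ^ k) \<longlonglongrightarrow> 0" using s0 by (intro LIMSEQ_power_zero) auto
  then have "(\<lambda>k. s * s0 ^ k) \<longlonglongrightarrow> 0" by (rule tendsto_mult_right_zero)
  then have "(\<lambda>k. T (s * s0 ^ k)) \<longlonglongrightarrow> (1 - 0) *\<^sub>R Xp + 0 *\<^sub>R Z1" unfolding T_def by (intro tendsto_intros)
  then have e: "(\<lambda>k. q (n + 2 * k)) \<longlonglongrightarrow> Xp" using ev by simp
  have "(\<lambda>k. stp (q (n + 2 * Suc k))) \<longlonglongrightarrow> stp Xp" using stp_cont LIMSEQ_Suc[OF e] by (rule isCont_tendsto_compose)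
  then have o: "(\<lambda>k. q (n + (2 * k + 1))) \<longlonglongrightarrow> Xp" using q stp_Xp by simp
  have "(\<lambda>m. q (n + m)) \<longlonglongrightarrow> Xp"
  proof (rule metric_LIMSEQ_I)
    fix r :: real assume r: "0 < r"
    obtain K1 where K1: "\<And>k. K1 \<le> k \<Longrightarrow> dist (q (n + 2 * k)) Xp < r" using metric_LIMSEQ_D[OF e r] by blast
    obtain K2 where K2: "\<And>k. K2 \<le> k \<Longrightarrow> dist (q (n + (2 * k + 1))) Xp < r" using metric_LIMSEQ_D[OF o r] by blast
    have "dist (q (n + m)) Xp < r" if m: "2 * max K1 K2 + 1 \<le> m" for m
    proof (cases "even m")
      case True then obtain k where "m = 2 * k" by (elim evenE)
      then show ?thesis using K1[of k] m by simp
    next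
      case False then obtain k where "m = 2 * k + 1" by (elim oddE)
      then show ?thesis using K2[of k] m by simp
    qed
    then show "\<exists>no. \<forall>m\<ge>no. dist (q (n + m)) Xp < r" by blast
  qed
  then have "(\<lambda>m. q (m + n)) \<longlonglongrightarrow> Xp" by (simp add: add.commute)
  then show "q \<longlonglongrightarrow> Xp" by (rule LIMSEQ_offset)
qed

end

section \<open>Limits of parameters\<close>

text \<open>The common shape of the three compactness arguments below: failures at arbitrarily
late indices have a limit point.\<close>
lemma subsequence_limit:
  fixes P :: "nat \<Rightarrow> nat \<Rightarrow> real \<Rightarrow> bool"
  assumes "\<And>i. \<exists>j\<ge>i. \<exists>s\<in>{x..y}. P i j s"
  obtains r k S s where "strict_mono r" "filterlim k at_top sequentially" "S \<longlonglongrightarrow> s" "s \<in> {x..y}"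
    "\<And>i. P (r i) (k i) (S i)"
proof -
  have "\<forall>i. \<exists>j s. i \<le> j \<and> s \<in> {x..y} \<and> P i j s" using assms by blast
  then obtain k S where kS: "\<And>i. i \<le> k i \<and> S i \<in> {x..y} \<and> P i (k i) (S i)" by metis
  have "compact {x..y}" by simp
  then have "\<exists>l\<in>{x..y}. \<exists>r. strict_mono r \<and> (S \<circ> r) \<longlonglongrightarrow> l"
    unfolding compact_def using kS by blast
  then obtain s r where r: "s \<in> {x..y}" "strict_mono r" "(S \<circ> r) \<longlonglongrightarrow> s" by blast
  have "i \<le> k (r i)" for i using seq_suble[OF r(2), of i] kS[of "r i"] by linarith
  then have "filterlim (k \<circ> r) at_top sequentially"
    by (intro filterlim_at_top_mono[OF filterlim_ident]) (auto simp: always_eventually)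
  then show thesis using that[of r "k \<circ> r" "S \<circ> r" s] r kS by auto
qed

lemma F_tendsto:
  assumes ok: "\<And>j. lozi_uv (U j) (L j)" and ok0: "lozi_uv u l"
    and U: "U \<longlonglongrightarrow> u" and L: "L \<longlonglongrightarrow> l" and S: "S \<longlonglongrightarrow> s"
  shows "(\<lambda>j. lozi_uv.F (U j) (L j) n (S j)) \<longlonglongrightarrow> lozi_uv.F u l n s"
proof (induction n)
  case 0
  have nz: "1 - l \<noteq> 0" "(1 + u) * (1 - l) \<noteq> 0" using lozi_uv.l1[OF ok0] lozi_uv.u1[OF ok0] by auto
  show ?case
    unfolding lozi_uv.F_0[OF ok] lozi_uv.F_0[OF ok0] lozi_uv.T_def[OF ok] lozi_uv.T_def[OF ok0]
      lozi_uv.Xp_def[OF ok] lozi_uv.Xp_def[OF ok0] lozi_uv.Z1_def[OF ok] lozi_uv.Z1_def[OF ok0]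
    by (intro tendsto_intros U L S nz)
next
  case (Suc n)
  show ?case
    unfolding lozi_uv.F_Suc[OF ok] lozi_uv.F_Suc[OF ok0] lozi_uv.stp_def[OF ok] lozi_uv.stp_def[OF ok0]
      lozi_uv.a_def[OF ok] lozi_uv.a_def[OF ok0] lozi_uv.b_def[OF ok] lozi_uv.b_def[OF ok0]
    by (intro tendsto_intros U L Suc)
qed

lemma coord_tendsto:
  assumes ok: "\<And>j. lozi_uv (U j) (L j)" and ok0: "lozi_uv u l"
    and U: "U \<longlonglongrightarrow> u" and L: "L \<longlonglongrightarrow> l" and Q: "Q \<longlonglongrightarrow> q"
  shows "(\<lambda>j. lozi_uv.pf (U j) (L j) (Q j)) \<longlonglongrightarrow> lozi_uv.pf u l q"
    "(\<lambda>j. lozi_uv.tau (U j) (L j) (Q j)) \<longlonglongrightarrow> lozi_uv.tau u l q"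
    "(\<lambda>j. lozi_uv.dY (U j) (L j)) \<longlonglongrightarrow> lozi_uv.dY u l"
    "(\<lambda>j. lozi_uv.s0 (U j)) \<longlonglongrightarrow> lozi_uv.s0 u"
proof -
  have nz: "1 + u \<noteq> 0" "u - 1 \<noteq> 0" "(u - 1) * (1 + l) \<noteq> 0" "u\<^sup>2 \<noteq> 0"
    using lozi_uv.l0[OF ok0] lozi_uv.u1[OF ok0] by auto
  show "(\<lambda>j. lozi_uv.pf (U j) (L j) (Q j)) \<longlonglongrightarrow> lozi_uv.pf u l q"
    unfolding lozi_uv.pf_def[OF ok] lozi_uv.pf_def[OF ok0] by (intro tendsto_intros U L Q nz)
  show "(\<lambda>j. lozi_uv.tau (U j) (L j) (Q j)) \<longlonglongrightarrow> lozi_uv.tau u l q"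
    unfolding lozi_uv.tau_def[OF ok] lozi_uv.tau_def[OF ok0] by (intro tendsto_intros U L Q nz)
  show "(\<lambda>j. lozi_uv.dY (U j) (L j)) \<longlonglongrightarrow> lozi_uv.dY u l"
    unfolding lozi_uv.dY_def[OF ok] lozi_uv.dY_def[OF ok0] by (intro tendsto_intros U L nz)
  show "(\<lambda>j. lozi_uv.s0 (U j)) \<longlonglongrightarrow> lozi_uv.s0 u"
    unfolding lozi_uv.s0_def[OF ok] lozi_uv.s0_def[OF ok0] by (intro tendsto_intros U nz)
qed

lemma Sb_tendsto:
  assumes ok: "\<And>j. lozi_uv (U j) (L j)" and ok0: "lozi_uv u l"
    and U: "U \<longlonglongrightarrow> u" and L: "L \<longlonglongrightarrow> l"
  shows "(\<lambda>j. lozi_uv.Sb (U j) (L j) N) \<longlonglongrightarrow> lozi_uv.Sb u l N"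
proof -
  have bt: "(\<lambda>j. lozi_uv.b (U j) (L j)) \<longlonglongrightarrow> lozi_uv.b u l"
    unfolding lozi_uv.b_def[OF ok] lozi_uv.b_def[OF ok0] by (intro tendsto_intros U L)
  have at: "(\<lambda>j. lozi_uv.a (U j) (L j)) \<longlonglongrightarrow> lozi_uv.a u l"
    unfolding lozi_uv.a_def[OF ok] lozi_uv.a_def[OF ok0] by (intro tendsto_intros U L)
  have Ub: "(\<lambda>j. lozi_uv.Ub (U j) (L j) n) \<longlonglongrightarrow> lozi_uv.Ub u l n \<and>
     (\<lambda>j. lozi_uv.Ub (U j) (L j) (Suc n)) \<longlonglongrightarrow> lozi_uv.Ub u l (Suc n)" for n
  proof (induction n)
    case 0
    show ?case by (simp add: lozi_uv.Ub.simps[OF ok] lozi_uv.Ub.simps[OF ok0])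
  next
    case (Suc n)
    have "(\<lambda>j. lozi_uv.Ub (U j) (L j) (Suc (Suc n))) \<longlonglongrightarrow> lozi_uv.Ub u l (Suc (Suc n))"
      unfolding lozi_uv.Ub.simps(3)[OF ok] lozi_uv.Ub.simps(3)[OF ok0]
      by (intro tendsto_intros at bt Suc[THEN conjunct1] Suc[THEN conjunct2])
    then show ?case using Suc by simp
  qed
  have "lozi_uv.b u l ^ (2 * n) \<noteq> 0" for n using lozi_uv.b0[OF ok0] by simp
  then show ?thesis unfolding lozi_uv.Sb_def[OF ok] lozi_uv.Sb_def[OF ok0]
    by (intro tendsto_intros bt Ub[THEN conjunct1])
qed

lemma reindex_ok:
  assumes k: "filterlim k at_top sequentially" and "U \<longlonglongrightarrow> (u::real)"
  shows "(\<lambda>i. U (k i)) \<longlonglongrightarrow> u"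
  using filterlim_compose[OF assms(2) k] .

text \<open>Otherwise there are points with \<open>tau\<close> tending to zero or below, and a
limit point contradicts positivity at the limit parameter.\<close>
lemma tau_bound_ev:
  assumes ok: "\<And>j. lozi_uv (U j) (L j)" and ok0: "lozi_uv u l" and U: "U \<longlonglongrightarrow> u" and L: "L \<longlonglongrightarrow> l"
    and pos: "\<And>n s. odd n \<Longrightarrow> 0 \<le> s \<Longrightarrow> s \<le> 1 \<Longrightarrow> fst (lozi_uv.F u l n s) \<le> 0 \<Longrightarrow> 0 < lozi_uv.tau u l (lozi_uv.F u l n s)"
  shows "\<exists>e>0. \<forall>\<^sub>F j in sequentially. lozi_uv.tau_bound (U j) (L j) e M"
proof -
  have one: "\<exists>e>0. \<forall>\<^sub>F j in sequentially. \<forall>s\<in>{0..1}. fst (lozi_uv.F (U j) (L j) n s) \<le> 0 \<longrightarrow>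
      e \<le> lozi_uv.tau (U j) (L j) (lozi_uv.F (U j) (L j) n s)" if n: "odd n" for n
  proof (rule ccontr)
    assume c: "\<not> ?thesis"
    define P where "P i j s \<longleftrightarrow> fst (lozi_uv.F (U j) (L j) n s) \<le> 0 \<and>
      lozi_uv.tau (U j) (L j) (lozi_uv.F (U j) (L j) n s) < 1 / real (Suc i)" for i j s
    have "\<exists>j\<ge>i. \<exists>s\<in>{0..1}. P i j s" for i
    proof -
      have "0 < 1 / real (Suc i)" by simp
      then have "\<not> (\<forall>\<^sub>F j in sequentially. \<forall>s\<in>{0..1}. fst (lozi_uv.F (U j) (L j) n s) \<le> 0 \<longrightarrow>
        1 / real (Suc i) \<le> lozi_uv.tau (U j) (L j) (lozi_uv.F (U j) (L j) n s))" using c by blast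
      then show ?thesis unfolding eventually_sequentially P_def by (meson not_less)
    qed
    then obtain r k S s where w: "strict_mono (r :: nat \<Rightarrow> nat)" "filterlim k at_top sequentially" "S \<longlonglongrightarrow> s" "s \<in> {0..1}"
      "\<And>i. P (r i) (k i) (S i)" using subsequence_limit by metis
    have Ft: "(\<lambda>i. lozi_uv.F (U (k i)) (L (k i)) n (S i)) \<longlonglongrightarrow> lozi_uv.F u l n s"
      by (rule F_tendsto[OF ok ok0 reindex_ok[OF w(2) U] reindex_ok[OF w(2) L] w(3)])
    have "fst (lozi_uv.F u l n s) \<le> 0"
      by (rule LIMSEQ_le_const2[OF tendsto_fst[OF Ft]]) (use w(5) in \<open>auto simp: P_def\<close>)
    moreover have "lozi_uv.tau u l (lozi_uv.F u l n s) \<le> 0"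
    proof (rule LIMSEQ_le)
      show "(\<lambda>i. lozi_uv.tau (U (k i)) (L (k i)) (lozi_uv.F (U (k i)) (L (k i)) n (S i)))
          \<longlonglongrightarrow> lozi_uv.tau u l (lozi_uv.F u l n s)"
        by (rule coord_tendsto(2)[OF ok ok0 reindex_ok[OF w(2) U] reindex_ok[OF w(2) L] Ft])
      show "(\<lambda>i. 1 / real (Suc (r i))) \<longlonglongrightarrow> 0"
        using LIMSEQ_subseq_LIMSEQ[OF lim_inverse_n' [THEN LIMSEQ_Suc] w(1)] by (simp add: o_def)
      show "\<exists>N. \<forall>i\<ge>N. lozi_uv.tau (U (k i)) (L (k i)) (lozi_uv.F (U (k i)) (L (k i)) n (S i)) \<le> 1 / real (Suc (r i))"
        using w(5) by (auto simp: P_def less_imp_le)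
    qed
    ultimately show False using pos[OF n, of s] w(4) by force
  qed
  show ?thesis
  proof (induction M)
    case 0
    have "lozi_uv.tau_bound (U j) (L j) 1 0" for j unfolding lozi_uv.tau_bound_def[OF ok] by simp
    then show ?case by (intro exI[of _ 1]) simp
  next
    case (Suc M)
    then obtain e where e: "e > 0" "\<forall>\<^sub>F j in sequentially. lozi_uv.tau_bound (U j) (L j) e M" by blast
    show ?case
    proof (cases "odd (Suc M)")
      case False
      have "\<forall>\<^sub>F j in sequentially. lozi_uv.tau_bound (U j) (L j) e (Suc M)" using e(2)
        by eventually_elim (use False in \<open>auto simp: lozi_uv.tau_bound_def[OF ok] le_Suc_eq\<close>)
      then show ?thesis using e by blast
    next
      case True
      obtain e' where e': "e' > 0" "\<forall>\<^sub>F j in sequentially. \<forall>s\<in>{0..1}. fst (lozi_uv.F (U j) (L j) (Suc M) s) \<le> 0 \<longrightarrow>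
         e' \<le> lozi_uv.tau (U j) (L j) (lozi_uv.F (U j) (L j) (Suc M) s)" using one[OF True] by blast
      have "\<forall>\<^sub>F j in sequentially. lozi_uv.tau_bound (U j) (L j) (min e e') (Suc M)" using e(2) e'(2)
        by eventually_elim (auto simp: lozi_uv.tau_bound_def[OF ok] le_Suc_eq min_le_iff_disj)
      then show ?thesis using e e' by (intro exI[of _ "min e e'"]) simp
    qed
  qed
qed

lemma (in lozi_uv) no_crossing_D:
  assumes "no_crossing B" "n \<le> B" "0 \<le> s1" "s1 \<le> s2" "s2 \<le> 1" "\<And>s. s \<in> {s1..s2} \<Longrightarrow> 0 < fst (F n s)"
  shows "\<not> pf (F n s1) * pf (F n s2) < 0"
  using assms unfolding no_crossing_def by blast

text \<open>Crossings are given by strict inequalities on compact sets.\<close>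
lemma not_no_crossing_ev:
  assumes ok: "\<And>j. lozi_uv (U j) (L j)" and ok0: "lozi_uv u l" and U: "U \<longlonglongrightarrow> u" and L: "L \<longlonglongrightarrow> l"
    and nc: "\<not> lozi_uv.no_crossing u l B"
  shows "\<forall>\<^sub>F j in sequentially. \<not> lozi_uv.no_crossing (U j) (L j) B"
proof -
  obtain n s1 s2 where n: "n \<le> B" "0 \<le> s1" "s1 \<le> s2" "s2 \<le> 1" "\<forall>s\<in>{s1..s2}. 0 < fst (lozi_uv.F u l n s)"
    "lozi_uv.pf u l (lozi_uv.F u l n s1) * lozi_uv.pf u l (lozi_uv.F u l n s2) < 0"
    using nc unfolding lozi_uv.no_crossing_def[OF ok0] by blast
  have t: "(\<lambda>j. lozi_uv.pf (U j) (L j) (lozi_uv.F (U j) (L j) n s)) \<longlonglongrightarrow> lozi_uv.pf u l (lozi_uv.F u l n s)" for s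
    by (rule coord_tendsto(1)[OF ok ok0 U L F_tendsto[OF ok ok0 U L tendsto_const]])
  have 1: "\<forall>\<^sub>F j in sequentially. lozi_uv.pf (U j) (L j) (lozi_uv.F (U j) (L j) n s1) *
      lozi_uv.pf (U j) (L j) (lozi_uv.F (U j) (L j) n s2) < 0"
    by (rule order_tendstoD(2)[OF tendsto_mult[OF t t] n(6)])
  have 2: "\<forall>\<^sub>F j in sequentially. \<forall>s\<in>{s1..s2}. 0 < fst (lozi_uv.F (U j) (L j) n s)"
  proof (rule ccontr)
    assume c: "\<not> ?thesis"
    have "\<exists>j\<ge>i. \<exists>s\<in>{s1..s2}. fst (lozi_uv.F (U j) (L j) n s) \<le> 0" for i
      using c unfolding eventually_sequentially by (meson not_less)
    then obtain r k S s where w: "strict_mono (r :: nat \<Rightarrow> nat)" "filterlim k at_top sequentially" "S \<longlonglongrightarrow> s" "s \<in> {s1..s2}"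
      "\<And>i. fst (lozi_uv.F (U (k i)) (L (k i)) n (S i)) \<le> 0"
      using subsequence_limit[where P="\<lambda>i j s. fst (lozi_uv.F (U j) (L j) n s) \<le> 0"] by metis
    have Ft: "(\<lambda>i. lozi_uv.F (U (k i)) (L (k i)) n (S i)) \<longlonglongrightarrow> lozi_uv.F u l n s"
      by (rule F_tendsto[OF ok ok0 reindex_ok[OF w(2) U] reindex_ok[OF w(2) L] w(3)])
    have "fst (lozi_uv.F u l n s) \<le> 0"
      by (rule LIMSEQ_le_const2[OF tendsto_fst[OF Ft]]) (use w(5) in auto)
    then show False using n(5) w(4) by force
  qed
  show ?thesis using 1 2
  proof eventually_elim
    case (elim j)
    show ?case
    proof
      assume "lozi_uv.no_crossing (U j) (L j) B"
      then have "\<not> lozi_uv.pf (U j) (L j) (lozi_uv.F (U j) (L j) n s1) * lozi_uv.pf (U j) (L j) (lozi_uv.F (U j) (L j) n s2) < 0"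
        by (rule lozi_uv.no_crossing_D[OF ok _ n(1-4)]) (use elim(2) in blast)
      then show False using elim(1) by simp
    qed
  qed
qed

context lozi_uv begin

lemma not_no_crossing_land: assumes "\<not> no_crossing B" shows "\<exists>s n. s0 < s \<and> s \<le> 1 \<and> n \<le> B \<and> land n s"
proof -
  obtain n s1 s2 where n: "n \<le> B" "0 \<le> s1" "s1 \<le> s2" "s2 \<le> 1" "\<forall>s\<in>{s1..s2}. 0 < fst (F n s)"
    "pf (F n s1) * pf (F n s2) < 0"
    using assms unfolding no_crossing_def by blast
  have conn: "connected ((\<lambda>s. pf (F n s)) ` {s1..s2})"
    by (intro connected_continuous_image continuous_on_subset[OF cont_comp(2)]) auto
  have m: "pf (F n s1) \<in> (\<lambda>s. pf (F n s)) ` {s1..s2}" "pf (F n s2) \<in> (\<lambda>s. pf (F n s)) ` {s1..s2}"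
    using n(3) by (simp_all add: imageI)
  have "pf (F n s1) \<le> 0 \<and> 0 \<le> pf (F n s2) \<or> pf (F n s2) \<le> 0 \<and> 0 \<le> pf (F n s1)"
    using n(6) by (auto simp: mult_less_0_iff)
  then have "0 \<in> (\<lambda>s. pf (F n s)) ` {s1..s2}"
    using connectedD_interval[OF conn m] connectedD_interval[OF conn m(2,1)] by blast
  then obtain s where s: "s1 \<le> s" "s \<le> s2" "pf (F n s) = 0" by auto
  have ls: "land n s" using s n(5) by (auto simp: land_def less_imp_le)
  have "s \<noteq> 0" using s n(2,6) by auto
  then have sp: "0 < s" "s \<le> 1" using s n by auto
  obtain s' m where m: "s0 < s'" "s' \<le> 1" "F m s = T s'" using fundamental[OF sp] by blast
  have "m \<le> n"
  proof (rule ccontr)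
    assume "\<not> m \<le> n"
    then have "land m s" using land_mono[OF ls] by simp
    then show False using pf_T(2)[of s'] m s0 by (simp add: land_def)
  qed
  have "F n s = F (n - m) s'"
  proof -
    have "F (n - m + m) s = (stp ^^ (n - m)) (T s')" unfolding F_add m(3) ..
    then show ?thesis using \<open>m \<le> n\<close> by (simp add: F_def[of "n - m"])
  qed
  then have "land (n - m) s'" using ls by (simp add: land_def)
  then show ?thesis using m n(1) by (intro exI[of _ s'] exI[of _ "n - m"]) simp
qed

end

text \<open>If the nearby parameter has no early crossing, \<open>land_bound\<close> bounds the
landing time; if it has one, the crossing itself is an early landing.\<close>
lemma limit_land:
  assumes ok: "\<And>j. lozi_uv (U j) (L j)" and ok0: "lozi_uv u l" and U: "U \<longlonglongrightarrow> u" and L: "L \<longlonglongrightarrow> l"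
    and nc: "\<And>B. lozi_uv.no_crossing u l B"
    and ld: "\<And>j. \<exists>s n. lozi_uv.s0 (U j) < s \<and> s \<le> 1 \<and> lozi_uv.land (U j) (L j) n s"
  shows "\<exists>s n. lozi_uv.s0 u \<le> s \<and> s \<le> 1 \<and> lozi_uv.land u l n s"
proof -
  interpret X: lozi_uv u l by (rule ok0)
  obtain N0 where N0: "X.Sb N0 < 0" using X.Sb_neg by blast
  then have N01: "1 \<le> N0" by (cases N0) auto
  have e1: "\<forall>\<^sub>F j in sequentially. lozi_uv.Sb (U j) (L j) N0 < 0"
    by (rule order_tendstoD(2)[OF Sb_tendsto[OF ok ok0 U L] N0])
  obtain e where e: "e > 0" "\<forall>\<^sub>F j in sequentially. lozi_uv.tau_bound (U j) (L j) e (2 * N0 + 1)"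
    using tau_bound_ev[OF ok ok0 U L X.tau_pos_odd[OF nc]] by blast
  obtain Nn where "X.dY / e < u ^ Nn" using real_arch_pow[OF X.u1] by blast
  then have Nn: "X.dY < u ^ Nn * e" using e by (simp add: pos_divide_less_eq)
  have "(\<lambda>j. U j ^ Nn * e - lozi_uv.dY (U j) (L j)) \<longlonglongrightarrow> u ^ Nn * e - X.dY"
    by (intro tendsto_intros U coord_tendsto(3)[OF ok ok0 U L tendsto_const[of "(0,0)"]])
  then have e3: "\<forall>\<^sub>F j in sequentially. 0 < U j ^ Nn * e - lozi_uv.dY (U j) (L j)"
    using Nn by (intro order_tendstoD) auto
  define B where "B = 2 * N0 + 2 + Nn"
  have ev: "\<forall>\<^sub>F j in sequentially. \<exists>s. lozi_uv.s0 (U j) < s \<and> s \<le> 1 \<and> lozi_uv.land (U j) (L j) B s"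
    using e1 e(2) e3
  proof eventually_elim
    case (elim j)
    interpret J: lozi_uv "U j" "L j" by (rule ok)
    show ?case
    proof (cases "J.no_crossing B")
      case True
      obtain s n where s: "J.s0 < s" "s \<le> 1" "J.land n s" using ld by blast
      have "J.land (2 * N0 + 2 + Nn) s"
        by (rule J.land_bound[OF _ N01 True _ elim(2) e(1) _ s]) (use elim in \<open>auto simp: B_def\<close>)
      then show ?thesis using s by (auto simp: B_def)
    next
      case False
      then show ?thesis using J.not_no_crossing_land J.land_mono by blast
    qed
  qed
  then have "\<exists>j\<ge>i. \<exists>s\<in>{0..1}. lozi_uv.s0 (U j) < s \<and> lozi_uv.land (U j) (L j) B s" for i
  proof -
    obtain N where N: "\<And>j. N \<le> j \<Longrightarrow> \<exists>s. lozi_uv.s0 (U j) < s \<and> s \<le> 1 \<and> lozi_uv.land (U j) (L j) B s"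
      using ev unfolding eventually_sequentially by blast
    obtain s where s: "lozi_uv.s0 (U (max i N)) < s" "s \<le> 1" "lozi_uv.land (U (max i N)) (L (max i N)) B s"
      using N[of "max i N"] by auto
    then have "0 \<le> s" using lozi_uv.s0(1)[OF ok, of "max i N"] by simp
    then show ?thesis using s by (intro exI[of _ "max i N"]) auto
  qed
  then obtain r k S s where w: "strict_mono (r :: nat \<Rightarrow> nat)" "filterlim k at_top sequentially" "S \<longlonglongrightarrow> s" "s \<in> {0..1}"
    "\<And>i. lozi_uv.s0 (U (k i)) < S i \<and> lozi_uv.land (U (k i)) (L (k i)) B (S i)"
    using subsequence_limit[where P="\<lambda>i j s. lozi_uv.s0 (U j) < s \<and> lozi_uv.land (U j) (L j) B s"] by metis
  note Ut = reindex_ok[OF w(2) U] reindex_ok[OF w(2) L]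
  have Ft: "(\<lambda>i. lozi_uv.F (U (k i)) (L (k i)) B (S i)) \<longlonglongrightarrow> X.F B s"
    by (rule F_tendsto[OF ok ok0 Ut w(3)])
  have ln: "0 \<le> fst (lozi_uv.F (U (k i)) (L (k i)) B (S i))" "lozi_uv.pf (U (k i)) (L (k i)) (lozi_uv.F (U (k i)) (L (k i)) B (S i)) = 0" for i
    using w(5)[of i] lozi_uv.land_def[OF ok] by auto
  have "0 \<le> fst (X.F B s)" by (rule LIMSEQ_le_const[OF tendsto_fst[OF Ft]]) (use ln in auto)
  moreover have "X.pf (X.F B s) = 0"
    using LIMSEQ_unique[OF coord_tendsto(1)[OF ok ok0 Ut Ft]] ln(2) by simp
  moreover have "X.s0 \<le> s"
    by (rule LIMSEQ_le[OF coord_tendsto(4)[OF ok ok0 Ut Ft] w(3)]) (use w(5) in \<open>auto simp: less_imp_le\<close>)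
  ultimately show ?thesis using w(4) by (auto simp: X.land_def)
qed

section \<open>Back to the Lozi map\<close>

context lozi_uv begin

text \<open>The conjugacy with the Lozi map and its inverse.\<close>
definition to_lozi :: "real \<times> real \<Rightarrow> real \<times> real" where "to_lozi p = (fst p, b * snd p)"
definition from_lozi :: "real \<times> real \<Rightarrow> real \<times> real" where "from_lozi p = (fst p, snd p / b)"

lemma to_lozi_inv [simp]: "to_lozi (from_lozi p) = p" "from_lozi (to_lozi p) = p"
  using b0 by (simp_all add: to_lozi_def from_lozi_def prod_eq_iff)
lemma to_lozi_inj: "to_lozi p = to_lozi q \<longleftrightarrow> p = q" by (metis to_lozi_inv(2))
lemma lozi_to_lozi: "lozi a b (to_lozi p) = to_lozi (stp p)" by (simp add: lozi_def to_lozi_def stp_def)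
lemma lozi_iter_to_lozi: "(lozi a b ^^ n) (to_lozi p) = to_lozi ((stp ^^ n) p)"
  by (induction n) (simp_all add: lozi_to_lozi)
lemma bijL: "bij (lozi a b)" using bij_lozi[of b a] b0 by simp
lemma lozi_inv: "lozi a b (inv (lozi a b) x) = x" "inv (lozi a b) (lozi a b x) = x"
  using bijL by (simp_all add: bij_is_surj surj_f_inv_f bij_is_inj)

lemma sqrt_disc: "sqrt (a\<^sup>2 + 4 * b) = u + l"
proof (rule real_sqrt_unique)
  show "(u + l)\<^sup>2 = a\<^sup>2 + 4 * b" by (simp add: a_def b_def power2_eq_square algebra_simps)
qed (use u1 l0 in simp)
lemma special_points: "X_pt a b = to_lozi Xp" "Z_pt a b = to_lozi Zp" "V_pt a b = to_lozi Vp"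
proof -
  have "1 + a - b = (1 + u) * (1 - l)" by (simp add: a_def b_def algebra_simps)
  then show "X_pt a b = to_lozi Xp" by (simp add: X_pt_def to_lozi_def Xp_def)
  have z: "2 + a - (u + l) = 2 * (1 - l)" by (simp add: a_def)
  have "2 / (2 + a - (u + l)) = 1 / (1 - l)" unfolding z using l1 by (simp add: divide_simps)
  then show "Z_pt a b = to_lozi Zp" unfolding Z_pt_def sqrt_disc by (simp only: to_lozi_def Zp_def fst_conv snd_conv mult_zero_right)
  have v: "- a + 2 * b + (u + l) = 2 * (l * (1 + u))" by (simp add: a_def b_def algebra_simps)
  show "V_pt a b = to_lozi Vp" unfolding V_pt_def sqrt_disc v by (simp add: to_lozi_def Vp_def)
qed

text \<open>Points of the same orbit of an injective map have common forward iterates; with this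
description no inverse iterates are involved.\<close>
definition stp_orbit where "stp_orbit p = {q. \<exists>m n. (stp ^^ m) p = (stp ^^ n) q}"
lemma stp_orbit_I: "(stp ^^ n) p \<in> stp_orbit p" "(stp ^^ n) q = p \<Longrightarrow> q \<in> stp_orbit p"
proof -
  have "(stp ^^ n) p = (stp ^^ 0) ((stp ^^ n) p)" by simp
  then show "(stp ^^ n) p \<in> stp_orbit p" unfolding stp_orbit_def by blast
  assume "(stp ^^ n) q = p"
  then have "(stp ^^ 0) p = (stp ^^ n) q" by simp
  then show "q \<in> stp_orbit p" unfolding stp_orbit_def by blast
qed

lemma inv_iter: "(lozi a b ^^ n) ((inv (lozi a b) ^^ n) x) = x"
proof (induction n arbitrary: x)
  case (Suc n)
  have "(lozi a b ^^ Suc n) ((inv (lozi a b) ^^ Suc n) x) =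
      lozi a b ((lozi a b ^^ n) ((inv (lozi a b) ^^ n) (inv (lozi a b) x)))" by (simp add: funpow_swap1)
  then show ?case using Suc by (simp add: lozi_inv)
qed simp
lemma inv_iter': "(inv (lozi a b) ^^ n) ((lozi a b ^^ n) x) = x"
proof (induction n arbitrary: x)
  case (Suc n)
  have "(inv (lozi a b) ^^ Suc n) ((lozi a b ^^ Suc n) x) =
      inv (lozi a b) ((inv (lozi a b) ^^ n) ((lozi a b ^^ n) (lozi a b x)))" by (simp add: funpow_swap1)
  then show ?case using Suc by (simp add: lozi_inv)
qed simp

lemma orbit_to_lozi: "lozi_orbit a b (to_lozi p) = to_lozi ` stp_orbit p"
proof
  show "lozi_orbit a b (to_lozi p) \<subseteq> to_lozi ` stp_orbit p"
  proof
    fix x assume "x \<in> lozi_orbit a b (to_lozi p)"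
    then obtain k where k: "x = lozi_iter a b k (to_lozi p)" by (auto simp: lozi_orbit_def)
    show "x \<in> to_lozi ` stp_orbit p"
    proof (cases "0 \<le> k")
      case True
      then have "x = to_lozi ((stp ^^ nat k) p)" by (simp add: k lozi_iter_def lozi_iter_to_lozi)
      moreover have "(stp ^^ nat k) p \<in> stp_orbit p" by (rule stp_orbit_I)
      ultimately show ?thesis by blast
    next
      case False
      then have "(lozi a b ^^ nat (- k)) x = to_lozi p" by (simp add: k lozi_iter_def inv_iter)
      then have "to_lozi ((stp ^^ nat (- k)) (from_lozi x)) = to_lozi p" using lozi_iter_to_lozi[of "nat (- k)" "from_lozi x"] by simp
      then have "from_lozi x \<in> stp_orbit p" unfolding to_lozi_inj by (rule stp_orbit_I)
      then show ?thesis by (metis image_eqI to_lozi_inv(1))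
    qed
  qed
  show "to_lozi ` stp_orbit p \<subseteq> lozi_orbit a b (to_lozi p)"
  proof
    fix x assume "x \<in> to_lozi ` stp_orbit p"
    then obtain q m n where q: "x = to_lozi q" "(stp ^^ m) p = (stp ^^ n) q" by (auto simp: stp_orbit_def)
    have "x = lozi_iter a b (int m - int n) (to_lozi p)"
    proof (cases "n \<le> m")
      case True
      have "(stp ^^ n) ((stp ^^ (m - n)) p) = (stp ^^ m) p" using True by (simp flip: funpow_add comp_apply[of "stp ^^ n"])
      then have "(stp ^^ (m - n)) p = q" using q(2) stp_iter_inj by metis
      then show ?thesis using True q(1) by (simp add: lozi_iter_def lozi_iter_to_lozi nat_diff_distrib)
    next
      case False
      have "(stp ^^ m) ((stp ^^ (n - m)) q) = (stp ^^ n) q" using False by (simp flip: funpow_add comp_apply[of "stp ^^ m"])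
      then have "(stp ^^ (n - m)) q = p" using q(2) stp_iter_inj by metis
      then have "(lozi a b ^^ (n - m)) x = to_lozi p" using q(1) by (simp add: lozi_iter_to_lozi)
      then have "x = (inv (lozi a b) ^^ (n - m)) (to_lozi p)" using inv_iter' by metis
      moreover have "nat (int n - int m) = n - m" by simp
      ultimately show ?thesis using False by (simp add: lozi_iter_def)
    qed
    then show "x \<in> lozi_orbit a b (to_lozi p)" by (simp add: lozi_orbit_def)
  qed
qed

lemma stp_orbit_eq: assumes "q \<in> stp_orbit p" shows "stp_orbit q = stp_orbit p"
proof -
  obtain m n where mn: "(stp ^^ m) p = (stp ^^ n) q" using assms by (auto simp: stp_orbit_def)
  have sub: "stp_orbit q \<subseteq> stp_orbit p" if "(stp ^^ m) p = (stp ^^ n) q" for p q m n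
  proof
    fix x assume "x \<in> stp_orbit q"
    then obtain i j where ij: "(stp ^^ i) q = (stp ^^ j) x" by (auto simp: stp_orbit_def)
    have "(stp ^^ (i + m)) p = (stp ^^ (i + n)) q" using that by (simp add: funpow_add)
    also have "\<dots> = (stp ^^ (n + i)) q" by (simp add: add.commute)
    also have "\<dots> = (stp ^^ (n + j)) x" using ij by (simp add: funpow_add)
    finally show "x \<in> stp_orbit p" unfolding stp_orbit_def by blast
  qed
  show ?thesis using sub[OF mn] sub[OF mn[symmetric]] by blast
qed
lemma stp_orbit_F: "stp_orbit (F n s) = stp_orbit (T s)"
  unfolding F_def by (rule stp_orbit_eq[OF stp_orbit_I(1)])

text \<open>By \<open>stable_iff\<close> and \<open>unstable_iff\<close>, and since every
parameter can be moved to the fundamental domain.\<close>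
lemma homoclinic_eq:
  "homoclinic_points a b = (\<Union>s\<in>{s. s0 < s \<and> s \<le> 1 \<and> (\<exists>n. land n s)}. to_lozi ` stp_orbit (T s))"
proof -
  have cp: "(\<lambda>n. to_lozi (q n)) \<longlonglongrightarrow> to_lozi p \<longleftrightarrow> q \<longlonglongrightarrow> p" for q p
  proof
    assume "q \<longlonglongrightarrow> p"
    then show "(\<lambda>n. to_lozi (q n)) \<longlonglongrightarrow> to_lozi p" unfolding to_lozi_def by (intro tendsto_intros)
  next
    assume "(\<lambda>n. to_lozi (q n)) \<longlonglongrightarrow> to_lozi p"
    then have "(\<lambda>n. from_lozi (to_lozi (q n))) \<longlonglongrightarrow> from_lozi (to_lozi p)" unfolding from_lozi_def using b0 by (intro tendsto_intros) auto
    then show "q \<longlonglongrightarrow> p" by simp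
  qed
  have st: "to_lozi p \<in> stable_manifold a b \<longleftrightarrow> (\<exists>n. 0 \<le> fst ((stp ^^ n) p) \<and> pf ((stp ^^ n) p) = 0)" for p
    unfolding stable_manifold_def special_points stable_iff[symmetric]
    by (simp add: lozi_iter_def lozi_iter_to_lozi cp)
  have un: "to_lozi p \<in> unstable_manifold a b \<longleftrightarrow> (\<exists>n s. 0 \<le> s \<and> s \<le> 1 \<and> p = F n s)" for p
  proof -
    define q where "q n = from_lozi ((inv (lozi a b) ^^ n) (to_lozi p))" for n
    have "to_lozi (stp (q (Suc n))) = to_lozi (q n)" for n
      unfolding lozi_to_lozi[symmetric] q_def by (simp add: lozi_inv)
    then have q: "stp (q (Suc n)) = q n" for n by (simp add: to_lozi_inj)
    have "lozi_iter a b (- int n) (to_lozi p) = to_lozi (q n)" for n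
      by (cases "n = 0") (simp_all add: lozi_iter_def q_def)
    then show ?thesis unfolding unstable_manifold_def special_points
      using unstable_iff[of q, OF q] cp[of q Xp] by (simp add: q_def)
  qed
  have "to_lozi p \<in> homoclinic_points a b \<longleftrightarrow> (\<exists>s. s0 < s \<and> s \<le> 1 \<and> (\<exists>n. land n s) \<and> p \<in> stp_orbit (T s))" for p
  proof
    assume "to_lozi p \<in> homoclinic_points a b"
    then have h: "p \<noteq> Xp" "\<exists>n. 0 \<le> fst ((stp ^^ n) p) \<and> pf ((stp ^^ n) p) = 0" "\<exists>n s. 0 \<le> s \<and> s \<le> 1 \<and> p = F n s"
      by (auto simp: homoclinic_points_def st un special_points to_lozi_inj)
    then obtain n s i where s: "0 \<le> s" "s \<le> 1" "p = F n s" and i: "0 \<le> fst ((stp ^^ i) p)" "pf ((stp ^^ i) p) = 0" by blast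
    have "s \<noteq> 0" using h(1) s F_Xp by metis
    then obtain s' m where m: "s0 < s'" "s' \<le> 1" "F m s = T s'" using fundamental[of s] s by auto
    have "F i' s = (stp ^^ (i' - n)) p" if "n \<le> i'" for i'
      using F_add[of "i' - n" n s] s(3) that by simp
    have "land (i + n) s" using i F_add[of i n s] s(3) by (simp add: land_def)
    then have "land (i + n + m) s" by (rule land_mono) simp
    moreover have "F (i + n + m) s = F (i + n) s'" unfolding F_add[of "i + n" m] m(3) by (simp add: F_def)
    ultimately have "land (i + n) s'" by (simp add: land_def)
    moreover have "stp_orbit p = stp_orbit (T s')" using stp_orbit_F[of n s] stp_orbit_F[of m s] s(3) m(3) by simp
    moreover have "p \<in> stp_orbit p" unfolding stp_orbit_def by blast
    ultimately show "\<exists>s. s0 < s \<and> s \<le> 1 \<and> (\<exists>n. land n s) \<and> p \<in> stp_orbit (T s)" using m by blast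
  next
    assume "\<exists>s. s0 < s \<and> s \<le> 1 \<and> (\<exists>n. land n s) \<and> p \<in> stp_orbit (T s)"
    then obtain s n m i where s: "s0 < s" "s \<le> 1" "land n s" "(stp ^^ m) (T s) = (stp ^^ i) p" by (auto simp: stp_orbit_def)
    have s01: "0 < s" using s s0 by simp
    have Fm: "F m s = (stp ^^ i) p" using s(4) by (simp add: F_def)
    have "land (n + m) s" using land_mono[OF s(3)] by simp
    moreover have "F (n + m) s = (stp ^^ (n + i)) p" unfolding F_add Fm by (simp add: funpow_add)
    ultimately have 1: "\<exists>n. 0 \<le> fst ((stp ^^ n) p) \<and> pf ((stp ^^ n) p) = 0" unfolding land_def by metis
    have 2: "\<exists>n s. 0 \<le> s \<and> s \<le> 1 \<and> p = F n s"
    proof -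
      have sk: "0 \<le> s * s0 ^ j \<and> s * s0 ^ j \<le> 1" for j
      proof -
        have "s * s0 ^ j \<le> 1 * 1" using s s0 s01 by (intro mult_mono power_le_one) auto
        then show ?thesis using s01 s0 by simp
      qed
      have "F (2 * j) (s * s0 ^ j) = T s" for j
      proof (induction j)
        case (Suc j)
        have "F 2 (s * s0 ^ j * s0) = T (s * s0 ^ j)" using T_two sk[of j] by (simp add: F_Suc numeral_2_eq_2)
        then have "F (2 * j + 2) (s * s0 ^ j * s0) = F (2 * j) (s * s0 ^ j)" unfolding F_add by (simp add: F_def)
        then show ?case using Suc by (simp add: ac_simps)
      qed simp
      then have "F (m + 2 * i) (s * s0 ^ i) = (stp ^^ i) p" unfolding F_add using s(4) by simp
      moreover have "F (m + 2 * i) (s * s0 ^ i) = (stp ^^ i) (F (m + i) (s * s0 ^ i))"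
        using F_add[of i "m + i" "s * s0 ^ i"] by (simp add: mult_2 add.assoc add.left_commute)
      ultimately have "p = F (m + i) (s * s0 ^ i)" by (simp add: stp_iter_inj)
      then show ?thesis using sk[of i] by blast
    qed
    have "p \<noteq> Xp"
    proof
      assume "p = Xp"
      then have "(stp ^^ m) (T s) = (stp ^^ m) Xp"
        using s(4) by (metis F_Xp F_def T_def add_0 diff_zero scale_one scale_zero_left add_0_right)
      then show False using pf_T(2)[of s] s01 pf_Xp by (simp add: stp_iter_inj)
    qed
    then show "to_lozi p \<in> homoclinic_points a b" using 1 2 by (simp add: homoclinic_points_def st un special_points to_lozi_inj)
  qed
  note mem = this
  show ?thesis
  proof (intro set_eqI)
    fix x
    have "x \<in> homoclinic_points a b \<longleftrightarrow> (\<exists>s. s0 < s \<and> s \<le> 1 \<and> (\<exists>n. land n s) \<and> from_lozi x \<in> stp_orbit (T s))"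
      using mem[of "from_lozi x"] by simp
    moreover have "from_lozi x \<in> stp_orbit (T s) \<longleftrightarrow> x \<in> to_lozi ` stp_orbit (T s)" for s
    proof
      assume "from_lozi x \<in> stp_orbit (T s)"
      then have "to_lozi (from_lozi x) \<in> to_lozi ` stp_orbit (T s)" by (rule imageI)
      then show "x \<in> to_lozi ` stp_orbit (T s)" by simp
    next
      assume "x \<in> to_lozi ` stp_orbit (T s)"
      then obtain q where "q \<in> stp_orbit (T s)" "x = to_lozi q" by (rule imageE)
      then show "from_lozi x \<in> stp_orbit (T s)" by simp
    qed
    ultimately show "x \<in> homoclinic_points a b \<longleftrightarrow> x \<in> (\<Union>s\<in>{s. s0 < s \<and> s \<le> 1 \<and> (\<exists>n. land n s)}. to_lozi ` stp_orbit (T s))" by simp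
  qed
qed

lemma parameter_iff: "(a, b) \<in> homoclinic_parameters \<longleftrightarrow> (\<exists>s n. s0 < s \<and> s \<le> 1 \<and> land n s)"
proof -
  have "p \<in> stp_orbit p" for p unfolding stp_orbit_def by blast
  then have "homoclinic_points a b \<noteq> {} \<longleftrightarrow> (\<exists>s n. s0 < s \<and> s \<le> 1 \<and> land n s)" unfolding homoclinic_eq by blast
  then show ?thesis using a0 b0 b1 by (simp add: homoclinic_parameters_def)
qed

text \<open>The segments of \<open>landing_set\<close> join \<open>V\<close> with \<open>F i
1\<close> or \<open>F i s0\<close>; these are iterates of \<open>Z\<close> because \<open>T
1\<close> is the image of \<open>Z\<close> and \<open>T s0\<close> is its preimage.\<close>
lemma classification:
  assumes nc: "\<And>B. no_crossing B" and ex: "\<exists>s n. s0 \<le> s \<and> s \<le> 1 \<and> land n s"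
  shows "homoclinic_points a b = lozi_orbit a b (Z_pt a b)
       \<or> homoclinic_points a b = lozi_orbit a b (V_pt a b)
       \<or> homoclinic_points a b = lozi_orbit a b (Z_pt a b) \<union> lozi_orbit a b (V_pt a b)
       \<or> (\<exists>k S. polygonal_segment (V_pt a b) (lozi_iter a b k (Z_pt a b)) S
              \<and> homoclinic_points a b = (\<Union>P\<in>S. lozi_orbit a b P))"
proof -
  \<comment> \<open>All landing parameters land by a common time, as the frontier argument shows for the constant sequence.\<close>
  have ok: "lozi_uv u l" by unfold_locales
  obtain N0 where N0: "Sb N0 < 0" using Sb_neg by blast
  then have N01: "1 \<le> N0" by (cases N0) auto
  have "\<exists>e>0. \<forall>\<^sub>F j::nat in sequentially. tau_bound e (2 * N0 + 1)"
    by (rule tau_bound_ev[where U="\<lambda>_. u" and L="\<lambda>_. l"]) (use ok tau_pos_odd[OF nc] in auto)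
  then obtain e where e: "e > 0" "tau_bound e (2 * N0 + 1)" by auto
  obtain Nn where "dY / e < u ^ Nn" using real_arch_pow[OF u1] by blast
  then have Nn: "dY < u ^ Nn * e" using e by (simp add: pos_divide_less_eq)
  define M where "M = 2 * N0 + 2 + Nn"
  have M: "land M s" if "s0 < s" "s \<le> 1" "land n s" for s n
    unfolding M_def using land_bound[OF _ N01 nc order_refl e(2,1) Nn that] N0 by simp
  define E where "E = {s. s0 < s \<and> s \<le> 1 \<and> (\<exists>n. land n s)}"
  have E: "s \<in> E \<longleftrightarrow> s0 < s \<and> s \<le> 1 \<and> land M s" for s using M by (auto simp: E_def)
  have H: "homoclinic_points a b = (\<Union>s\<in>E. to_lozi ` stp_orbit (T s))" unfolding E_def by (rule homoclinic_eq)
  have ZT: "F 1 s0 = Zp" "stp Zp = T 1" using T_s0' F_Suc[of 1 s0] by (simp_all add: numeral_2_eq_2)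
  have oZ: "stp_orbit (T 1) = stp_orbit Zp" using stp_orbit_eq[OF stp_orbit_I(1)[of 1 Zp]] ZT by simp
  have oV: "stp_orbit (T v) = stp_orbit Vp" if "F i v = Vp" for i v using stp_orbit_F[of i v] that by simp
  have oZ': "to_lozi ` stp_orbit (T 1) = lozi_orbit a b (Z_pt a b)" by (simp add: special_points orbit_to_lozi oZ)
  have land1: "land M 1" if "land n s0" for n
  proof -
    have "land (n + 2) s0" using land_mono[OF that] by simp
    moreover have "F (n + 2) s0 = F n 1" unfolding F_add T_s0' by (simp add: F_def)
    ultimately have "land n 1" by (simp add: land_def)
    then show ?thesis using M s0 by simp
  qed
  have seg: "polygonal_segment (to_lozi p) (to_lozi q) (to_lozi ` closed_segment p q)" if "p \<noteq> q" for p q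
  proof -
    have "linear to_lozi" by (intro linearI) (simp_all add: to_lozi_def algebra_simps)
    then have "closed_segment (to_lozi p) (to_lozi q) = to_lozi ` closed_segment p q" by (rule closed_segment_linear_image)
    moreover have "to_lozi p \<noteq> to_lozi q" using that by (simp add: to_lozi_inj)
    ultimately show ?thesis unfolding polygonal_segment_def
      by (intro exI[of _ "[to_lozi p, to_lozi q]"]) (simp add: arc_linepath)
  qed
  have orbs: "(\<Union>P\<in>to_lozi ` F i ` A. lozi_orbit a b P) = (\<Union>s\<in>A. to_lozi ` stp_orbit (T s))" for i A
    by (simp add: orbit_to_lozi stp_orbit_F)
  have "\<forall>s n. s0 < s \<longrightarrow> s \<le> 1 \<longrightarrow> land n s \<longrightarrow> land M s" using M by blast
  from landing_set[OF nc this] show ?thesis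
  proof (elim disjE exE conjE)
    assume none: "\<forall>s. s0 < s \<and> s < 1 \<longrightarrow> \<not> land M s"
    obtain s n where s: "s0 \<le> s" "s \<le> 1" "land n s" using ex by blast
    have "land M 1"
    proof (cases "s = s0")
      case True then show ?thesis using land1 s(3) by simp
    next
      case False
      then have "land M s" using M s by simp
      then have "s = 1" using none s False by force
      then show ?thesis using \<open>land M s\<close> by simp
    qed
    then have "E = {1}" using none s0 E by (auto simp: set_eq_iff le_less)
    then show ?thesis using H oZ' by simp
  next
    fix v i assume v: "s0 < v" "v < 1" "F i v = Vp" and iff: "\<forall>s. s0 < s \<and> s < 1 \<longrightarrow> (land M s \<longleftrightarrow> s = v)"
    have "s \<in> E \<longleftrightarrow> s = v \<or> (s = 1 \<and> land M 1)" for s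
    proof (cases "s = 1")
      case True then show ?thesis using E[of 1] s0 v by auto
    next
      case False then show ?thesis using E[of s] iff v by (cases "s < 1") auto
    qed
    then have EE: "E = insert v (if land M 1 then {1} else {})" by auto
    have oV': "to_lozi ` stp_orbit (T v) = lozi_orbit a b (V_pt a b)" by (simp add: special_points orbit_to_lozi oV[OF v(3)])
    show ?thesis
    proof (cases "land M 1")
      case True
      then have "homoclinic_points a b = lozi_orbit a b (Z_pt a b) \<union> lozi_orbit a b (V_pt a b)"
        unfolding H EE using oV' oZ' by auto
      then show ?thesis by blast
    next
      case False
      then have "homoclinic_points a b = lozi_orbit a b (V_pt a b)" unfolding H EE using oV' by simp
      then show ?thesis by blast
    qed
  next
    fix v i assume v: "s0 < v" "v < 1" "F i v = Vp" and l1: "land M 1"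
      and iff: "\<forall>s. s0 < s \<and> s < 1 \<longrightarrow> (land M s \<longleftrightarrow> v \<le> s)" and sg: "F i ` {v..1} = closed_segment Vp (F i 1)"
    have "s \<in> E \<longleftrightarrow> s \<in> {v..1}" for s
    proof (cases "s = 1")
      case True then show ?thesis using E[of 1] s0 l1 v by simp
    next
      case False then show ?thesis using E[of s] iff v by (cases "s < 1") auto
    qed
    then have EE: "E = {v..1}" by (rule set_eqI)
    have ne: "Vp \<noteq> F i 1"
    proof
      assume "Vp = F i 1"
      then have "F (i + 0) v = F (i + 0) 1" using v by simp
      then show False unfolding F_cancel using T_inj v by simp
    qed
    have "lozi_iter a b (int (i + 1)) (Z_pt a b) = to_lozi ((stp ^^ (i + 1)) Zp)"
      unfolding special_points lozi_iter_to_lozi[symmetric] by (simp add: lozi_iter_def nat_add_distrib del: funpow.simps)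
    also have "(stp ^^ (i + 1)) Zp = (stp ^^ i) (stp Zp)" by (simp add: funpow_swap1)
    also have "\<dots> = F i 1" unfolding ZT F_def ..
    finally have k: "lozi_iter a b (int (i + 1)) (Z_pt a b) = to_lozi (F i 1)" .
    have "polygonal_segment (V_pt a b) (lozi_iter a b (int (i + 1)) (Z_pt a b)) (to_lozi ` F i ` {v..1})"
      unfolding k sg special_points(3) by (rule seg[OF ne])
    moreover have "homoclinic_points a b = (\<Union>P\<in>to_lozi ` F i ` {v..1}. lozi_orbit a b P)" unfolding orbs H EE ..
    ultimately show ?thesis by blast
  next
    fix v i assume v: "s0 < v" "v < 1" "F i v = Vp" and l0: "land M s0"
      and iff: "\<forall>s. s0 < s \<and> s < 1 \<longrightarrow> (land M s \<longleftrightarrow> s \<le> v)" and sg: "F i ` {s0..v} = closed_segment Vp (F i s0)"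
    have L1: "land M 1" using land1 l0 .
    have "s \<in> E \<longleftrightarrow> s \<in> insert 1 {s0<..v}" for s
    proof (cases "s = 1")
      case True then show ?thesis using E[of 1] s0 L1 by simp
    next
      case False then show ?thesis using E[of s] iff v by (cases "s < 1") auto
    qed
    then have EE: "E = insert 1 {s0<..v}" by (rule set_eqI)
    have "stp_orbit (T 1) = stp_orbit (T s0)" using stp_orbit_F[of 2 s0] T_s0' by simp
    then have "(\<Union>s\<in>E. to_lozi ` stp_orbit (T s)) = (\<Union>s\<in>insert s0 {s0<..v}. to_lozi ` stp_orbit (T s))" unfolding EE by simp
    also have "insert s0 {s0<..v} = {s0..v}" using v by auto
    finally have H2: "homoclinic_points a b = (\<Union>s\<in>{s0..v}. to_lozi ` stp_orbit (T s))" using H by simp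
    have ne: "Vp \<noteq> F i s0"
    proof
      assume "Vp = F i s0"
      then have "F (i + 0) v = F (i + 0) s0" using v by simp
      then show False unfolding F_cancel using T_inj v by simp
    qed
    have k: "lozi_iter a b (int i - 1) (Z_pt a b) = to_lozi (F i s0)"
    proof (cases i)
      case 0
      have "lozi a b (to_lozi (T s0)) = to_lozi Zp" unfolding lozi_to_lozi using T_s0' F_Suc[of 0 s0] by simp
      then have "inv (lozi a b) (to_lozi Zp) = to_lozi (T s0)" using lozi_inv(2) by metis
      then show ?thesis by (simp add: 0 lozi_iter_def special_points)
    next
      case (Suc j)
      have "F (j + 1) s0 = (stp ^^ j) Zp" unfolding F_add ZT ..
      then show ?thesis unfolding special_points by (simp add: Suc lozi_iter_def lozi_iter_to_lozi)
    qed
    have "polygonal_segment (V_pt a b) (lozi_iter a b (int i - 1) (Z_pt a b)) (to_lozi ` F i ` {s0..v})"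
      unfolding k sg special_points(3) by (rule seg[OF ne])
    moreover have "homoclinic_points a b = (\<Union>P\<in>to_lozi ` F i ` {s0..v}. lozi_orbit a b P)" unfolding orbs H2 ..
    ultimately show ?thesis by blast
  qed
qed

end

section \<open>Parameters on the frontier\<close>

text \<open>The absolute values of the eigenvalues at \<open>X\<close>.\<close>
definition uf :: "real \<Rightarrow> real \<Rightarrow> real" where "uf a b = (sqrt (a\<^sup>2 + 4 * b) + a) / 2"
definition lf :: "real \<Rightarrow> real \<Rightarrow> real" where "lf a b = (sqrt (a\<^sup>2 + 4 * b) - a) / 2"

lemma uf_lf:
  assumes "0 < b" "b < 1" "1 < a + b"
  shows "lozi_uv (uf a b) (lf a b)" "lozi_uv.a (uf a b) (lf a b) = a" "lozi_uv.b (uf a b) (lf a b) = b"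
proof -
  have sq: "(sqrt (a\<^sup>2 + 4 * b))\<^sup>2 = a\<^sup>2 + 4 * b" using assms by simp
  have ul: "uf a b * lf a b = b" using sq by (simp add: uf_def lf_def field_simps power2_eq_square)
  have "(2 - a)\<^sup>2 < a\<^sup>2 + 4 * b" using assms by (simp add: power2_eq_square algebra_simps)
  then have "2 - a < sqrt (a\<^sup>2 + 4 * b)" by (rule real_less_rsqrt)
  then have u: "1 < uf a b" by (simp add: uf_def)
  have "a < sqrt (a\<^sup>2 + 4 * b)" using assms by (intro real_less_rsqrt) simp
  then have l: "0 < lf a b" by (simp add: lf_def)
  show ok: "lozi_uv (uf a b) (lf a b)" by unfold_locales (use u l ul assms in auto)
  show "lozi_uv.a (uf a b) (lf a b) = a" unfolding lozi_uv.a_def[OF ok] by (simp add: uf_def lf_def field_simps)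
  show "lozi_uv.b (uf a b) (lf a b) = b" unfolding lozi_uv.b_def[OF ok] by (rule ul)
qed

lemma approximating_parameters:
  assumes cl: "(a, b) \<in> closure K" and ab: "0 < b" "b < 1" "1 < a + b"
  obtains U L where "\<And>j::nat. lozi_uv (U j) (L j)" "U \<longlonglongrightarrow> uf a b" "L \<longlonglongrightarrow> lf a b"
    "\<And>j. (lozi_uv.a (U j) (L j), lozi_uv.b (U j) (L j)) \<in> K"
proof -
  obtain p where p: "\<And>n. p n \<in> K" "p \<longlonglongrightarrow> (a, b)" using cl unfolding closure_sequential by blast
  have t: "(\<lambda>n. fst (p n)) \<longlonglongrightarrow> a" "(\<lambda>n. snd (p n)) \<longlonglongrightarrow> b"
    using tendsto_fst[OF p(2)] tendsto_snd[OF p(2)] by simp_all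
  have "\<forall>\<^sub>F n in sequentially. 0 < snd (p n)" "\<forall>\<^sub>F n in sequentially. snd (p n) < 1"
    "\<forall>\<^sub>F n in sequentially. 1 < fst (p n) + snd (p n)"
    using ab order_tendstoD[OF t(2)] order_tendstoD[OF tendsto_add[OF t]] by auto
  then have "\<forall>\<^sub>F n in sequentially. 0 < snd (p n) \<and> snd (p n) < 1 \<and> 1 < fst (p n) + snd (p n)"
    by eventually_elim simp
  then obtain N where N: "\<And>n. N \<le> n \<Longrightarrow> 0 < snd (p n) \<and> snd (p n) < 1 \<and> 1 < fst (p n) + snd (p n)"
    by (auto simp: eventually_sequentially)
  define A B where "A j = fst (p (j + N))" and "B j = snd (p (j + N))" for j
  have AB: "0 < B j" "B j < 1" "1 < A j + B j" for j using N[of "j + N"] by (auto simp: A_def B_def)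
  have At: "A \<longlonglongrightarrow> a" "B \<longlonglongrightarrow> b" unfolding A_def B_def using t by (auto intro: LIMSEQ_ignore_initial_segment)
  show thesis
  proof (rule that[of "\<lambda>j. uf (A j) (B j)" "\<lambda>j. lf (A j) (B j)"])
    show "lozi_uv (uf (A j) (B j)) (lf (A j) (B j))" for j using uf_lf AB by blast
    show "(\<lambda>j. uf (A j) (B j)) \<longlonglongrightarrow> uf a b" "(\<lambda>j. lf (A j) (B j)) \<longlonglongrightarrow> lf a b"
      unfolding uf_def lf_def by (intro tendsto_intros At; simp)+
    show "(lozi_uv.a (uf (A j) (B j)) (lf (A j) (B j)), lozi_uv.b (uf (A j) (B j)) (lf (A j) (B j))) \<in> K" for j
      using uf_lf(2,3)[OF AB] p(1) by (simp add: A_def B_def)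
  qed
qed

theorem theorem1p1:
  fixes a b :: real
  assumes "(a, b) \<in> frontier homoclinic_parameters"
    and "0 < b" and "b < 1" and "a + b > 1"
  shows "homoclinic_points a b = lozi_orbit a b (Z_pt a b)
       \<or> homoclinic_points a b = lozi_orbit a b (V_pt a b)
       \<or> homoclinic_points a b = lozi_orbit a b (Z_pt a b) \<union> lozi_orbit a b (V_pt a b)
       \<or> (\<exists>k S. polygonal_segment (V_pt a b) (lozi_iter a b k (Z_pt a b)) S
              \<and> homoclinic_points a b = (\<Union>P\<in>S. lozi_orbit a b P))"
proof -
  have ab: "0 < b" "b < 1" "1 < a + b" using assms by auto
  interpret X: lozi_uv "uf a b" "lf a b" by (rule uf_lf(1)[OF ab])
  note ok0 = X.lozi_uv_axioms
  have nc: "X.no_crossing B" for B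
  proof (rule ccontr)
    assume n: "\<not> X.no_crossing B"
    have "(a, b) \<in> closure (- homoclinic_parameters)"
      using assms(1) by (simp add: frontier_def closure_complement)
    then obtain U L where UL: "\<And>j::nat. lozi_uv (U j) (L j)" "U \<longlonglongrightarrow> uf a b" "L \<longlonglongrightarrow> lf a b"
      "\<And>j. (lozi_uv.a (U j) (L j), lozi_uv.b (U j) (L j)) \<in> - homoclinic_parameters"
      using approximating_parameters ab by blast
    obtain j where j: "\<not> lozi_uv.no_crossing (U j) (L j) B"
      using not_no_crossing_ev[OF UL(1) ok0 UL(2,3) n] by (auto simp: eventually_sequentially)
    have "(lozi_uv.a (U j) (L j), lozi_uv.b (U j) (L j)) \<in> homoclinic_parameters"
      using lozi_uv.not_no_crossing_land[OF UL(1) j] lozi_uv.parameter_iff[OF UL(1), of j] by blast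
    then show False using UL(4)[of j] by simp
  qed
  have "(a, b) \<in> closure homoclinic_parameters" using assms(1) by (simp add: frontier_def)
  then obtain U L where UL: "\<And>j::nat. lozi_uv (U j) (L j)" "U \<longlonglongrightarrow> uf a b" "L \<longlonglongrightarrow> lf a b"
      "\<And>j. (lozi_uv.a (U j) (L j), lozi_uv.b (U j) (L j)) \<in> homoclinic_parameters"
    using approximating_parameters ab by blast
  have "\<exists>s n. X.s0 \<le> s \<and> s \<le> 1 \<and> X.land n s"
    by (rule limit_land[OF UL(1) ok0 UL(2,3) nc]) (use UL(4) lozi_uv.parameter_iff[OF UL(1)] in blast)
  then show ?thesis using X.classification[OF nc] unfolding uf_lf(2,3)[OF ab] by blast
qed

end
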